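(* For every partition $\lambda$, $\mathbf{S}_{[\lambda]}\mathbf{W}$ is an irreducible $H$-module.
   Context: $\mathbf{V}$ is the complex vector space with countable basis $\{e_i,f_i\}_{i\ge1}$; $\mathbf{GL}$ is the group of automorphisms of $\mathbf{V}$ fixing all but finitely many basis vectors; $\omega$ is the alternating form on $\mathbf{V}$ with $\omega(e_i,f_j)=\delta_{i,j}$, $\omega(e_i,e_j)=\omega(f_i,f_j)=0$; $\mathbf{Sp}\subset\mathbf{GL}$ is the subgroup preserving $\omega$; $\xi:\mathbf{V}\to\mathbf{C}$ is the functional with $\xi(e_i)=\xi(f_i)=1$ for all $i$; $H\subset\mathbf{Sp}$ is the stabilizer of $\xi$. $\mathbf{W}=\ker\xi$, with the alternating form obtained by restricting $\omega$. For $d\ge0$, $\mathbf{W}^{[d]}\subset\mathbf{W}^{\otimes d}$ is the intersection of the kernels of all contraction maps $\mathbf{W}^{\otimes d}\to\mathbf{W}^{\otimes(d-2)}$ that apply $\omega$ to the $i$th and $j$th tensor factors, $1\le i<j\le d$. For a partition $\lambda$ of $d$, choose an embedding of the Schur functor $\mathbf{S}_\lambda(\mathbf{W})\subset\mathbf{W}^{\otimes d}$ and set $\mathbf{S}_{[\lambda]}\mathbf{W}=\mathbf{S}_\lambda(\mathbf{W})\cap\mathbf{W}^{[d]}$. *)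

theory Defs
  imports Complex_Main "HOL-Library.Poly_Mapping" "HOL-Combinatorics.Permutations"
begin

section \<open>Complex vector spaces with a given basis\<close>

text \<open>
  The complex vector space with basis a type \<open>'k\<close> is the type of finitely supported
  functions \<open>'k \<Rightarrow>\<^sub>0 complex\<close>; its basis vectors are \<open>Poly_Mapping.single k 1\<close>.
\<close>

definition cscale :: "complex \<Rightarrow> ('k \<Rightarrow>\<^sub>0 complex) \<Rightarrow> ('k \<Rightarrow>\<^sub>0 complex)"  (infixr "*\<^sub>C" 75)
  where "c *\<^sub>C x = Poly_Mapping.map ((*) c) x"

abbreviation bvec :: "'k \<Rightarrow> ('k \<Rightarrow>\<^sub>0 complex)"
  where "bvec k \<equiv> Poly_Mapping.single k 1"

lemma lookup_cscale [simp]: "Poly_Mapping.lookup (c *\<^sub>C x) k = c * Poly_Mapping.lookup x k"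
  by (cases "Poly_Mapping.lookup x k = 0") (simp_all add: cscale_def Poly_Mapping.map.rep_eq)

interpretation cvec: vector_space "cscale :: complex \<Rightarrow> ('k \<Rightarrow>\<^sub>0 complex) \<Rightarrow> ('k \<Rightarrow>\<^sub>0 complex)"
  by unfold_locales (auto intro!: poly_mapping_eqI simp: lookup_add algebra_simps)

abbreviation clinear :: "(('k \<Rightarrow>\<^sub>0 complex) \<Rightarrow> ('l \<Rightarrow>\<^sub>0 complex)) \<Rightarrow> bool"
  where "clinear \<equiv> Vector_Spaces.linear cscale cscale"

text \<open>The linear map with prescribed values \<open>b\<close> on the basis vectors.\<close>

definition lin_ext :: "('k \<Rightarrow> ('l \<Rightarrow>\<^sub>0 complex)) \<Rightarrow> ('k \<Rightarrow>\<^sub>0 complex) \<Rightarrow> ('l \<Rightarrow>\<^sub>0 complex)"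
  where "lin_ext b x = (\<Sum>k\<in>Poly_Mapping.keys x. Poly_Mapping.lookup x k *\<^sub>C b k)"

lemma lin_ext_superset:
  assumes "finite K" "Poly_Mapping.keys x \<subseteq> K"
  shows "lin_ext b x = (\<Sum>k\<in>K. Poly_Mapping.lookup x k *\<^sub>C b k)"
  unfolding lin_ext_def
  by (rule sum.mono_neutral_left) (use assms in \<open>auto simp: in_keys_iff\<close>)

lemma lin_ext_bvec [simp]: "lin_ext b (bvec k) = b k"
  by (simp add: lin_ext_def)

lemma clinear_iff:
  "clinear f \<longleftrightarrow> (\<forall>x y. f (x + y) = f x + f y) \<and> (\<forall>c x. f (c *\<^sub>C x) = c *\<^sub>C f x)"
  by (simp only: Vector_Spaces.linear_iff cvec.vector_space_axioms simp_thms)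

lemma clinear_lin_ext: "clinear (lin_ext b)"
  unfolding clinear_iff
proof (intro conjI allI)
  fix x y :: "'a \<Rightarrow>\<^sub>0 complex"
  let ?K = "Poly_Mapping.keys x \<union> Poly_Mapping.keys y"
  have "Poly_Mapping.keys (x + y) \<subseteq> ?K" by (rule keys_add)
  then show "lin_ext b (x + y) = lin_ext b x + lin_ext b y"
    by (simp add: lin_ext_superset[where K = ?K] lookup_add cvec.scale_left_distrib sum.distrib)
next
  fix c and x :: "'a \<Rightarrow>\<^sub>0 complex"
  have "Poly_Mapping.keys (c *\<^sub>C x) \<subseteq> Poly_Mapping.keys x" by (auto simp: in_keys_iff)
  then show "lin_ext b (c *\<^sub>C x) = c *\<^sub>C lin_ext b x"
    by (simp add: lin_ext_superset[where K = "Poly_Mapping.keys x"] cvec.scale_sum_right)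
qed

section \<open>The symplectic space and the group \<open>H\<close>\<close>

text \<open>The indices of the basis vectors \<open>e\<^sub>i\<close>, \<open>f\<^sub>i\<close> start at \<open>0\<close> instead of \<open>1\<close>.\<close>

datatype idx = E nat | F nat

type_synonym V = "idx \<Rightarrow>\<^sub>0 complex"

fun omega_basis :: "idx \<Rightarrow> idx \<Rightarrow> complex" where
  "omega_basis (E i) (F j) = (if i = j then 1 else 0)"
| "omega_basis (F i) (E j) = (if i = j then -1 else 0)"
| "omega_basis (E i) (E j) = 0"
| "omega_basis (F i) (F j) = 0"

definition omega :: "V \<Rightarrow> V \<Rightarrow> complex"
  where "omega v w = (\<Sum>k\<in>Poly_Mapping.keys v. \<Sum>l\<in>Poly_Mapping.keys w.
    Poly_Mapping.lookup v k * Poly_Mapping.lookup w l * omega_basis k l)"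

definition xi :: "V \<Rightarrow> complex"
  where "xi v = (\<Sum>k\<in>Poly_Mapping.keys v. Poly_Mapping.lookup v k)"

definition GL :: "(V \<Rightarrow> V) set"
  where "GL = {g. clinear g \<and> bij g \<and> finite {k. g (bvec k) \<noteq> bvec k}}"

definition Sp :: "(V \<Rightarrow> V) set"
  where "Sp = {g \<in> GL. \<forall>v w. omega (g v) (g w) = omega v w}"

definition H :: "(V \<Rightarrow> V) set"
  where "H = {g \<in> Sp. \<forall>v. xi (g v) = xi v}"

definition W :: "V set"
  where "W = {v. xi v = 0}"

section \<open>Tensor powers\<close>

text \<open>
  The tensor algebra of the space with basis \<open>'k\<close> is the space with basis the words in \<open>'k\<close>;
  its part of degree \<open>d\<close> is spanned by the words of length \<open>d\<close>. For a subspace \<open>U\<close>,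
  the tensor power of \<open>U\<close> is identified with its image in that of the whole space.
\<close>

fun tensor :: "('k \<Rightarrow>\<^sub>0 complex) list \<Rightarrow> ('k list \<Rightarrow>\<^sub>0 complex)" where
  "tensor [] = bvec []"
| "tensor (v # vs) = lin_ext (\<lambda>k. lin_ext (\<lambda>ks. bvec (k # ks)) (tensor vs)) v"

definition tpower :: "('k \<Rightarrow>\<^sub>0 complex) set \<Rightarrow> nat \<Rightarrow> ('k list \<Rightarrow>\<^sub>0 complex) set"
  where "tpower U d = cvec.span {tensor vs |vs. length vs = d \<and> set vs \<subseteq> U}"

text \<open>For linear \<open>g\<close>, the map acting on every tensor power as \<open>g \<otimes> \<dots> \<otimes> g\<close>.\<close>

definition tmap :: "(('k \<Rightarrow>\<^sub>0 complex) \<Rightarrow> ('k \<Rightarrow>\<^sub>0 complex))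
    \<Rightarrow> ('k list \<Rightarrow>\<^sub>0 complex) \<Rightarrow> ('k list \<Rightarrow>\<^sub>0 complex)"
  where "tmap g = lin_ext (\<lambda>ks. tensor (map (\<lambda>k. g (bvec k)) ks))"

text \<open>
  The right action of permutations of the tensor positions \<open>0, \<dots>, d - 1\<close>, sending
  \<open>v\<^sub>0 \<otimes> \<dots> \<otimes> v\<^sub>d\<^sub>-\<^sub>1\<close> to \<open>v\<^sub>\<sigma>\<^sub>(\<^sub>0\<^sub>) \<otimes> \<dots> \<otimes> v\<^sub>\<sigma>\<^sub>(\<^sub>d\<^sub>-\<^sub>1\<^sub>)\<close>.
\<close>

definition tperm :: "(nat \<Rightarrow> nat) \<Rightarrow> ('k list \<Rightarrow>\<^sub>0 complex) \<Rightarrow> ('k list \<Rightarrow>\<^sub>0 complex)"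
  where "tperm \<sigma> = lin_ext (\<lambda>ks. bvec (permute_list \<sigma> ks))"

definition contract :: "nat \<Rightarrow> nat \<Rightarrow> (idx list \<Rightarrow>\<^sub>0 complex) \<Rightarrow> (idx list \<Rightarrow>\<^sub>0 complex)"
  where "contract i j = lin_ext (\<lambda>ks. omega_basis (ks ! i) (ks ! j) *\<^sub>C bvec (nths ks (- {i, j})))"

definition traceless :: "nat \<Rightarrow> (idx list \<Rightarrow>\<^sub>0 complex) set"
  where "traceless d = {x \<in> tpower W d. \<forall>i j. i < j \<and> j < d \<longrightarrow> contract i j x = 0}"

section \<open>Schur functors\<close>

definition is_partition :: "nat list \<Rightarrow> bool"
  where "is_partition p \<longleftrightarrow> sorted_wrt (\<ge>) p \<and> 0 \<notin> set p"

text \<open>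
  The cells of the Young diagram in row reading order; the tensor position \<open>m\<close> is put
  into the cell \<open>cells p ! m\<close>.
\<close>

definition cells :: "nat list \<Rightarrow> (nat \<times> nat) list"
  where "cells p = concat (map (\<lambda>i. map (\<lambda>j. (i, j)) [0..<p ! i]) [0..<length p])"

definition row_group :: "nat list \<Rightarrow> (nat \<Rightarrow> nat) set"
  where "row_group p = {\<sigma>. \<sigma> permutes {..<sum_list p} \<and>
    (\<forall>m<sum_list p. fst (cells p ! \<sigma> m) = fst (cells p ! m))}"

definition col_group :: "nat list \<Rightarrow> (nat \<Rightarrow> nat) set"
  where "col_group p = {\<tau>. \<tau> permutes {..<sum_list p} \<and>
    (\<forall>m<sum_list p. snd (cells p ! \<tau> m) = snd (cells p ! m))}"

text \<open>
  The right action of the Young symmetrizer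
  \<open>(\<Sum>\<sigma>\<in>row_group p. \<sigma>) * (\<Sum>\<tau>\<in>col_group p. sign \<tau> * \<tau>)\<close>.
\<close>

definition young_sym :: "nat list \<Rightarrow> ('k list \<Rightarrow>\<^sub>0 complex) \<Rightarrow> ('k list \<Rightarrow>\<^sub>0 complex)"
  where "young_sym p x =
    (\<Sum>\<sigma>\<in>row_group p. \<Sum>\<tau>\<in>col_group p. of_int (sign \<tau>) *\<^sub>C tperm (\<sigma> \<circ> \<tau>) x)"

definition schur :: "nat list \<Rightarrow> ('k \<Rightarrow>\<^sub>0 complex) set \<Rightarrow> ('k list \<Rightarrow>\<^sub>0 complex) set"
  where "schur p U = young_sym p ` tpower U (sum_list p)"

text \<open>
  Embeddings of the Schur functor into the tensor power functor, evaluated at \<open>U\<close>: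
  injective linear maps commuting with all linear endomorphisms of \<open>U\<close>. As every linear map
  on a subspace extends to the whole space, it is no restriction to let \<open>\<phi>\<close> and \<open>g\<close> be
  defined everywhere; only their values on \<open>schur p U\<close> and \<open>U\<close> matter.
\<close>

definition schur_embedding ::
    "nat list \<Rightarrow> ('k \<Rightarrow>\<^sub>0 complex) set \<Rightarrow> (('k list \<Rightarrow>\<^sub>0 complex) \<Rightarrow> ('k list \<Rightarrow>\<^sub>0 complex)) \<Rightarrow> bool"
  where "schur_embedding p U \<phi> \<longleftrightarrow>
    clinear \<phi> \<and> inj_on \<phi> (schur p U) \<and> \<phi> ` schur p U \<subseteq> tpower U (sum_list p) \<and>
    (\<forall>g. clinear g \<and> g ` U \<subseteq> U \<longrightarrow> (\<forall>x\<in>schur p U. \<phi> (tmap g x) = tmap g (\<phi> x)))"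

definition schur_traceless ::
    "nat list \<Rightarrow> ((idx list \<Rightarrow>\<^sub>0 complex) \<Rightarrow> (idx list \<Rightarrow>\<^sub>0 complex)) \<Rightarrow> (idx list \<Rightarrow>\<^sub>0 complex) set"
  where "schur_traceless p \<phi> = \<phi> ` schur p W \<inter> traceless (sum_list p)"

section \<open>Irreducible modules\<close>

definition submodule_under ::
    "'g set \<Rightarrow> ('g \<Rightarrow> ('k \<Rightarrow>\<^sub>0 complex) \<Rightarrow> ('k \<Rightarrow>\<^sub>0 complex)) \<Rightarrow> ('k \<Rightarrow>\<^sub>0 complex) set \<Rightarrow> bool"
  where "submodule_under G act M \<longleftrightarrow> cvec.subspace M \<and> (\<forall>g\<in>G. \<forall>x\<in>M. act g x \<in> M)"

definition irreducible_module ::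
    "'g set \<Rightarrow> ('g \<Rightarrow> ('k \<Rightarrow>\<^sub>0 complex) \<Rightarrow> ('k \<Rightarrow>\<^sub>0 complex)) \<Rightarrow> ('k \<Rightarrow>\<^sub>0 complex) set \<Rightarrow> bool"
  where "irreducible_module G act M \<longleftrightarrow> submodule_under G act M \<and> M \<noteq> {0} \<and>
    (\<forall>N. submodule_under G act N \<and> N \<subseteq> M \<longrightarrow> N = {0} \<or> N = M)"

end

theory Submission
  imports Defs "HOL-Combinatorics.Multiset_Permutations"
begin

text \<open>
  For orthogonal \<open>l, u \<in> W\<close> the operator \<open>X v = \<omega>(v, u) l + \<omega>(v, l) u\<close> has square zero and
  \<open>1 + t X\<close> lies in \<open>H\<close>; comparing coefficients of \<open>t\<close>, every submodule of the tensor power is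
  closed under the derivation extending \<open>X\<close>. Since \<open>W\<close> is infinite-dimensional, there are isotropic
  vectors \<open>l\<^sub>0, \<dots>, l\<^sub>d\<^sub>-\<^sub>1\<close> of \<open>W\<close> orthogonal to any given finite set of basis vectors; let
  \<open>L = l\<^sub>0 \<otimes> \<dots> \<otimes> l\<^sub>d\<^sub>-\<^sub>1\<close>.

  Starting with a nonzero element of a submodule \<open>N\<close>, such derivations replace its tensor factors one
  by one by the \<open>l\<^sub>i\<close> and produce a nonzero element \<open>Q L\<close> of \<open>N\<close>, where \<open>Q\<close> lies in the group algebra of
  the symmetric group; then also \<open>Q P L \<in> N\<close> for every \<open>P\<close> in the group algebra. If \<open>N\<close> is contained
  in the image of a Young symmetrizer \<open>c\<close>, it follows from \<open>c P c \<in> \<complex> c\<close> and from the Hermitian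
  structure on the group algebra that \<open>c L \<in> N\<close>. Conversely, derivations replace the factors \<open>l\<^sub>i\<close> of
  \<open>L\<close> one by one by the factors of a traceless tensor \<open>x\<close>: all unwanted terms are contractions of
  \<open>x\<close> and vanish. Hence \<open>c L\<close> generates all traceless tensors in the image of \<open>c\<close>.

  Finally, an embedding of the Schur functor is given by an element of the group algebra with a
  left inverse on the image of \<open>c\<close>, so it preserves and reflects tracelessness.
\<close>

section \<open>Linear algebra\<close>

text \<open>No basis vector lies in \<open>W\<close>, so operators coming from \<open>H\<close>
  cannot address single coordinates directly. The remedy is room at infinity: tensors have finite
  support, and each auxiliary vector is a difference of two basis vectors, one of which carries the
  wanted pairing while the other serves to annihilate \<open>xi\<close> and has an index that is out
  of reach of the other vectors involved. If the given tensors use indices below n, the isotropic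
  vectors occupy the indices from n to n + 2d - 1, and n + 2d is the index of the corrections.

  Nonvanishing on the side of the symmetric group comes from positive definiteness. Permutations are
  unitary, so every element Q has an adjoint Q' in the group algebra, and Q Q' Q x = 0 forces Q x =
  0. For the symmetrizer c this makes c c' a nonzero scalar s on the image of c, so that c' / s is a
  section of c inside the group algebra, whose elements preserve tracelessness. Since the group
  algebra acts freely on L, an operator identity can be tested on the single tensor L and then
  applied to any other tensor.\<close>

lemma clinear_add: "clinear f \<Longrightarrow> f (x + y) = f x + f y"
  and clinear_scale: "clinear f \<Longrightarrow> f (c *\<^sub>C x) = c *\<^sub>C f x"
  by (simp_all add: clinear_iff)

lemma clinear_0: "clinear f \<Longrightarrow> f 0 = 0"
  using clinear_scale[of f 0 0] by simp

lemma clinear_minus: "clinear f \<Longrightarrow> f (- x) = - f x"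
  using clinear_scale[of f "- 1" x] by simp

lemma clinear_diff: "clinear f \<Longrightarrow> f (x - y) = f x - f y"
  using clinear_add[of f x "- y"] clinear_minus[of f y] by simp

lemma clinear_sum: "clinear f \<Longrightarrow> f (sum h A) = (\<Sum>a\<in>A. f (h a))"
  by (induction A rule: infinite_finite_induct) (simp_all add: clinear_0 clinear_add)

lemmas clinear_simps = clinear_add clinear_scale clinear_0 clinear_minus clinear_diff clinear_sum

lemma clinearI:
  assumes "\<And>x y. f (x + y) = f x + f y" "\<And>c x. f (c *\<^sub>C x) = c *\<^sub>C f x"
  shows "clinear f"
  using assms by (simp add: clinear_iff)

lemma lookup_bvec: "Poly_Mapping.lookup (bvec k) l = (if k = l then 1 else 0)"
  by (simp add: lookup_single when_def)

lemma bvec_expand: "x = (\<Sum>k\<in>Poly_Mapping.keys x. Poly_Mapping.lookup x k *\<^sub>C bvec k)"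
proof (rule poly_mapping_eqI)
  fix l
  have "(\<Sum>k\<in>Poly_Mapping.keys x. Poly_Mapping.lookup x k * (if k = l then 1 else 0)) =
      Poly_Mapping.lookup x l"
    by (simp add: sum.delta if_distrib[of "(*) _"] in_keys_iff cong: if_cong)
  then show "Poly_Mapping.lookup x l =
      Poly_Mapping.lookup (\<Sum>k\<in>Poly_Mapping.keys x. Poly_Mapping.lookup x k *\<^sub>C bvec k) l"
    by (simp add: lookup_sum lookup_bvec)
qed

lemma clinear_conv_lin_ext:
  assumes "clinear f"
  shows "f x = lin_ext (\<lambda>k. f (bvec k)) x"
proof -
  have "f x = f (\<Sum>k\<in>Poly_Mapping.keys x. Poly_Mapping.lookup x k *\<^sub>C bvec k)"
    by (rule arg_cong[OF bvec_expand])
  then show ?thesis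
    by (simp only: clinear_sum[OF assms] clinear_scale[OF assms] lin_ext_def)
qed

lemma clinear_eq_keys:
  assumes "clinear f" "clinear g" "\<And>k. k \<in> Poly_Mapping.keys x \<Longrightarrow> f (bvec k) = g (bvec k)"
  shows "f x = g x"
proof -
  have "lin_ext (\<lambda>k. f (bvec k)) x = lin_ext (\<lambda>k. g (bvec k)) x"
    unfolding lin_ext_def by (rule sum.cong) (simp_all only: assms(3))
  then show ?thesis
    by (simp only: clinear_conv_lin_ext[OF assms(1), of x] clinear_conv_lin_ext[OF assms(2), of x])
qed

lemma clinear_eq_basis:
  assumes "clinear f" "clinear g" "\<And>k. f (bvec k) = g (bvec k)"
  shows "f x = g x"
  using assms clinear_eq_keys by blast

lemma clinear_compose: "clinear f \<Longrightarrow> clinear g \<Longrightarrow> clinear (\<lambda>x. f (g x))"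
  by (simp add: clinear_iff)

lemma clinear_plus: "clinear f \<Longrightarrow> clinear g \<Longrightarrow> clinear (\<lambda>x. f x + g x)"
  by (simp add: clinear_iff cvec.scale_right_distrib)

lemma clinear_scaled: "clinear f \<Longrightarrow> clinear (\<lambda>x. c *\<^sub>C f x)"
  by (simp add: clinear_iff cvec.scale_right_distrib mult.commute)

lemma clinear_zero: "clinear (\<lambda>x. 0)"
  by (simp add: clinear_iff)

lemma clinear_ident: "clinear (\<lambda>x. x)"
  by (simp add: clinear_iff)

lemma clinear_sums: "(\<And>a. a \<in> A \<Longrightarrow> clinear (f a)) \<Longrightarrow> clinear (\<lambda>x. \<Sum>a\<in>A. f a x)"
  by (induction A rule: infinite_finite_induct) (simp_all add: clinear_zero clinear_plus)

lemma lin_ext_plus: "lin_ext (\<lambda>k. b k + b' k) x = lin_ext b x + lin_ext b' x"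
  by (simp add: lin_ext_def cvec.scale_right_distrib sum.distrib)

lemma lin_ext_scale: "lin_ext (\<lambda>k. c *\<^sub>C b k) x = c *\<^sub>C lin_ext b x"
  by (simp add: lin_ext_def cvec.scale_sum_right mult.commute)

lemma clinear_span_le:
  assumes "clinear f" "cvec.subspace S" "\<And>x. x \<in> B \<Longrightarrow> f x \<in> S" "x \<in> cvec.span B"
  shows "f x \<in> S"
  using assms(4)
  by (induction rule: cvec.span_induct_alt)
    (use assms(2,3) in \<open>auto simp: clinear_simps[OF assms(1)] cvec.subspace_def\<close>)

lemma clinear_eq_span:
  assumes "clinear f" "clinear g" "\<And>x. x \<in> B \<Longrightarrow> f x = g x" "x \<in> cvec.span B"
  shows "f x = g x"
  using assms(4)
  by (induction rule: cvec.span_induct_alt) (use assms(3) in \<open>auto simp: clinear_simps[OF assms(1)] clinear_simps[OF assms(2)]\<close>)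

text \<open>Scalar-valued counterpart of \<open>lin_ext\<close>: \<open>clinear\<close> speaks only
  about maps into spaces of finitely supported functions, and the scalars are not of that form.
  \<open>omega\<close>, \<open>xi\<close>, \<open>inner\<close> and the coefficients of contractions
  are all expressed through it.\<close>

definition linfun :: "('k \<Rightarrow> complex) \<Rightarrow> ('k \<Rightarrow>\<^sub>0 complex) \<Rightarrow> complex"
  where "linfun c x = (\<Sum>k\<in>Poly_Mapping.keys x. Poly_Mapping.lookup x k * c k)"

lemma linfun_superset:
  assumes "finite K" "Poly_Mapping.keys x \<subseteq> K"
  shows "linfun c x = (\<Sum>k\<in>K. Poly_Mapping.lookup x k * c k)"
  unfolding linfun_def
  by (rule sum.mono_neutral_left) (use assms in \<open>auto simp: in_keys_iff\<close>)

lemma linfun_add: "linfun c (x + y) = linfun c x + linfun c y"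
proof -
  let ?K = "Poly_Mapping.keys x \<union> Poly_Mapping.keys y"
  have "Poly_Mapping.keys (x + y) \<subseteq> ?K" by (rule keys_add)
  then show ?thesis
    by (simp add: linfun_superset[where K = ?K] lookup_add ring_distribs sum.distrib)
qed

lemma linfun_scale: "linfun c (a *\<^sub>C x) = a * linfun c x"
proof -
  have "Poly_Mapping.keys (a *\<^sub>C x) \<subseteq> Poly_Mapping.keys x" by (auto simp: in_keys_iff)
  then show ?thesis
    by (simp add: linfun_superset[where K = "Poly_Mapping.keys x"] sum_distrib_left mult.assoc)
qed

lemma linfun_bvec: "linfun c (bvec k) = c k"
  by (simp add: linfun_def)

section \<open>The alternating form and the functional \<open>xi\<close>\<close>

lemma omega_linfun: "omega v w = linfun (\<lambda>k. linfun (omega_basis k) w) v"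
  by (simp add: omega_def linfun_def sum_distrib_left mult.assoc)

lemma linfun_coeff: "linfun (\<lambda>k. c k + c' k) x = linfun c x + linfun c' x"
  "linfun (\<lambda>k. a * c k) x = a * linfun c x"
  by (simp_all add: linfun_def ring_distribs sum.distrib sum_distrib_left mult.left_commute)

lemma omega_add_left: "omega (v + v') w = omega v w + omega v' w"
  and omega_scale_left: "omega (c *\<^sub>C v) w = c * omega v w"
  and omega_add_right: "omega v (w + w') = omega v w + omega v w'"
  and omega_scale_right: "omega v (c *\<^sub>C w) = c * omega v w"
  by (simp_all add: omega_linfun linfun_add linfun_scale linfun_coeff)

lemma omega_minus_left: "omega (- v) w = - omega v w"
  using omega_scale_left[of "-1" v w] by simp
lemma omega_minus_right: "omega v (- w) = - omega v w"
  using omega_scale_right[of v "-1" w] by simp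
lemma omega_diff_left: "omega (v - v') w = omega v w - omega v' w"
  using omega_add_left[of v "- v'" w] by (simp add: omega_minus_left)
lemma omega_diff_right: "omega v (w - w') = omega v w - omega v w'"
  using omega_add_right[of v w "- w'"] by (simp add: omega_minus_right)

lemma omega_bvec: "omega (bvec k) (bvec l) = omega_basis k l"
  by (simp add: omega_linfun linfun_bvec)

lemma omega_basis_antisym: "omega_basis l k = - omega_basis k l"
  by (cases k; cases l) auto

lemma omega_antisym: "omega w v = - omega v w"
proof -
  have "omega w v = (\<Sum>l\<in>Poly_Mapping.keys v. \<Sum>k\<in>Poly_Mapping.keys w.
      Poly_Mapping.lookup w k * Poly_Mapping.lookup v l * omega_basis k l)"
    unfolding omega_def by (rule sum.swap)
  also have "\<dots> = (\<Sum>l\<in>Poly_Mapping.keys v. \<Sum>k\<in>Poly_Mapping.keys w.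
      - (Poly_Mapping.lookup v l * Poly_Mapping.lookup w k * omega_basis l k))"
    by (intro sum.cong refl) (subst omega_basis_antisym, simp add: mult.commute)
  finally show ?thesis by (simp add: omega_def sum_negf)
qed

lemma xi_linfun: "xi v = linfun (\<lambda>k. 1) v"
  by (simp add: xi_def linfun_def)

lemma xi_add: "xi (v + w) = xi v + xi w" and xi_scale: "xi (c *\<^sub>C v) = c * xi v"
  and xi_bvec: "xi (bvec k) = 1"
  by (simp_all add: xi_linfun linfun_add linfun_scale linfun_bvec)

lemma xi_minus: "xi (- v) = - xi v"
  using xi_scale[of "-1" v] by simp
lemma xi_diff: "xi (v - w) = xi v - xi w"
  using xi_add[of v "- w"] by (simp add: xi_minus)

section \<open>Tensors\<close>

text \<open>Bilinear version of prepending a letter. Inductions peel off the first factor with it,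
  and \<open>bilinear_eq_basis\<close> reduces identities in both arguments to words.\<close>

definition tcons :: "('k \<Rightarrow>\<^sub>0 complex) \<Rightarrow> ('k list \<Rightarrow>\<^sub>0 complex) \<Rightarrow> ('k list \<Rightarrow>\<^sub>0 complex)" (infixr "\<otimes>" 76)
  where "v \<otimes> x = lin_ext (\<lambda>k. lin_ext (\<lambda>ks. bvec (k # ks)) x) v"

lemma tensor_Cons: "tensor (v # vs) = v \<otimes> tensor vs"
  by (simp add: tcons_def)

declare tensor.simps(2) [simp del]
declare tensor_Cons [simp]

lemma clinear_tcons_left: "clinear (\<lambda>v. v \<otimes> x)"
  unfolding tcons_def by (rule clinear_lin_ext)

lemma clinear_tcons_right: "clinear (\<lambda>x. v \<otimes> x)"
  unfolding tcons_def
  by (rule clinearI) (simp_all add: clinear_simps[OF clinear_lin_ext] lin_ext_plus lin_ext_scale)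

lemmas tcons_left = clinear_simps[OF clinear_tcons_left]
lemmas tcons_right = clinear_simps[OF clinear_tcons_right]

lemma tcons_bvec [simp]: "bvec k \<otimes> bvec ks = bvec (k # ks)"
  by (simp add: tcons_def)

lemma lookup_tcons_Cons:
  "Poly_Mapping.lookup (v \<otimes> x) (k # ks) = Poly_Mapping.lookup v k * Poly_Mapping.lookup x ks"
proof -
  have *: "Poly_Mapping.lookup (bvec a \<otimes> x) (k # ks) = (if a = k then Poly_Mapping.lookup x ks else 0)" for a
  proof -
    have "bvec a \<otimes> x = (\<Sum>w\<in>Poly_Mapping.keys x. Poly_Mapping.lookup x w *\<^sub>C bvec (a # w))"
      by (subst bvec_expand[of x]) (simp add: tcons_right)
    then show ?thesis
      by (auto simp: lookup_sum lookup_bvec if_distrib[of "(*) _"] in_keys_iff sum.delta cong: if_cong)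
  qed
  have "v \<otimes> x = (\<Sum>a\<in>Poly_Mapping.keys v. Poly_Mapping.lookup v a *\<^sub>C (bvec a \<otimes> x))"
    by (subst bvec_expand[of v]) (simp add: tcons_left)
  then show ?thesis
    by (auto simp: lookup_sum * if_distrib[of "(*) _"] in_keys_iff sum.delta cong: if_cong)
qed

lemma lookup_tcons_Nil: "Poly_Mapping.lookup (v \<otimes> x) [] = 0"
  by (simp add: tcons_def lin_ext_def lookup_sum lookup_bvec)

lemma lookup_tensor:
  "Poly_Mapping.lookup (tensor vs) ws =
    (if length ws = length vs then \<Prod>i<length vs. Poly_Mapping.lookup (vs ! i) (ws ! i) else 0)"
proof (induction vs arbitrary: ws)
  case Nil
  then show ?case by (auto simp: lookup_bvec)
next
  case (Cons v vs)
  then show ?case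
    by (cases ws) (auto simp: lookup_tcons_Cons lookup_tcons_Nil prod.lessThan_Suc_shift
      simp del: prod.lessThan_Suc)
qed

text \<open>The operators \<open>tperm s\<close> are defined on words of every length but form an
  action only where \<open>s\<close> permutes the positions; hence the recurring restriction to one
  degree.\<close>

definition homog :: "nat \<Rightarrow> ('k list \<Rightarrow>\<^sub>0 complex) set"
  where "homog d = {x. \<forall>ks\<in>Poly_Mapping.keys x. length ks = d}"

lemma homog_iff: "x \<in> homog d \<longleftrightarrow> (\<forall>ks. length ks \<noteq> d \<longrightarrow> Poly_Mapping.lookup x ks = 0)"
  by (auto simp: homog_def in_keys_iff)

lemma subspace_homog: "cvec.subspace (homog d)"
  by (auto simp: cvec.subspace_def homog_iff lookup_add)

lemma homog_add: "x \<in> homog d \<Longrightarrow> y \<in> homog d \<Longrightarrow> x + y \<in> homog d"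
  and homog_scale: "x \<in> homog d \<Longrightarrow> c *\<^sub>C x \<in> homog d"
  and homog_0: "0 \<in> homog d"
  by (auto simp: homog_iff lookup_add)

lemma homog_sum: "(\<And>a. a \<in> A \<Longrightarrow> f a \<in> homog d) \<Longrightarrow> sum f A \<in> homog d"
  by (rule cvec.subspace_sum[OF subspace_homog])

lemma tensor_homog: "length vs = d \<Longrightarrow> tensor vs \<in> homog d"
  by (auto simp: homog_iff lookup_tensor)

lemma bvec_homog: "bvec ks \<in> homog d \<longleftrightarrow> length ks = d"
  by (auto simp: homog_iff lookup_bvec)

lemma tpower_homog: "x \<in> tpower U d \<Longrightarrow> x \<in> homog d"
  unfolding tpower_def
  by (erule cvec.span_minimal[OF _ subspace_homog, THEN subsetD, rotated]) (auto simp: tensor_homog)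

lemma subspace_tpower: "cvec.subspace (tpower U d)"
  unfolding tpower_def by (rule cvec.subspace_span)

lemma tensor_tpower: "set vs \<subseteq> U \<Longrightarrow> length vs = d \<Longrightarrow> tensor vs \<in> tpower U d"
  unfolding tpower_def by (rule cvec.span_base) blast

lemma clinear_tmap: "clinear (tmap g)"
  unfolding tmap_def by (rule clinear_lin_ext)
lemma clinear_tperm: "clinear (tperm s)"
  unfolding tperm_def by (rule clinear_lin_ext)
lemma clinear_contract: "clinear (contract i j)"
  unfolding contract_def by (rule clinear_lin_ext)

lemmas clinear_tensor_intros = clinear_tmap clinear_tperm clinear_contract
  clinear_compose[OF clinear_tmap] clinear_compose[OF clinear_tperm] clinear_compose[OF clinear_contract]
  clinear_tcons_left clinear_tcons_right
  clinear_compose[OF clinear_tcons_left] clinear_compose[OF clinear_tcons_right]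

lemma tmap_bvec: "tmap g (bvec ks) = tensor (map (\<lambda>k. g (bvec k)) ks)"
  by (simp add: tmap_def)
lemma tperm_bvec: "tperm s (bvec ks) = bvec (permute_list s ks)"
  by (simp add: tperm_def)

lemma bilinear_eq_basis:
  assumes "\<And>x. clinear (\<lambda>v. f v x)" "\<And>v. clinear (f v)"
    "\<And>x. clinear (\<lambda>v. g v x)" "\<And>v. clinear (g v)"
    "\<And>k l. f (bvec k) (bvec l) = g (bvec k) (bvec l)"
  shows "f v x = g v x"
  by (rule clinear_eq_basis[of "\<lambda>v. f v x" "\<lambda>v. g v x", OF assms(1,3)],
      rule clinear_eq_basis[OF assms(2,4)], rule assms(5))

lemma tmap_tcons:
  assumes "clinear g"
  shows "tmap g (v \<otimes> x) = g v \<otimes> tmap g x"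
  by (rule bilinear_eq_basis[of "\<lambda>v x. tmap g (v \<otimes> x)" "\<lambda>v x. g v \<otimes> tmap g x"])
    (auto intro!: clinear_tensor_intros assms simp: tmap_bvec)

lemma tmap_tensor: "clinear g \<Longrightarrow> tmap g (tensor vs) = tensor (map g vs)"
  by (induction vs) (simp_all add: tmap_tcons tmap_bvec[of _ "[]", simplified])

lemma clinear_tpower_le:
  assumes "clinear f" "cvec.subspace S"
    "\<And>vs. length vs = d \<Longrightarrow> set vs \<subseteq> U \<Longrightarrow> f (tensor vs) \<in> S" "x \<in> tpower U d"
  shows "f x \<in> S"
  by (rule clinear_span_le[OF assms(1,2) _ assms(4)[unfolded tpower_def]]) (use assms(3) in auto)

lemma clinear_eq_tpower:
  assumes "clinear f" "clinear g"
    "\<And>vs. length vs = d \<Longrightarrow> set vs \<subseteq> U \<Longrightarrow> f (tensor vs) = g (tensor vs)" "x \<in> tpower U d"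
  shows "f x = g x"
  by (rule clinear_eq_span[OF assms(1,2) _ assms(4)[unfolded tpower_def]]) (use assms(3) in auto)

lemma tmap_tpower:
  assumes "clinear g" "g ` U \<subseteq> U" "x \<in> tpower U d"
  shows "tmap g x \<in> tpower U d"
  by (rule clinear_tpower_le[OF clinear_tmap subspace_tpower _ assms(3)])
    (use assms(1,2) in \<open>force intro!: tensor_tpower simp: tmap_tensor\<close>)

lemma clinear_eq_homog_tensor:
  assumes "clinear f" "clinear g" "x \<in> homog d"
    "\<And>ks. length ks = d \<Longrightarrow> f (bvec ks) = g (bvec ks)"
  shows "f x = g x"
  by (rule clinear_eq_keys[OF assms(1,2)]) (use assms(3,4) in \<open>auto simp: homog_def\<close>)

lemma inv_permutes_list:
  assumes "s permutes {..<length ks}"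
  shows "permute_list s (permute_list (inv s) ks) = ks"
proof -
  have "permute_list (inv s \<circ> s) ks = permute_list s (permute_list (inv s) ks)"
    using assms by (intro permute_list_compose)
  then show ?thesis using permutes_inv_o(2)[OF assms] by simp
qed

lemma lookup_tperm:
  assumes "s permutes {..<d}" "x \<in> homog d" "length ks = d"
  shows "Poly_Mapping.lookup (tperm s x) ks = Poly_Mapping.lookup x (permute_list (inv s) ks)"
proof -
  have "permute_list s w = ks \<longleftrightarrow> w = permute_list (inv s) ks" if "length w = d" for w
  proof
    assume *: "permute_list s w = ks"
    have "inv s permutes {..<length w}" using assms(1) that permutes_inv by auto
    then have "permute_list (inv s) (permute_list (inv (inv s)) w) = w"
      by (rule inv_permutes_list)
    then show "w = permute_list (inv s) ks"
      using * assms(1) by (simp add: permutes_inv_inv)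
  next
    assume "w = permute_list (inv s) ks"
    then show "permute_list s w = ks" using inv_permutes_list[of s ks] assms by simp
  qed
  then have "Poly_Mapping.lookup (tperm s x) ks =
    (\<Sum>w\<in>Poly_Mapping.keys x. if w = permute_list (inv s) ks then Poly_Mapping.lookup x w else 0)"
    unfolding tperm_def lin_ext_def lookup_sum
    by (intro sum.cong) (use assms(2) in \<open>auto simp: lookup_bvec homog_def\<close>)
  then show ?thesis by (auto simp: in_keys_iff)
qed

lemma tperm_homog: "x \<in> homog d \<Longrightarrow> tperm s x \<in> homog d"
  unfolding tperm_def lin_ext_def
  by (intro homog_sum homog_scale) (auto simp: bvec_homog homog_def)

lemma tperm_tensor:
  assumes "s permutes {..<length vs}"
  shows "tperm s (tensor vs) = tensor (permute_list s vs)"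
proof (rule poly_mapping_eqI)
  fix ks
  show "Poly_Mapping.lookup (tperm s (tensor vs)) ks = Poly_Mapping.lookup (tensor (permute_list s vs)) ks"
  proof (cases "length ks = length vs")
    case True
    have "inv s permutes {..<length vs}" using assms permutes_inv by auto
    then have "(\<Prod>i<length vs. Poly_Mapping.lookup (vs ! i) (permute_list (inv s) ks ! i)) =
       (\<Prod>i<length vs. Poly_Mapping.lookup (vs ! i) (ks ! (inv s i)))"
      using True by (simp add: permute_list_nth)
    also have "\<dots> = (\<Prod>i<length vs. Poly_Mapping.lookup (vs ! s i) (ks ! i))"
      using prod.permute[OF assms, of "\<lambda>i. Poly_Mapping.lookup (vs ! i) (ks ! (inv s i))"]
        permutes_inverses(2)[OF assms] by (simp add: o_def)
    also have "\<dots> = (\<Prod>i<length vs. Poly_Mapping.lookup (permute_list s vs ! i) (ks ! i))"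
      using assms by (simp add: permute_list_nth)
    finally show ?thesis
      using True lookup_tperm[OF assms tensor_homog[OF refl] True] by (simp add: lookup_tensor)
  next
    case False
    then show ?thesis
      using tperm_homog[OF tensor_homog[OF refl], of s vs] by (auto simp: homog_iff lookup_tensor)
  qed
qed

lemma tperm_tperm:
  assumes "x \<in> homog d" "s permutes {..<d}"
  shows "tperm s (tperm t x) = tperm (t \<circ> s) x"
  by (rule clinear_eq_homog_tensor[of "\<lambda>x. tperm s (tperm t x)" "tperm (t \<circ> s)", OF _ _ assms(1)])
    (auto intro!: clinear_tensor_intros simp: tperm_bvec permute_list_compose assms)

lemma tperm_id: "tperm id x = x"
  by (rule clinear_eq_basis[OF clinear_tperm clinear_ident]) (simp add: tperm_bvec)

lemma tperm_tpower:
  assumes "s permutes {..<d}" "x \<in> tpower U d"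
  shows "tperm s x \<in> tpower U d"
  by (rule clinear_tpower_le[OF clinear_tperm subspace_tpower _ assms(2)])
    (use assms(1) in \<open>auto intro!: tensor_tpower simp: tperm_tensor\<close>)

lemma tmap_tperm:
  assumes "clinear g" "x \<in> homog d" "s permutes {..<d}"
  shows "tmap g (tperm s x) = tperm s (tmap g x)"
  by (rule clinear_eq_homog_tensor[of "\<lambda>x. tmap g (tperm s x)" "\<lambda>x. tperm s (tmap g x)",
        OF _ _ assms(2)])
    (use assms(1,3) in \<open>auto intro!: clinear_tensor_intros simp: tperm_bvec tmap_bvec tperm_tensor permute_list_map\<close>)

section \<open>The action of the group algebra of the symmetric group\<close>

text \<open>Agreement with an element of the group algebra is asked only in degree \<open>d\<close>,
  so that composites can be handled as plain functions, whatever they do elsewhere.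
  \<open>galg_linear\<close> provides a globally linear representative.\<close>

definition galg :: "nat \<Rightarrow> (('k list \<Rightarrow>\<^sub>0 complex) \<Rightarrow> ('k list \<Rightarrow>\<^sub>0 complex)) \<Rightarrow> bool"
  where "galg d P \<longleftrightarrow>
    (\<exists>f. \<forall>x\<in>homog d. P x = (\<Sum>s | s permutes {..<d}. f s *\<^sub>C tperm s x))"

lemma finite_perms: "finite {s. s permutes {..<d::nat}}"
  by (rule finite_permutations) simp

lemma galg_cong: "(\<And>x. x \<in> homog d \<Longrightarrow> P x = Q x) \<Longrightarrow> galg d P \<longleftrightarrow> galg d Q"
  by (simp add: galg_def)

lemma galg_tperm:
  assumes "s permutes {..<d}"
  shows "galg d (tperm s)"
  unfolding galg_def
proof (intro exI ballI)
  fix x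
  have "(\<Sum>t | t permutes {..<d}. (if t = s then 1 else 0) *\<^sub>C tperm t x) =
      (\<Sum>t | t permutes {..<d}. if t = s then tperm t x else 0)"
    by (intro sum.cong) auto
  then show "tperm s x = (\<Sum>t | t permutes {..<d}. (if t = s then 1 else 0) *\<^sub>C tperm t x)"
    using assms by (simp add: finite_perms)
qed

lemma galg_add:
  assumes "galg d P" "galg d Q"
  shows "galg d (\<lambda>x. P x + Q x)"
proof -
  obtain f g where "\<forall>x\<in>homog d. P x = (\<Sum>s | s permutes {..<d}. f s *\<^sub>C tperm s x)"
    "\<forall>x\<in>homog d. Q x = (\<Sum>s | s permutes {..<d}. g s *\<^sub>C tperm s x)"
    using assms unfolding galg_def by auto
  then show ?thesis
    unfolding galg_def by (intro exI[of _ "\<lambda>s. f s + g s"]) (simp add: cvec.scale_left_distrib sum.distrib)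
qed

lemma galg_scale:
  assumes "galg d P"
  shows "galg d (\<lambda>x. c *\<^sub>C P x)"
proof -
  obtain f where "\<forall>x\<in>homog d. P x = (\<Sum>s | s permutes {..<d}. f s *\<^sub>C tperm s x)"
    using assms unfolding galg_def by auto
  then show ?thesis
    unfolding galg_def by (intro exI[of _ "\<lambda>s. c * f s"]) (simp add: cvec.scale_sum_right)
qed

lemma galg_zero: "galg d (\<lambda>x. 0)"
  unfolding galg_def by (intro exI[of _ "\<lambda>s. 0"]) simp

lemma galg_sum: "(\<And>a. a \<in> A \<Longrightarrow> galg d (P a)) \<Longrightarrow> galg d (\<lambda>x. \<Sum>a\<in>A. P a x)"
  by (induction A rule: infinite_finite_induct) (simp_all add: galg_zero galg_add)

lemma galg_closed:
  assumes "galg d P" "cvec.subspace S" "\<And>s. s permutes {..<d} \<Longrightarrow> tperm s x \<in> S" "x \<in> homog d"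
  shows "P x \<in> S"
proof -
  obtain f where "\<forall>x\<in>homog d. P x = (\<Sum>s | s permutes {..<d}. f s *\<^sub>C tperm s x)"
    using assms unfolding galg_def by auto
  then show ?thesis
    using assms(2-4) by (auto intro!: cvec.subspace_sum cvec.subspace_scale)
qed

lemma galg_homog: "galg d P \<Longrightarrow> x \<in> homog d \<Longrightarrow> P x \<in> homog d"
  by (rule galg_closed) (auto intro: tperm_homog subspace_homog)

lemma galg_tpower: "galg d P \<Longrightarrow> x \<in> tpower U d \<Longrightarrow> P x \<in> tpower U d"
  by (rule galg_closed) (auto intro: tperm_tpower subspace_tpower tpower_homog)

lemma galg_comp:
  assumes "galg d P" "galg d Q"
  shows "galg d (\<lambda>x. P (Q x))"
proof -
  obtain f g where f: "\<forall>x\<in>homog d. P x = (\<Sum>s | s permutes {..<d}. f s *\<^sub>C tperm s x)"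
    and g: "\<forall>x\<in>homog d. Q x = (\<Sum>s | s permutes {..<d}. g s *\<^sub>C tperm s x)"
    using assms unfolding galg_def by auto
  have "P (Q x) = (\<Sum>s | s permutes {..<d}. \<Sum>t | t permutes {..<d}.
      f s *\<^sub>C g t *\<^sub>C tperm (t \<circ> s) x)" if "x \<in> homog d" for x
    using that galg_homog[OF assms(2) that]
    by (simp add: f) (simp add: g clinear_simps[OF clinear_tperm] cvec.scale_sum_right tperm_tperm)
  moreover have "galg d (\<lambda>x. \<Sum>s | s permutes {..<d}. \<Sum>t | t permutes {..<d}.
      f s *\<^sub>C g t *\<^sub>C tperm (t \<circ> s) x)"
    by (intro galg_sum galg_scale galg_tperm permutes_compose) auto
  ultimately show ?thesis by (simp cong: galg_cong)
qed

lemma galg_linear: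
  assumes "galg d P"
  obtains P' where "clinear P'" "\<And>x. x \<in> homog d \<Longrightarrow> P x = P' x"
proof -
  obtain f where f: "\<forall>x\<in>homog d. P x = (\<Sum>s | s permutes {..<d}. f s *\<^sub>C tperm s x)"
    using assms unfolding galg_def by auto
  have "clinear (\<lambda>x. \<Sum>s | s permutes {..<d}. f s *\<^sub>C tperm s x)"
    by (intro clinear_sums clinear_scaled clinear_tperm)
  with f show ?thesis using that by blast
qed

lemma galg_arg:
  assumes "galg d P" "x \<in> homog d" "y \<in> homog d"
  shows "P (x + y) = P x + P y" "P (c *\<^sub>C x) = c *\<^sub>C P x"
proof -
  obtain P' where "clinear P'" "\<And>x. x \<in> homog d \<Longrightarrow> P x = P' x" using galg_linear[OF assms(1)] by blast
  then show "P (x + y) = P x + P y" "P (c *\<^sub>C x) = c *\<^sub>C P x"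
    using assms(2,3) by (simp_all add: homog_add homog_scale clinear_simps[of P'])
qed

lemma galg_0: "galg d P \<Longrightarrow> P 0 = 0"
  using galg_arg(2)[of d P 0 0 0] by (simp add: homog_0)

lemma tmap_homog: "x \<in> homog d \<Longrightarrow> tmap g x \<in> homog d"
  unfolding tmap_def lin_ext_def
  by (intro homog_sum homog_scale tensor_homog) (auto simp: homog_def)

lemma galg_tmap:
  assumes "galg d P" "clinear g" "x \<in> homog d"
  shows "tmap g (P x) = P (tmap g x)"
proof -
  obtain f where "\<forall>x\<in>homog d. P x = (\<Sum>s | s permutes {..<d}. f s *\<^sub>C tperm s x)"
    using assms unfolding galg_def by auto
  then show ?thesis
    using assms by (simp add: tmap_homog clinear_simps[OF clinear_tmap] tmap_tperm)
qed

text \<open>The Hermitian form for which the basis vectors are orthonormal, linear in the first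
  argument. On tensors of one degree permutations only rearrange the words, so they act
  unitarily.\<close>

definition inner :: "('k \<Rightarrow>\<^sub>0 complex) \<Rightarrow> ('k \<Rightarrow>\<^sub>0 complex) \<Rightarrow> complex"
  where "inner x y = linfun (\<lambda>k. cnj (Poly_Mapping.lookup y k)) x"

lemma inner_add: "inner (x + y) z = inner x z + inner y z"
  and inner_scale: "inner (c *\<^sub>C x) z = c * inner x z"
  by (simp_all add: inner_def linfun_add linfun_scale)

lemma inner_0: "inner 0 z = 0"
  using inner_scale[of 0 0] by simp

lemma inner_sum: "inner (sum f A) z = (\<Sum>a\<in>A. inner (f a) z)"
  by (induction A rule: infinite_finite_induct) (simp_all add: inner_0 inner_add)

lemma inner_cnj: "inner y x = cnj (inner x y)"
proof -
  let ?K = "Poly_Mapping.keys x \<union> Poly_Mapping.keys y"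
  show ?thesis
    by (simp add: inner_def linfun_superset[where K = ?K] mult.commute)
qed

lemma inner_self: "inner x x = 0 \<longleftrightarrow> x = 0"
proof
  assume "inner x x = 0"
  then have "(\<Sum>k\<in>Poly_Mapping.keys x. complex_of_real ((cmod (Poly_Mapping.lookup x k))\<^sup>2)) = 0"
    by (simp only: inner_def linfun_def complex_norm_square)
  then have "(\<Sum>k\<in>Poly_Mapping.keys x. (cmod (Poly_Mapping.lookup x k))\<^sup>2) = 0"
    by (simp only: of_real_sum[symmetric] of_real_eq_0_iff)
  then have "\<forall>k\<in>Poly_Mapping.keys x. Poly_Mapping.lookup x k = 0"
    by (subst (asm) sum_nonneg_eq_0_iff) auto
  then show "x = 0" by (auto simp: in_keys_iff intro!: poly_mapping_eqI)
qed (simp add: inner_0)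

lemma inner_lin_ext: "inner (lin_ext b x) y = (\<Sum>k\<in>Poly_Mapping.keys x. Poly_Mapping.lookup x k * inner (b k) y)"
  by (simp add: lin_ext_def inner_sum inner_scale)

lemma inner_tperm:
  assumes "s permutes {..<d}" "x \<in> homog d" "y \<in> homog d"
  shows "inner (tperm s x) y = inner x (tperm (inv s) y)"
proof -
  have "inner (bvec (permute_list s ks)) y = cnj (Poly_Mapping.lookup (tperm (inv s) y) ks)"
    if "ks \<in> Poly_Mapping.keys x" for ks
    using that assms
    by (subst lookup_tperm[where d = d])
      (auto simp: homog_def inner_def linfun_bvec permutes_inv permutes_inv_inv)
  then show ?thesis
    unfolding tperm_def[of s] inner_lin_ext by (simp add: inner_def linfun_def)
qed

text \<open>By unitarity of permutations, the adjoint arises by conjugating the coefficients and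
  inverting the permutations. Both directions of adjointness are kept because cancellation moves
  operators across the form both ways.\<close>

lemma galg_adjoint:
  assumes "galg d P"
  obtains Q where "galg d Q" "\<And>x y. x \<in> homog d \<Longrightarrow> y \<in> homog d \<Longrightarrow> inner (P x) y = inner x (Q y)"
    "\<And>x y. x \<in> homog d \<Longrightarrow> y \<in> homog d \<Longrightarrow> inner (Q x) y = inner x (P y)"
proof -
  obtain f where f: "\<forall>x\<in>homog d. P x = (\<Sum>s | s permutes {..<d}. f s *\<^sub>C tperm s x)"
    using assms unfolding galg_def by auto
  define Q :: "('a list \<Rightarrow>\<^sub>0 complex) \<Rightarrow> ('a list \<Rightarrow>\<^sub>0 complex)"
    where "Q x = (\<Sum>s | s permutes {..<d}. cnj (f s) *\<^sub>C tperm (inv s) x)" for x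
  have Q: "galg d Q"
    unfolding Q_def by (intro galg_sum galg_scale galg_tperm permutes_inv) auto
  have 1: "inner (Q x) y = inner x (P y)" if "x \<in> homog d" "y \<in> homog d" for x y
  proof -
    have "inner (tperm (inv s) x) y = cnj (inner (tperm s y) x)" if "s permutes {..<d}" for s
      using inner_tperm[OF permutes_inv[OF that] \<open>x \<in> homog d\<close> \<open>y \<in> homog d\<close>] that
      by (simp add: permutes_inv_inv inner_cnj[of x])
    then have "inner (Q x) y = cnj (inner (P y) x)"
      using f that by (simp add: Q_def inner_sum inner_scale)
    then show ?thesis by (simp add: inner_cnj[of x])
  qed
  then have "inner (P x) y = inner x (Q y)" if "x \<in> homog d" "y \<in> homog d" for x y
    using that by (metis inner_cnj)
  with Q 1 show ?thesis using that by blast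
qed

section \<open>Young symmetrizers\<close>

lemma length_cells: "length (cells p) = sum_list p"
proof -
  have "map (\<lambda>i. p ! i) [0..<length p] = p" by (rule map_nth)
  then show ?thesis by (simp add: cells_def length_concat o_def)
qed

lemma set_cells: "set (cells p) = {(i, j). i < length p \<and> j < p ! i}"
  by (auto simp: cells_def)

lemma distinct_cells: "distinct (cells p)"
proof -
  have "distinct (concat (map (\<lambda>i. map (\<lambda>j. (i, f i j)) [0..<g i]) [0..<n]))"
    if "\<And>i. inj (f i)" for n and f g :: "nat \<Rightarrow> _"
    using that by (induction n) (auto simp: distinct_map inj_on_def)
  from this[of "\<lambda>i j. j"] show ?thesis by (simp add: cells_def)
qed

lemma cells_nth_inj: "m < sum_list p \<Longrightarrow> m' < sum_list p \<Longrightarrow> cells p ! m = cells p ! m' \<longleftrightarrow> m = m'"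
  by (simp add: nth_eq_iff_index_eq distinct_cells length_cells)

lemma cells_nth: "m < sum_list p \<Longrightarrow> cells p ! m \<in> {(i, j). i < length p \<and> j < p ! i}"
  using nth_mem[of m "cells p"] by (simp add: length_cells set_cells)

lemma partition_mono:
  assumes "is_partition p" "i \<le> j" "j < length p"
  shows "p ! j \<le> p ! i"
  using assms sorted_wrt_nth_less[of "(\<ge>)" p i j] by (cases "i = j") (auto simp: is_partition_def)

lemma rearrangement_fits:
  assumes p: "is_partition p" and pi: "\<pi> permutes {..<sum_list p}"
    and sep: "\<And>x y. x < sum_list p \<Longrightarrow> y < sum_list p \<Longrightarrow> x \<noteq> y \<Longrightarrow>
      snd (cells p ! x) = snd (cells p ! y) \<Longrightarrow> fst (cells p ! \<pi> x) \<noteq> fst (cells p ! \<pi> y)"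
    and m: "m < sum_list p"
  shows "(fst (cells p ! \<pi> m), snd (cells p ! m)) \<in> set (cells p)"
proof (rule ccontr)
  \<comment> \<open>Let \<open>r\<close> be the row of \<open>\<pi> m\<close>. At most as many positions of a column are moved to the rows above
    \<open>r\<close> as belong to these rows; summing over all columns gives equality. But in the column of \<open>m\<close>
    all positions belong to these rows.\<close>
  let ?d = "sum_list p" and ?row = "\<lambda>x. fst (cells p ! x)" and ?col = "\<lambda>x. snd (cells p ! x)"
  define r where "r = ?row (\<pi> m)"
  define a where "a j = card {x \<in> {..<?d}. ?col x = j \<and> ?row (\<pi> x) < r}" for j
  define b where "b j = card {x \<in> {..<?d}. ?col x = j \<and> ?row x < r}" for j
  assume not: "(?row (\<pi> m), ?col m) \<notin> set (cells p)"
  have pim: "\<pi> m < ?d" using permutes_in_image[OF pi, of m] m by simp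
  have r: "r < length p" "p ! r \<le> ?col m"
    using not cells_nth[OF pim] unfolding r_def set_cells by auto
  \<comment> \<open>A column reaching all rows above \<open>r\<close> has \<open>r\<close> positions
    there, while separation allows at most one moved position per row. A shorter column lies
    entirely above \<open>r\<close>, because row lengths decrease weakly.\<close>
  have le: "a j \<le> b j" for j
  proof (cases "\<forall>i<r. j < p ! i")
    case True
    have "inj_on (\<lambda>x. ?row (\<pi> x)) {x \<in> {..<?d}. ?col x = j \<and> ?row (\<pi> x) < r}"
      using sep by (intro inj_onI) (simp, metis)
    then have "a j \<le> card {..<r}"
      unfolding a_def by (rule card_inj_on_le) auto
    also have "\<dots> \<le> b j"
    proof -
      have "{..<r} \<subseteq> ?row ` {x \<in> {..<?d}. ?col x = j \<and> ?row x < r}"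
      proof
        fix i assume "i \<in> {..<r}"
        then have "(i, j) \<in> set (cells p)" using True r by (simp add: set_cells)
        then obtain x where "x < ?d" "cells p ! x = (i, j)"
          by (auto simp: in_set_conv_nth length_cells)
        then show "i \<in> ?row ` {x \<in> {..<?d}. ?col x = j \<and> ?row x < r}"
          using \<open>i \<in> {..<r}\<close> by (intro image_eqI[of _ _ x]) auto
      qed
      then show ?thesis unfolding b_def by (intro surj_card_le) auto
    qed
    finally show ?thesis .
  next
    case False
    then obtain i where i: "i < r" "p ! i \<le> j" by (auto simp: not_less)
    have "?row x < r" if "x < ?d" "?col x = j" for x
    proof (rule ccontr)
      assume "\<not> ?row x < r"
      then have "p ! ?row x \<le> p ! i"
        using cells_nth[OF that(1)] i by (intro partition_mono[OF p]) auto
      then show False using cells_nth[OF that(1)] that i by auto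
    qed
    then show ?thesis unfolding a_def b_def by (intro card_mono) auto
  qed
  have split: "card {x \<in> {..<?d}. Q x} = (\<Sum>j\<in>?col ` {..<?d}. card {x \<in> {..<?d}. ?col x = j \<and> Q x})" for Q
  proof -
    have "{x \<in> {..<?d}. Q x} = (\<Union>j\<in>?col ` {..<?d}. {x \<in> {..<?d}. ?col x = j \<and> Q x})" by auto
    from arg_cong[OF this, of card] show ?thesis
      by (rule trans) (rule card_UN_disjoint, auto)
  qed
  have "card {x \<in> {..<?d}. ?row (\<pi> x) < r} = card {x \<in> {..<?d}. ?row x < r}"
  proof (rule bij_betw_same_card[of \<pi>])
    have "\<pi> ` {x \<in> {..<?d}. ?row (\<pi> x) < r} = {x \<in> {..<?d}. ?row x < r}"
    proof -
      have "x \<in> \<pi> ` {x \<in> {..<?d}. ?row (\<pi> x) < r}" if "x < ?d" "?row x < r" for x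
        using that permutes_inverses(1)[OF pi, of x] permutes_in_image[OF permutes_inv[OF pi], of x]
        by (intro image_eqI[of _ _ "inv \<pi> x"]) auto
      then show ?thesis using permutes_in_image[OF pi] by auto
    qed
    then show "bij_betw \<pi> {x \<in> {..<?d}. ?row (\<pi> x) < r} {x \<in> {..<?d}. ?row x < r}"
      using permutes_inj[OF pi] by (auto simp: bij_betw_def inj_on_def inj_def)
  qed
  then have "(\<Sum>j\<in>?col ` {..<?d}. a j) = (\<Sum>j\<in>?col ` {..<?d}. b j)"
    unfolding a_def b_def by (simp only: split[symmetric])
  then have ab: "a (?col m) = b (?col m)"
    by (rule sum_mono_inv) (use le m in auto)
  have "?row x < r" if "x < ?d" "?col x = ?col m" for x
  proof (rule ccontr)
    assume "\<not> ?row x < r"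
    then have "p ! ?row x \<le> p ! r"
      using cells_nth[OF that(1)] by (intro partition_mono[OF p]) auto
    then show False using cells_nth[OF that(1)] that r by auto
  qed
  then have "b (?col m) = card {x \<in> {..<?d}. ?col x = ?col m}"
    unfolding b_def by (intro arg_cong[of _ _ card]) auto
  moreover have "a (?col m) < card {x \<in> {..<?d}. ?col x = ?col m}"
    unfolding a_def by (intro psubset_card_mono) (use m r_def in auto)
  ultimately show False using ab by simp
qed

text \<open>Let \<kappa> move each position m inside its column to the row of \<pi> m;
  \<open>rearrangement_fits\<close> says that this cell belongs to the diagram, and separation makes
  \<kappa> injective. What remains, \<pi> followed after the inverse of \<kappa>, preserves
  rows.\<close>

lemma row_col_factorization:
  assumes p: "is_partition p" and pi: "\<pi> permutes {..<sum_list p}"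
    and sep: "\<And>x y. x < sum_list p \<Longrightarrow> y < sum_list p \<Longrightarrow> x \<noteq> y \<Longrightarrow>
      snd (cells p ! x) = snd (cells p ! y) \<Longrightarrow> fst (cells p ! \<pi> x) \<noteq> fst (cells p ! \<pi> y)"
  obtains \<rho> \<kappa> where "\<rho> \<in> row_group p" "\<kappa> \<in> col_group p" "\<pi> = \<rho> \<circ> \<kappa>"
proof -
  let ?d = "sum_list p"
  have "\<exists>m'<?d. cells p ! m' = (fst (cells p ! \<pi> m), snd (cells p ! m))" if "m < ?d" for m
  proof -
    have "(fst (cells p ! \<pi> m), snd (cells p ! m)) \<in> set (cells p)"
      by (rule rearrangement_fits[OF p pi]) (fact sep, fact that)
    then show ?thesis unfolding in_set_conv_nth length_cells .
  qed
  then obtain k where k: "\<And>m. m < ?d \<Longrightarrow> k m < ?d \<and>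
      cells p ! k m = (fst (cells p ! \<pi> m), snd (cells p ! m))"
    by metis
  define \<kappa> where "\<kappa> m = (if m < ?d then k m else m)" for m
  have "inj_on \<kappa> {..<?d}"
  proof (rule inj_onI)
    fix x y assume xy: "x \<in> {..<?d}" "y \<in> {..<?d}" "\<kappa> x = \<kappa> y"
    then have "cells p ! k x = cells p ! k y" by (simp add: \<kappa>_def)
    then show "x = y" using k[of x] k[of y] xy sep[of x y] by auto
  qed
  moreover have "\<kappa> ` {..<?d} \<subseteq> {..<?d}" using k by (auto simp: \<kappa>_def)
  ultimately have "\<kappa> permutes {..<?d}"
    by (intro bij_imp_permutes bij_betw_imageI endo_inj_surj) (simp_all add: \<kappa>_def)
  then have kap: "\<kappa> \<in> col_group p" using k by (auto simp: col_group_def \<kappa>_def)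
  define \<rho> where "\<rho> = \<pi> \<circ> inv \<kappa>"
  have "\<rho> permutes {..<?d}"
    unfolding \<rho>_def by (intro permutes_compose permutes_inv pi \<open>\<kappa> permutes {..<?d}\<close>)
  moreover have "fst (cells p ! \<rho> m) = fst (cells p ! m)" if "m < ?d" for m
  proof -
    have *: "inv \<kappa> m < ?d" "\<kappa> (inv \<kappa> m) = m"
      using that permutes_in_image[OF permutes_inv[OF \<open>\<kappa> permutes {..<?d}\<close>], of m]
        permutes_inverses(1)[OF \<open>\<kappa> permutes {..<?d}\<close>] by auto
    then have "k (inv \<kappa> m) = m" by (simp add: \<kappa>_def)
    then show ?thesis using k[OF *(1)] by (simp add: \<rho>_def)
  qed
  ultimately have "\<rho> \<in> row_group p" by (simp add: row_group_def)
  moreover have "\<pi> = \<rho> \<circ> \<kappa>"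
    using permutes_inv_o(2)[OF \<open>\<kappa> permutes {..<?d}\<close>] by (simp add: \<rho>_def o_assoc[symmetric])
  ultimately show ?thesis using kap that by blast
qed

section \<open>Row symmetrization and column antisymmetrization\<close>

lemma row_group_permutes: "s \<in> row_group p \<Longrightarrow> s permutes {..<sum_list p}"
  and col_group_permutes: "t \<in> col_group p \<Longrightarrow> t permutes {..<sum_list p}"
  by (simp_all add: row_group_def col_group_def)

lemma finite_row_group: "finite (row_group p)" and finite_col_group: "finite (col_group p)"
  by (rule finite_subset[OF _ finite_perms[of "sum_list p"]], auto simp: row_group_def col_group_def)+

lemma row_group_compose: "s \<in> row_group p \<Longrightarrow> s' \<in> row_group p \<Longrightarrow> s \<circ> s' \<in> row_group p"
  using permutes_in_image[of s' "{..<sum_list p}"] permutes_compose[of s' "{..<sum_list p}" s]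
  by (simp add: row_group_def)

lemma col_group_compose: "t \<in> col_group p \<Longrightarrow> t' \<in> col_group p \<Longrightarrow> t \<circ> t' \<in> col_group p"
  using permutes_in_image[of t' "{..<sum_list p}"] permutes_compose[of t' "{..<sum_list p}" t]
  by (simp add: col_group_def)

lemma row_group_inv: assumes "s \<in> row_group p" shows "inv s \<in> row_group p"
proof -
  have s: "s permutes {..<sum_list p}" using assms by (rule row_group_permutes)
  have "fst (cells p ! inv s m) = fst (cells p ! m)" if "m < sum_list p" for m
    using assms that permutes_in_image[OF permutes_inv[OF s], of m] permutes_inverses(1)[OF s, of m]
    unfolding row_group_def by force
  then show ?thesis using permutes_inv[OF s] by (simp add: row_group_def)
qed

lemma col_group_inv: assumes "s \<in> col_group p" shows "inv s \<in> col_group p"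
proof -
  have s: "s permutes {..<sum_list p}" using assms by (rule col_group_permutes)
  have "snd (cells p ! inv s m) = snd (cells p ! m)" if "m < sum_list p" for m
    using assms that permutes_in_image[OF permutes_inv[OF s], of m] permutes_inverses(1)[OF s, of m]
    unfolding col_group_def by force
  then show ?thesis using permutes_inv[OF s] by (simp add: col_group_def)
qed

definition row_sym :: "nat list \<Rightarrow> ('k list \<Rightarrow>\<^sub>0 complex) \<Rightarrow> ('k list \<Rightarrow>\<^sub>0 complex)"
  where "row_sym p x = (\<Sum>\<sigma>\<in>row_group p. tperm \<sigma> x)"

definition col_antisym :: "nat list \<Rightarrow> ('k list \<Rightarrow>\<^sub>0 complex) \<Rightarrow> ('k list \<Rightarrow>\<^sub>0 complex)"
  where "col_antisym p x = (\<Sum>\<tau>\<in>col_group p. of_int (sign \<tau>) *\<^sub>C tperm \<tau> x)"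

lemma galg_row_sym: "galg (sum_list p) (row_sym p)"
  unfolding row_sym_def by (intro galg_sum galg_tperm) (rule row_group_permutes)

lemma galg_col_antisym: "galg (sum_list p) (col_antisym p)"
  unfolding col_antisym_def by (intro galg_sum galg_scale galg_tperm) (rule col_group_permutes)

text \<open>In a right action the left factor of a product acts first, so rows are symmetrized
  before columns are antisymmetrized.\<close>

lemma young_sym_eq: "x \<in> homog (sum_list p) \<Longrightarrow> young_sym p x = col_antisym p (row_sym p x)"
  unfolding young_sym_def col_antisym_def row_sym_def
  by (subst sum.swap) (simp add: clinear_simps[OF clinear_tperm] cvec.scale_sum_right tperm_tperm
    col_group_permutes)

lemma galg_young_sym: "galg (sum_list p) (young_sym p)"
  using galg_comp[OF galg_col_antisym galg_row_sym] by (simp add: young_sym_eq cong: galg_cong)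

lemma tperm_row_sym:
  assumes "x \<in> homog (sum_list p)" "\<rho> \<in> row_group p"
  shows "tperm \<rho> (row_sym p x) = row_sym p x"
proof -
  have "tperm \<rho> (row_sym p x) = (\<Sum>\<sigma>\<in>row_group p. tperm (\<sigma> \<circ> \<rho>) x)"
    using assms by (simp add: row_sym_def clinear_simps[OF clinear_tperm] tperm_tperm row_group_permutes)
  also have "\<dots> = (\<Sum>\<sigma>\<in>row_group p. tperm \<sigma> x)"
    by (rule sum.reindex_bij_witness[of _ "\<lambda>\<sigma>. \<sigma> \<circ> inv \<rho>" "\<lambda>\<sigma>. \<sigma> \<circ> \<rho>"])
      (use assms permutes_inv_o[OF row_group_permutes[OF assms(2)]] in
        \<open>auto simp: row_group_compose row_group_inv o_assoc[symmetric]\<close>)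
  finally show ?thesis by (simp add: row_sym_def)
qed

lemma col_antisym_tperm:
  assumes "x \<in> homog (sum_list p)" "\<kappa> \<in> col_group p"
  shows "col_antisym p (tperm \<kappa> x) = of_int (sign \<kappa>) *\<^sub>C col_antisym p x"
proof -
  have perm: "permutation \<tau>" if "\<tau> \<in> col_group p" for \<tau>
    using col_group_permutes[OF that] permutation_permutes by blast
  have "col_antisym p (tperm \<kappa> x) = (\<Sum>\<tau>\<in>col_group p. of_int (sign \<tau>) *\<^sub>C tperm (\<kappa> \<circ> \<tau>) x)"
    using assms by (simp add: col_antisym_def tperm_tperm col_group_permutes)
  also have "\<dots> = (\<Sum>\<tau>\<in>col_group p. of_int (sign (inv \<kappa> \<circ> \<tau>)) *\<^sub>C tperm \<tau> x)"
    by (rule sum.reindex_bij_witness[of _ "\<lambda>\<tau>. inv \<kappa> \<circ> \<tau>" "\<lambda>\<tau>. \<kappa> \<circ> \<tau>"])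
      (use assms permutes_inv_o[OF col_group_permutes[OF assms(2)]] in
        \<open>auto simp: col_group_compose col_group_inv o_assoc\<close>)
  also have "\<dots> = of_int (sign \<kappa>) *\<^sub>C col_antisym p x"
    using assms(2)
    by (simp add: col_antisym_def cvec.scale_sum_right sign_compose perm permutation_inverse sign_inverse)
  finally show ?thesis .
qed

text \<open>The classical dichotomy. If \<pi> sends two positions of one column into one row, the
  transposition of the images is absorbed by the row symmetrizer; moved past \<pi> it becomes the
  transposition of the two positions, on which the column antisymmetrizer gives the sign -1, so the
  result is 0. Otherwise \<pi> is a row permutation after a column permutation, and both are
  absorbed up to a sign. The scalar must be independent of the tensor.\<close>

lemma col_antisym_tperm_row_sym:
  assumes "is_partition p" "\<pi> permutes {..<sum_list p}"
  obtains s where "\<And>x::'k list \<Rightarrow>\<^sub>0 complex. x \<in> homog (sum_list p) \<Longrightarrow>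
    col_antisym p (tperm \<pi> (row_sym p x)) = s *\<^sub>C col_antisym p (row_sym p x)"
proof (cases "\<exists>x y. x < sum_list p \<and> y < sum_list p \<and> x \<noteq> y \<and>
      snd (cells p ! x) = snd (cells p ! y) \<and> fst (cells p ! \<pi> x) = fst (cells p ! \<pi> y)")
  case True
  let ?d = "sum_list p"
  obtain a b where ab: "a < ?d" "b < ?d" "a \<noteq> b" "snd (cells p ! a) = snd (cells p ! b)"
    "fst (cells p ! \<pi> a) = fst (cells p ! \<pi> b)" using True by blast
  let ?t = "transpose a b" and ?t' = "transpose (\<pi> a) (\<pi> b)"
  have pab: "\<pi> a < ?d" "\<pi> b < ?d" using permutes_in_image[OF assms(2)] ab by auto
  have t: "?t \<in> col_group p" "?t' \<in> row_group p"
    using ab pab by (auto simp: col_group_def row_group_def transpose_def intro!: permutes_swap_id)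
  have "?t' \<circ> \<pi> = \<pi> \<circ> ?t"
    using inj_eq[OF permutes_inj[OF assms(2)]] by (auto simp: transpose_def fun_eq_iff)
  have "col_antisym p (tperm \<pi> (row_sym p x)) = 0 *\<^sub>C col_antisym p (row_sym p x)"
    if x: "x \<in> homog ?d" for x :: "'k list \<Rightarrow>\<^sub>0 complex"
  proof -
    have rx: "row_sym p x \<in> homog ?d" by (rule galg_homog[OF galg_row_sym x])
    have "col_antisym p (tperm \<pi> (row_sym p x)) = col_antisym p (tperm \<pi> (tperm ?t' (row_sym p x)))"
      by (simp add: tperm_row_sym x t)
    also have "\<dots> = col_antisym p (tperm ?t (tperm \<pi> (row_sym p x)))"
      using tperm_tperm[OF rx assms(2), of ?t'] tperm_tperm[OF rx col_group_permutes[OF t(1)], of \<pi>]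
        \<open>?t' \<circ> \<pi> = \<pi> \<circ> ?t\<close> by simp
    also have "\<dots> = - col_antisym p (tperm \<pi> (row_sym p x))"
      using col_antisym_tperm[OF tperm_homog[OF rx] t(1)] ab by (simp add: sign_swap_id)
    finally have "2 *\<^sub>C col_antisym p (tperm \<pi> (row_sym p x)) = 0"
      by (metis add.right_inverse cvec.scale_left_distrib cvec.scale_one one_add_one)
    then show ?thesis by simp
  qed
  then show ?thesis using that by blast
next
  case False
  then obtain \<rho> \<kappa> where rk: "\<rho> \<in> row_group p" "\<kappa> \<in> col_group p" "\<pi> = \<rho> \<circ> \<kappa>"
    using row_col_factorization[OF assms] by metis
  have "col_antisym p (tperm \<pi> (row_sym p x)) = of_int (sign \<kappa>) *\<^sub>C col_antisym p (row_sym p x)"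
    if x: "x \<in> homog (sum_list p)" for x :: "'k list \<Rightarrow>\<^sub>0 complex"
  proof -
    have rx: "row_sym p x \<in> homog (sum_list p)" by (rule galg_homog[OF galg_row_sym x])
    have "tperm \<pi> (row_sym p x) = tperm \<kappa> (row_sym p x)"
      using tperm_tperm[OF rx col_group_permutes[OF rk(2)], of \<rho>] rk by (simp add: tperm_row_sym x)
    then show ?thesis using col_antisym_tperm[OF rx rk(2)] by simp
  qed
  then show ?thesis using that by blast
qed

text \<open>Write the symmetrizer as B A with A the row and B the column part. In B A Q B A the
  middle part A Q B is a combination of permutations \<pi>, and each B \<pi> A is a multiple of B
  A.\<close>

lemma young_sym_sandwich:
  assumes "is_partition p" "galg (sum_list p) Q"
  obtains s where "\<And>x::'k list \<Rightarrow>\<^sub>0 complex. x \<in> homog (sum_list p) \<Longrightarrow>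
    young_sym p (Q (young_sym p x)) = s *\<^sub>C young_sym p x"
proof -
  let ?d = "sum_list p" and ?A = "row_sym p" and ?B = "col_antisym p"
  have "galg ?d (\<lambda>x::'k list \<Rightarrow>\<^sub>0 complex. ?A (Q (?B x)))"
    by (intro galg_comp[OF galg_row_sym] galg_comp[OF assms(2)] galg_col_antisym)
  then obtain f where f: "\<forall>x::'k list \<Rightarrow>\<^sub>0 complex\<in>homog ?d.
      ?A (Q (?B x)) = (\<Sum>s | s permutes {..<?d}. f s *\<^sub>C tperm s x)"
    unfolding galg_def by blast
  have "\<forall>\<pi>. \<exists>s. \<pi> permutes {..<?d} \<longrightarrow> (\<forall>x::'k list \<Rightarrow>\<^sub>0 complex\<in>homog ?d.
      ?B (tperm \<pi> (?A x)) = s *\<^sub>C ?B (?A x))"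
    using col_antisym_tperm_row_sym[OF assms(1)] by metis
  then obtain s where s: "\<And>\<pi> x::'k list \<Rightarrow>\<^sub>0 complex. \<pi> permutes {..<?d} \<Longrightarrow> x \<in> homog ?d \<Longrightarrow>
      ?B (tperm \<pi> (?A x)) = s \<pi> *\<^sub>C ?B (?A x)"
    by metis
  have "young_sym p (Q (young_sym p x)) = (\<Sum>\<pi> | \<pi> permutes {..<?d}. f \<pi> * s \<pi>) *\<^sub>C young_sym p x"
    if x: "x \<in> homog ?d" for x :: "'k list \<Rightarrow>\<^sub>0 complex"
  proof -
    have Ax: "?A x \<in> homog ?d" by (rule galg_homog[OF galg_row_sym x])
    obtain B' where B': "clinear B'" "\<And>x::'k list \<Rightarrow>\<^sub>0 complex. x \<in> homog ?d \<Longrightarrow> ?B x = B' x"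
      using galg_linear[OF galg_col_antisym] by blast
    have "young_sym p (Q (young_sym p x)) = ?B (?A (Q (?B (?A x))))"
      using young_sym_eq[OF x] young_sym_eq[OF galg_homog[OF assms(2) galg_homog[OF galg_young_sym x]]]
      by simp
    also have "\<dots> = B' (\<Sum>\<pi> | \<pi> permutes {..<?d}. f \<pi> *\<^sub>C tperm \<pi> (?A x))"
      using f Ax by (simp add: B'(2) homog_sum homog_scale tperm_homog)
    also have "\<dots> = (\<Sum>\<pi> | \<pi> permutes {..<?d}. f \<pi> *\<^sub>C ?B (tperm \<pi> (?A x)))"
      by (simp add: clinear_simps[OF B'(1)] B'(2) tperm_homog Ax)
    also have "\<dots> = (\<Sum>\<pi> | \<pi> permutes {..<?d}. f \<pi> * s \<pi>) *\<^sub>C ?B (?A x)"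
      by (simp add: s x cvec.scale_sum_left)
    finally show ?thesis by (simp add: young_sym_eq x)
  qed
  then show ?thesis using that by blast
qed

lemma row_col_trivial:
  assumes "\<sigma> \<in> row_group p" "\<tau> \<in> col_group p" "\<sigma> \<circ> \<tau> = id"
  shows "\<tau> = id"
proof
  fix m
  show "\<tau> m = id m"
  proof (cases "m < sum_list p")
    case True
    then have tm: "\<tau> m < sum_list p" using permutes_in_image[OF col_group_permutes[OF assms(2)]] by simp
    have "\<sigma> (\<tau> m) = m" using assms(3) by (simp add: fun_eq_iff)
    then have "fst (cells p ! \<tau> m) = fst (cells p ! m)" using assms(1) tm by (force simp: row_group_def)
    moreover have "snd (cells p ! \<tau> m) = snd (cells p ! m)" using assms(2) True by (simp add: col_group_def)
    ultimately show ?thesis using True tm cells_nth_inj[of "\<tau> m" p m] by (simp add: prod_eq_iff)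
  next
    case False
    then show ?thesis using col_group_permutes[OF assms(2)] by (simp add: permutes_def)
  qed
qed

text \<open>Tensors on which the group algebra acts freely.\<close>

definition generic :: "('k list \<Rightarrow>\<^sub>0 complex) \<Rightarrow> 'k list \<Rightarrow> bool"
  where "generic x ks \<longleftrightarrow> x \<in> homog (length ks) \<and> (\<forall>s. s permutes {..<length ks} \<longrightarrow>
    Poly_Mapping.lookup x (permute_list s ks) = (if s = id then 1 else 0))"

lemma lookup_tperm_generic:
  assumes "generic x ks" "s permutes {..<length ks}" "t permutes {..<length ks}"
  shows "Poly_Mapping.lookup (tperm s x) (permute_list t ks) = (if s = t then 1 else 0)"
proof -
  have "Poly_Mapping.lookup (tperm s x) (permute_list t ks) = Poly_Mapping.lookup x (permute_list (t \<circ> inv s) ks)"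
    using assms permutes_inv[OF assms(2)]
    by (subst lookup_tperm[OF assms(2)]) (auto simp: generic_def permute_list_compose)
  also have "\<dots> = (if t \<circ> inv s = id then 1 else 0)"
    using assms permutes_compose[OF permutes_inv[OF assms(2)] assms(3)] by (simp add: generic_def)
  also have "t \<circ> inv s = id \<longleftrightarrow> s = t"
    using permutes_inv_o[OF assms(2)] by (metis comp_id comp_assoc id_comp)
  finally show ?thesis .
qed

text \<open>On a generic tensor the coefficient of each permutation in \<open>P\<close> can be read
  off as the coefficient of the correspondingly permuted word. Vanishing at one such tensor
  therefore makes \<open>P\<close> vanish on the whole degree.\<close>

lemma galg_generic:
  assumes "galg (length ks) P" "generic x ks" "P x = 0" "y \<in> homog (length ks)"
  shows "P y = 0"
proof -
  obtain f where f: "\<forall>x\<in>homog (length ks). P x = (\<Sum>s | s permutes {..<length ks}. f s *\<^sub>C tperm s x)"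
    using assms unfolding galg_def by auto
  have "f t = 0" if "t permutes {..<length ks}" for t
  proof -
    have "Poly_Mapping.lookup (P x) (permute_list t ks) =
        (\<Sum>s | s permutes {..<length ks}. f s * (if s = t then 1 else 0))"
      using f assms(2) that by (simp add: generic_def lookup_sum lookup_tperm_generic[OF assms(2)])
    also have "\<dots> = f t" using that by (simp add: finite_perms if_distrib[of "(*) _"] cong: if_cong)
    finally show ?thesis using assms(3) by simp
  qed
  then show ?thesis using f assms(4) by simp
qed

text \<open>The coefficient at \<open>ks\<close> is that of the identity in the symmetrizer. It
  equals 1, since a row permutation and a column permutation compose to the identity only if both
  are trivial.\<close>

lemma young_sym_generic_nonzero:
  assumes "generic x ks" "length ks = sum_list p"
  shows "young_sym p x \<noteq> 0"
proof -
  have "Poly_Mapping.lookup (young_sym p x) ks =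
      (\<Sum>\<sigma>\<in>row_group p. \<Sum>\<tau>\<in>col_group p. of_int (sign \<tau>) * (if \<sigma> \<circ> \<tau> = id then 1 else 0))"
    unfolding young_sym_def
    using lookup_tperm_generic[OF assms(1), of _ id] assms(2)
    by (simp add: lookup_sum row_group_permutes col_group_permutes permutes_compose permutes_id
      del: sum.delta sum.delta' cong: sum.cong)
  also have "\<dots> = (\<Sum>\<sigma>\<in>row_group p. \<Sum>\<tau>\<in>col_group p. if \<tau> = id then if \<sigma> = id then 1 else 0 else 0)"
    using row_col_trivial by (intro sum.cong refl) (auto simp: sign_id)
  also have "\<dots> = 1"
    using finite_row_group[of p] finite_col_group[of p]
    by (simp add: row_group_def col_group_def permutes_id)
  finally show ?thesis by auto
qed

text \<open>The scalar \<open>s\<close> comes from the sandwich property applied to the adjoint. If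
  it were 0, positive definiteness would make c' c x and then c x vanish, against the freeness at
  the generic tensor. Thus c' / s is a right inverse of the symmetrizer on its image.\<close>

lemma young_sym_adjoint:
  assumes "is_partition p" "generic (x :: 'k list \<Rightarrow>\<^sub>0 complex) ks" "length ks = sum_list p"
  obtains c' s where "galg (sum_list p) c'" "s \<noteq> 0"
    "\<And>y z :: 'k list \<Rightarrow>\<^sub>0 complex. y \<in> homog (sum_list p) \<Longrightarrow> z \<in> homog (sum_list p) \<Longrightarrow>
      inner (young_sym p y) z = inner y (c' z)"
    "\<And>y z :: 'k list \<Rightarrow>\<^sub>0 complex. y \<in> homog (sum_list p) \<Longrightarrow> z \<in> homog (sum_list p) \<Longrightarrow>
      inner (c' y) z = inner y (young_sym p z)"
    "\<And>y :: 'k list \<Rightarrow>\<^sub>0 complex. y \<in> homog (sum_list p) \<Longrightarrow>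
      young_sym p (c' (young_sym p y)) = s *\<^sub>C young_sym p y"
proof -
  let ?d = "sum_list p" and ?c = "young_sym p"
  obtain c' where c': "galg ?d c'"
    "\<And>y z :: 'k list \<Rightarrow>\<^sub>0 complex. y \<in> homog ?d \<Longrightarrow> z \<in> homog ?d \<Longrightarrow> inner (?c y) z = inner y (c' z)"
    "\<And>y z :: 'k list \<Rightarrow>\<^sub>0 complex. y \<in> homog ?d \<Longrightarrow> z \<in> homog ?d \<Longrightarrow> inner (c' y) z = inner y (?c z)"
    using galg_adjoint[OF galg_young_sym] by metis
  obtain s where s: "\<And>y :: 'k list \<Rightarrow>\<^sub>0 complex. y \<in> homog ?d \<Longrightarrow> ?c (c' (?c y)) = s *\<^sub>C ?c y"
    using young_sym_sandwich[OF assms(1) c'(1)] by metis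
  have "s \<noteq> 0"
  proof
    assume "s = 0"
    have x: "x \<in> homog ?d" using assms(2,3) by (simp add: generic_def)
    note h = x galg_homog[OF galg_young_sym x] galg_homog[OF c'(1) galg_homog[OF galg_young_sym x]]
    have "inner (c' (?c x)) (c' (?c x)) = inner (?c (c' (?c x))) (?c x)" using c'(2) h by simp
    then have "c' (?c x) = 0" using s[OF x] \<open>s = 0\<close> inner_self by (auto simp: inner_0)
    then have "inner (?c x) (?c x) = 0" using c'(3)[of "?c x" x] h by (simp add: inner_0)
    then show False using young_sym_generic_nonzero[OF assms(2,3)] by (simp add: inner_self)
  qed
  then show ?thesis using that c' s by metis
qed

section \<open>Contractions and traceless tensors\<close>

text \<open>Contraction of one position against a vector outside the tensor: this is what a
  contraction involving the first position becomes once the first factor is split off.\<close>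

definition vcontract :: "V \<Rightarrow> nat \<Rightarrow> (idx list \<Rightarrow>\<^sub>0 complex) \<Rightarrow> (idx list \<Rightarrow>\<^sub>0 complex)"
  where "vcontract b i = lin_ext (\<lambda>ks. omega b (bvec (ks ! i)) *\<^sub>C bvec (nths ks (- {i})))"

lemma clinear_vcontract: "clinear (vcontract b i)"
  unfolding vcontract_def by (rule clinear_lin_ext)

lemma vcontract_bvec: "vcontract b i (bvec ks) = omega b (bvec (ks ! i)) *\<^sub>C bvec (nths ks (- {i}))"
  by (simp add: vcontract_def)

lemma contract_bvec: "contract i j (bvec ks) = omega_basis (ks ! i) (ks ! j) *\<^sub>C bvec (nths ks (- {i, j}))"
  by (simp add: contract_def)

lemma clinear_vcontract_left: "clinear (\<lambda>b. vcontract b i x)"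
  unfolding vcontract_def
  by (rule clinearI)
    (simp_all add: omega_add_left omega_scale_left cvec.scale_left_distrib lin_ext_plus
      flip: lin_ext_scale cvec.scale_scale)

lemma clinear_omega_scale:
  "clinear (\<lambda>v. omega v w *\<^sub>C x)" "clinear (\<lambda>v. omega w v *\<^sub>C x)" "clinear (\<lambda>x. c *\<^sub>C x)"
  by (auto intro!: clinearI simp: omega_add_left omega_scale_left omega_add_right omega_scale_right
    cvec.scale_left_distrib cvec.scale_right_distrib mult.commute)

lemma nths_Cons_compl:
  "nths (k # ks) (- {0}) = ks"
  "nths (k # ks) (- {Suc i}) = k # nths ks (- {i})"
  "nths (k # ks) (- {0, Suc j}) = nths ks (- {j})"
  "nths (k # ks) (- {Suc i, Suc j}) = k # nths ks (- {i, j})"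
proof -
  have "{m. Suc m \<noteq> 0} = UNIV" "{m. m \<noteq> i} = - {i}" "{m. m \<noteq> j} = - {j}"
    "{m. m \<noteq> i \<and> m \<noteq> j} = - {i, j}" by auto
  then show "nths (k # ks) (- {0}) = ks"
    "nths (k # ks) (- {Suc i}) = k # nths ks (- {i})"
    "nths (k # ks) (- {0, Suc j}) = nths ks (- {j})"
    "nths (k # ks) (- {Suc i, Suc j}) = k # nths ks (- {i, j})"
    by (simp_all add: nths_Cons nths_all)
qed

lemma vcontract_tcons_0: "vcontract b 0 (v \<otimes> x) = omega b v *\<^sub>C x"
  by (rule bilinear_eq_basis[of "\<lambda>v x. vcontract b 0 (v \<otimes> x)" "\<lambda>v x. omega b v *\<^sub>C x"])
    (auto intro!: clinear_tensor_intros clinear_compose[OF clinear_vcontract] clinear_omega_scale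
      simp: vcontract_bvec nths_Cons_compl)

lemma vcontract_tcons_Suc: "vcontract b (Suc i) (v \<otimes> x) = v \<otimes> vcontract b i x"
  by (rule bilinear_eq_basis[of "\<lambda>v x. vcontract b (Suc i) (v \<otimes> x)" "\<lambda>v x. v \<otimes> vcontract b i x"])
    (auto intro!: clinear_tensor_intros clinear_compose[OF clinear_vcontract] clinear_vcontract
      simp: vcontract_bvec nths_Cons_compl tcons_right)

lemma contract_tcons_0: "contract 0 (Suc j) (v \<otimes> x) = vcontract v j x"
  by (rule bilinear_eq_basis[of "\<lambda>v x. contract 0 (Suc j) (v \<otimes> x)" "\<lambda>v x. vcontract v j x"])
    (auto intro!: clinear_tensor_intros clinear_vcontract clinear_vcontract_left
      simp: contract_bvec vcontract_bvec nths_Cons_compl omega_bvec)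

lemma contract_tcons_Suc: "contract (Suc i) (Suc j) (v \<otimes> x) = v \<otimes> contract i j x"
  by (rule bilinear_eq_basis[of "\<lambda>v x. contract (Suc i) (Suc j) (v \<otimes> x)" "\<lambda>v x. v \<otimes> contract i j x"])
    (auto intro!: clinear_tensor_intros simp: contract_bvec nths_Cons_compl tcons_right)

lemma vcontract_tensor:
  "i < length vs \<Longrightarrow> vcontract b i (tensor vs) = omega b (vs ! i) *\<^sub>C tensor (nths vs (- {i}))"
proof (induction vs arbitrary: i)
  case (Cons v vs)
  then show ?case
    by (cases i) (simp_all add: vcontract_tcons_0 vcontract_tcons_Suc nths_Cons_compl tcons_right)
qed simp

lemma contract_tensor:
  "i < j \<Longrightarrow> j < length vs \<Longrightarrow>
    contract i j (tensor vs) = omega (vs ! i) (vs ! j) *\<^sub>C tensor (nths vs (- {i, j}))"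
proof (induction vs arbitrary: i j)
  case (Cons v vs)
  obtain j' where "j = Suc j'" using Cons.prems by (cases j) auto
  with Cons show ?case
    by (cases i) (simp_all add: contract_tcons_0 contract_tcons_Suc vcontract_tensor nths_Cons_compl tcons_right)
qed simp

lemma contract_tmap:
  assumes g: "clinear g" "\<And>v w. omega (g v) (g w) = omega v w"
    and "i < j" "j < d" "x \<in> homog d"
  shows "contract i j (tmap g x) = tmap g (contract i j x)"
proof (rule clinear_eq_homog_tensor[of "\<lambda>x. contract i j (tmap g x)" "\<lambda>x. tmap g (contract i j x)", OF _ _ assms(5)])
  fix ks :: "idx list" assume "length ks = d"
  then show "contract i j (tmap g (bvec ks)) = tmap g (contract i j (bvec ks))"
    using contract_tensor[of i j "map (\<lambda>k. g (bvec k)) ks"] assms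
    by (simp add: tmap_bvec contract_def clinear_simps[OF clinear_tmap] nths_map omega_bvec)
qed (auto intro!: clinear_tensor_intros)

lemma nths_compl_eq_iff:
  "length ks = length ws \<Longrightarrow>
    nths ks (- A) = nths ws (- A) \<longleftrightarrow> (\<forall>q<length ks. q \<notin> A \<longrightarrow> ks ! q = ws ! q)"
proof (induction ks ws arbitrary: A rule: list_induct2)
  case (Cons k ks w ws)
  have "{j. Suc j \<in> - A} = - {j. Suc j \<in> A}" by auto
  moreover have "(\<forall>q<Suc (length ks). q \<notin> A \<longrightarrow> (k # ks) ! q = (w # ws) ! q) \<longleftrightarrow>
    (0 \<notin> A \<longrightarrow> k = w) \<and> (\<forall>q<length ks. Suc q \<notin> A \<longrightarrow> ks ! q = ws ! q)"
    by (auto simp: less_Suc_eq_0_disj)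
  ultimately show ?case using Cons.IH[of "{j. Suc j \<in> A}"] by (simp add: nths_Cons)
qed simp

text \<open>The coefficient of a contraction at the word obtained by deleting the letters \<open>i\<close> and \<open>j\<close> of
  \<open>ws\<close>, in a form which is symmetric under permutations of the positions.\<close>

definition pair_coeff :: "nat \<Rightarrow> nat \<Rightarrow> idx list \<Rightarrow> idx list \<Rightarrow> complex"
  where "pair_coeff i j ws ks = (if \<forall>q<length ks. q \<notin> {i, j} \<longrightarrow> ks ! q = ws ! q
    then omega_basis (ks ! i) (ks ! j) else 0)"

lemma linfun_cong: "(\<And>k. k \<in> Poly_Mapping.keys x \<Longrightarrow> c k = c' k) \<Longrightarrow> linfun c x = linfun c' x"
  by (simp add: linfun_def)

lemma lookup_contract:
  assumes "x \<in> homog d" "length ws = d"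
  shows "Poly_Mapping.lookup (contract i j x) (nths ws (- {i, j})) = linfun (pair_coeff i j ws) x"
  using assms
  by (auto simp: contract_def lin_ext_def lookup_sum linfun_def lookup_bvec homog_def
    pair_coeff_def nths_compl_eq_iff intro!: sum.cong)

text \<open>A word that does not arise by deleting the two letters from a word of \<open>x\<close>
  has coefficient 0 anyway, so it suffices to test at deletions.\<close>

lemma contract_eq_0_iff:
  assumes "x \<in> homog d"
  shows "contract i j x = 0 \<longleftrightarrow> (\<forall>ws. length ws = d \<longrightarrow> linfun (pair_coeff i j ws) x = 0)"
proof
  assume "contract i j x = 0"
  then show "\<forall>ws. length ws = d \<longrightarrow> linfun (pair_coeff i j ws) x = 0"
    using lookup_contract[OF assms, of _ i j] by simp
next
  assume *: "\<forall>ws. length ws = d \<longrightarrow> linfun (pair_coeff i j ws) x = 0"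
  have "Poly_Mapping.lookup (contract i j x) vs = 0" for vs
  proof (rule ccontr)
    assume nz: "Poly_Mapping.lookup (contract i j x) vs \<noteq> 0"
    then have "(\<Sum>ks\<in>Poly_Mapping.keys x. Poly_Mapping.lookup x ks * (omega_basis (ks ! i) (ks ! j) *
        (if nths ks (- {i, j}) = vs then 1 else 0))) \<noteq> 0"
      by (simp add: contract_def lin_ext_def lookup_sum lookup_bvec mult.assoc)
    then obtain ks where "ks \<in> Poly_Mapping.keys x" "nths ks (- {i, j}) = vs"
      by (auto elim!: sum.not_neutral_contains_not_neutral split: if_splits)
    then show False
      using lookup_contract[OF assms, of ks i j] * nz assms by (auto simp: homog_def)
  qed
  then show "contract i j x = 0" by (intro poly_mapping_eqI) simp
qed

lemma linfun_lin_ext: "linfun c (lin_ext b x) = (\<Sum>k\<in>Poly_Mapping.keys x. Poly_Mapping.lookup x k * linfun c (b k))"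
proof -
  have "linfun c (sum f A) = (\<Sum>a\<in>A. linfun c (f a))" for f :: "'b \<Rightarrow> 'a \<Rightarrow>\<^sub>0 complex" and A
    by (induction A rule: infinite_finite_induct) (auto simp: linfun_add linfun_def[of c 0])
  then show ?thesis by (simp add: lin_ext_def linfun_scale)
qed

lemma pair_coeff_tperm:
  assumes "s permutes {..<d}" "x \<in> homog d" "length ws = d" "i < d" "j < d"
  shows "linfun (pair_coeff i j (permute_list s ws)) (tperm s x) = linfun (pair_coeff (s i) (s j) ws) x"
proof -
  have "pair_coeff i j (permute_list s ws) (permute_list s ks) = pair_coeff (s i) (s j) ws ks"
    if "length ks = d" for ks
  proof -
    have "(\<forall>q<d. q \<notin> {i, j} \<longrightarrow> ks ! s q = ws ! s q) \<longleftrightarrow> (\<forall>q<d. q \<notin> {s i, s j} \<longrightarrow> ks ! q = ws ! q)"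
      (is "?L \<longleftrightarrow> ?R")
    proof
      assume ?L
      show ?R
      proof (intro allI impI)
        fix q assume "q < d" "q \<notin> {s i, s j}"
        then have "inv s q < d" "s (inv s q) = q" "inv s q \<notin> {i, j}"
          using permutes_in_image[OF permutes_inv[OF assms(1)], of q] permutes_inverses(1)[OF assms(1), of q]
          by auto
        then show "ks ! q = ws ! q" using \<open>?L\<close> by metis
      qed
    next
      assume ?R
      show ?L
      proof (intro allI impI)
        fix q assume "q < d" "q \<notin> {i, j}"
        then have "s q < d" "s q \<notin> {s i, s j}"
          using permutes_in_image[OF assms(1), of q] inj_eq[OF permutes_inj[OF assms(1)]] by auto
        then show "ks ! s q = ws ! s q" using \<open>?R\<close> by blast
      qed
    qed
    then show ?thesis using that assms by (auto simp: pair_coeff_def permute_list_nth)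
  qed
  then show ?thesis
    unfolding tperm_def linfun_lin_ext
    using assms(2) by (auto simp: linfun_def homog_def intro!: sum.cong)
qed

lemma pair_coeff_swap: "linfun (pair_coeff j i ws) x = - linfun (pair_coeff i j ws) x"
proof -
  have "pair_coeff j i ws ks = -1 * pair_coeff i j ws ks" for ks
    using omega_basis_antisym[of "ks ! j" "ks ! i"] by (auto simp: pair_coeff_def)
  then have "linfun (pair_coeff j i ws) x = linfun (\<lambda>ks. -1 * pair_coeff i j ws ks) x"
    by (intro linfun_cong) simp
  then show ?thesis unfolding linfun_coeff(2) by simp
qed

lemma traceless_homog: "x \<in> traceless d \<Longrightarrow> x \<in> homog d"
  by (auto simp: traceless_def tpower_homog)

lemma subspace_traceless: "cvec.subspace (traceless d)"
  using subspace_tpower[of W d]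
  by (auto simp: cvec.subspace_def traceless_def clinear_simps[OF clinear_contract])

text \<open>Permuting by \<open>s\<close> turns the contraction of positions i and j into that of s
  i and s j. These may come in reversed order, which by antisymmetry of the form costs only a sign.
  Since the deletion of letters shifts positions, the argument runs on the coefficients
  \<open>pair_coeff\<close>.\<close>

lemma tperm_traceless:
  assumes s: "s permutes {..<d}" and x: "x \<in> traceless d"
  shows "tperm s x \<in> traceless d"
proof -
  have h: "x \<in> homog d" by (rule traceless_homog[OF x])
  have zero: "linfun (pair_coeff i j ws) x = 0" if "length ws = d" "i \<noteq> j" "i < d" "j < d" for i j ws
    using x that contract_eq_0_iff[OF h] pair_coeff_swap[of i j ws x]
    by (cases "i < j") (auto simp: traceless_def)
  have "contract i j (tperm s x) = 0" if ij: "i < j" "j < d" for i j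
    unfolding contract_eq_0_iff[OF tperm_homog[OF h]]
  proof (intro allI impI)
    fix ws :: "idx list" assume ws: "length ws = d"
    have "permute_list s (permute_list (inv s) ws) = ws" using inv_permutes_list[of s ws] s ws by simp
    then have "linfun (pair_coeff i j ws) (tperm s x) =
        linfun (pair_coeff (s i) (s j) (permute_list (inv s) ws)) x"
      using pair_coeff_tperm[OF s h, of "permute_list (inv s) ws" i j] ws ij by simp
    also have "\<dots> = 0"
      using ij ws permutes_in_image[OF s] inj_eq[OF permutes_inj[OF s], of i j] by (intro zero) auto
    finally show "linfun (pair_coeff i j ws) (tperm s x) = 0" .
  qed
  then show ?thesis using x tperm_tpower[OF s] by (auto simp: traceless_def)
qed

lemma galg_traceless: "galg d P \<Longrightarrow> x \<in> traceless d \<Longrightarrow> P x \<in> traceless d"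
  by (rule galg_closed) (auto intro: subspace_traceless tperm_traceless traceless_homog)

section \<open>Slices\<close>

definition slice :: "'k \<Rightarrow> ('k list \<Rightarrow>\<^sub>0 complex) \<Rightarrow> ('k list \<Rightarrow>\<^sub>0 complex)"
  where "slice k = lin_ext (\<lambda>ks. case ks of [] \<Rightarrow> 0 | a # as \<Rightarrow> if a = k then bvec as else 0)"

text \<open>Every basis vector has \<open>xi\<close> equal to 1, so dropping the first letter
  amounts to applying \<open>xi\<close> to the first factor; this kills tensors over
  \<open>W\<close>.\<close>

definition xi_head :: "(idx list \<Rightarrow>\<^sub>0 complex) \<Rightarrow> (idx list \<Rightarrow>\<^sub>0 complex)"
  where "xi_head = lin_ext (\<lambda>ks. case ks of [] \<Rightarrow> 0 | a # as \<Rightarrow> bvec as)"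

lemma clinear_slice: "clinear (slice k)" and clinear_xi_head: "clinear xi_head"
  unfolding slice_def xi_head_def by (rule clinear_lin_ext)+

lemma slice_bvec: "slice k (bvec (a # as)) = (if a = k then bvec as else 0)"
  by (simp add: slice_def)

lemma xi_head_bvec: "xi_head (bvec (a # as)) = bvec as"
  by (simp add: xi_head_def)

lemma slice_tcons: "slice k (v \<otimes> x) = Poly_Mapping.lookup v k *\<^sub>C x"
  by (rule bilinear_eq_basis[of "\<lambda>v x. slice k (v \<otimes> x)" "\<lambda>v x. Poly_Mapping.lookup v k *\<^sub>C x"])
    (auto intro!: clinear_tensor_intros clinear_compose[OF clinear_slice] clinear_omega_scale
      intro: clinearI simp: slice_bvec lookup_add cvec.scale_left_distrib lookup_bvec)

lemma xi_head_tcons: "xi_head (v \<otimes> x) = xi v *\<^sub>C x"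
  by (rule bilinear_eq_basis[of "\<lambda>v x. xi_head (v \<otimes> x)" "\<lambda>v x. xi v *\<^sub>C x"])
    (auto intro!: clinear_tensor_intros clinear_compose[OF clinear_xi_head] clinear_omega_scale
      intro: clinearI simp: xi_head_bvec xi_add xi_scale xi_bvec cvec.scale_left_distrib)

lemma slice_expand:
  assumes "x \<in> homog (Suc d)" "finite K" "\<And>ks. ks \<in> Poly_Mapping.keys x \<Longrightarrow> hd ks \<in> K"
  shows "x = (\<Sum>k\<in>K. bvec k \<otimes> slice k x)"
proof (rule clinear_eq_keys[of "\<lambda>x. x" "\<lambda>x. \<Sum>k\<in>K. bvec k \<otimes> slice k x"])
  show "clinear (\<lambda>x. \<Sum>k\<in>K. bvec k \<otimes> slice k x)"
    by (intro clinear_sums clinear_compose[OF clinear_tcons_right] clinear_slice)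
next
  fix ks assume "ks \<in> Poly_Mapping.keys x"
  then obtain a as where ks: "ks = a # as" "a \<in> K"
    using assms(1,3) by (cases ks) (force simp: homog_def)+
  have "(\<Sum>k\<in>K. bvec k \<otimes> slice k (bvec ks)) = (\<Sum>k\<in>K. if k = a then bvec ks else 0)"
    by (intro sum.cong) (auto simp: ks slice_def tcons_right)
  then show "bvec ks = (\<Sum>k\<in>K. bvec k \<otimes> slice k (bvec ks))"
    using ks assms(2) by simp
qed (rule clinear_ident)

lemma xi_head_expand:
  assumes "x \<in> homog (Suc d)" "finite K" "\<And>ks. ks \<in> Poly_Mapping.keys x \<Longrightarrow> hd ks \<in> K"
  shows "xi_head x = (\<Sum>k\<in>K. slice k x)"
  by (subst slice_expand[OF assms])
    (simp_all add: clinear_simps[OF clinear_xi_head] xi_head_tcons xi_bvec)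

lemma xi_head_tpower: "x \<in> tpower W (Suc d) \<Longrightarrow> xi_head x = 0"
proof (rule clinear_eq_tpower[OF clinear_xi_head clinear_zero])
  fix vs :: "V list" assume "length vs = Suc d" "set vs \<subseteq> W"
  then show "xi_head (tensor vs) = 0" by (cases vs) (auto simp: xi_head_tcons W_def)
qed

lemma slice_tpower: "x \<in> tpower U (Suc d) \<Longrightarrow> slice k x \<in> tpower U d"
proof (rule clinear_tpower_le[OF clinear_slice subspace_tpower])
  fix vs :: "('a \<Rightarrow>\<^sub>0 complex) list" assume "length vs = Suc d" "set vs \<subseteq> U"
  then show "slice k (tensor vs) \<in> tpower U d"
    by (cases vs) (auto simp: slice_tcons intro!: cvec.subspace_scale subspace_tpower tensor_tpower)
qed

lemma keys_slice: "ks \<in> Poly_Mapping.keys (slice k x) \<Longrightarrow> k # ks \<in> Poly_Mapping.keys x"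
proof (rule ccontr)
  assume *: "ks \<in> Poly_Mapping.keys (slice k x)" "k # ks \<notin> Poly_Mapping.keys x"
  have "Poly_Mapping.lookup (slice k x) ks = 0"
    unfolding slice_def lin_ext_def lookup_sum
    using *(2) by (auto intro!: sum.neutral simp: lookup_bvec split: list.split)
  then show False using *(1) by (simp add: in_keys_iff)
qed

lemma slice_traceless:
  assumes "x \<in> traceless (Suc d)"
  shows "slice k x \<in> traceless d"
proof -
  have x: "x \<in> tpower W (Suc d)" and h: "x \<in> homog (Suc d)"
    using assms traceless_homog by (auto simp: traceless_def)
  have "contract i j (slice k x) = 0" if "i < j" "j < d" for i j
  proof -
    have "contract i j (slice k x) = slice k (contract (Suc i) (Suc j) x)"
    proof (rule clinear_eq_homog_tensor[of "\<lambda>x. contract i j (slice k x)"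
          "\<lambda>x. slice k (contract (Suc i) (Suc j) x)", OF _ _ h])
      fix ks :: "idx list" assume "length ks = Suc d"
      then obtain a as where ks: "ks = a # as" by (cases ks) auto
      have "bvec ks = bvec a \<otimes> bvec as" by (simp add: ks)
      then show "contract i j (slice k (bvec ks)) = slice k (contract (Suc i) (Suc j) (bvec ks))"
        by (simp only: slice_tcons contract_tcons_Suc clinear_simps[OF clinear_contract])
    qed (auto intro!: clinear_tensor_intros clinear_slice clinear_compose[OF clinear_slice])
    also have "\<dots> = 0" using assms that by (simp add: traceless_def clinear_simps[OF clinear_slice])
    finally show ?thesis .
  qed
  then show ?thesis using slice_tpower[OF x] by (auto simp: traceless_def)
qed

section \<open>Derivations\<close>

fun deriv_word :: "(('k \<Rightarrow>\<^sub>0 complex) \<Rightarrow> ('k \<Rightarrow>\<^sub>0 complex)) \<Rightarrow> 'k list \<Rightarrow> ('k list \<Rightarrow>\<^sub>0 complex)" where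
  "deriv_word X [] = 0"
| "deriv_word X (k # ks) = X (bvec k) \<otimes> bvec ks + bvec k \<otimes> deriv_word X ks"

definition derivation :: "(('k \<Rightarrow>\<^sub>0 complex) \<Rightarrow> ('k \<Rightarrow>\<^sub>0 complex)) \<Rightarrow> ('k list \<Rightarrow>\<^sub>0 complex) \<Rightarrow> ('k list \<Rightarrow>\<^sub>0 complex)"
  where "derivation X = lin_ext (deriv_word X)"

lemma clinear_derivation: "clinear (derivation X)"
  unfolding derivation_def by (rule clinear_lin_ext)

lemma derivation_bvec: "derivation X (bvec ks) = deriv_word X ks"
  by (simp add: derivation_def)

lemma derivation_Nil: "derivation X (bvec []) = 0"
  by (simp add: derivation_def)

lemma derivation_tcons:
  assumes "clinear X"
  shows "derivation X (v \<otimes> x) = X v \<otimes> x + v \<otimes> derivation X x"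
  by (rule bilinear_eq_basis[of "\<lambda>v x. derivation X (v \<otimes> x)" "\<lambda>v x. X v \<otimes> x + v \<otimes> derivation X x"])
    (auto intro!: clinear_plus clinear_tensor_intros clinear_compose[OF clinear_derivation]
      clinear_derivation assms simp: derivation_bvec)

text \<open>The coefficient of \<open>t ^ m\<close> in \<open>(1 + t X) \<otimes> \<dots> \<otimes> (1 + t X)\<close> applied to a word.\<close>

fun expand_word :: "(('k \<Rightarrow>\<^sub>0 complex) \<Rightarrow> ('k \<Rightarrow>\<^sub>0 complex)) \<Rightarrow> nat \<Rightarrow> 'k list \<Rightarrow> ('k list \<Rightarrow>\<^sub>0 complex)" where
  "expand_word X 0 ks = bvec ks"
| "expand_word X (Suc m) [] = 0"
| "expand_word X (Suc m) (k # ks) = bvec k \<otimes> expand_word X (Suc m) ks + X (bvec k) \<otimes> expand_word X m ks"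

lemma expand_word_1: "expand_word X (Suc 0) ks = deriv_word X ks"
  by (induction ks) (simp_all add: add.commute)

lemma tensor_expand_word:
  "length ks \<le> n \<Longrightarrow> tensor (map (\<lambda>k. bvec k + t *\<^sub>C X (bvec k)) ks) = (\<Sum>m\<le>n. t ^ m *\<^sub>C expand_word X m ks)"
proof (induction ks arbitrary: n)
  case Nil
  show ?case by (cases n) (simp_all add: sum.atMost_Suc_shift del: sum.atMost_Suc)
next
  case (Cons k ks)
  then obtain n' where n: "n = Suc n'" by (cases n) auto
  let ?t = "tensor (map (\<lambda>k. bvec k + t *\<^sub>C X (bvec k)) ks)"
  have "tensor (map (\<lambda>k. bvec k + t *\<^sub>C X (bvec k)) (k # ks)) = bvec k \<otimes> ?t + t *\<^sub>C (X (bvec k) \<otimes> ?t)"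
    by (simp add: tcons_left)
  also have "bvec k \<otimes> ?t = bvec (k # ks) + (\<Sum>m\<le>n'. t ^ Suc m *\<^sub>C (bvec k \<otimes> expand_word X (Suc m) ks))"
    using Cons.IH[of n] Cons.prems n
    by (simp add: sum.atMost_Suc_shift tcons_right del: sum.atMost_Suc)
  also have "X (bvec k) \<otimes> ?t = (\<Sum>m\<le>n'. t ^ m *\<^sub>C (X (bvec k) \<otimes> expand_word X m ks))"
    using Cons.IH[of n'] Cons.prems n by (simp add: tcons_right)
  finally show ?case
    unfolding n
    by (simp add: sum.atMost_Suc_shift cvec.scale_sum_right sum.distrib cvec.scale_right_distrib
      del: sum.atMost_Suc)
qed

lemma subspace_unscale: "cvec.subspace S \<Longrightarrow> c *\<^sub>C y \<in> S \<Longrightarrow> c \<noteq> 0 \<Longrightarrow> y \<in> S"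
  using cvec.subspace_scale[of S "c *\<^sub>C y" "inverse c"] by simp

text \<open>In place of a Vandermonde matrix, compare the values at t and 2t: subtracting 2 ^ (n +
  1) times the value at t from the value at 2t removes the top coefficient and multiplies each lower
  one by the nonzero number 2 ^ m - 2 ^ (n + 1).\<close>

lemma subspace_poly_coeffs:
  assumes S: "cvec.subspace S" and "\<And>t. (\<Sum>m\<le>n. t ^ m *\<^sub>C y m) \<in> S" "m \<le> n"
  shows "y m \<in> S"
  using assms(2,3)
proof (induction n arbitrary: y m)
  case 0
  then show ?case using "0.prems"(1)[of 1] by simp
next
  case (Suc n)
  have low: "y m \<in> S" if "m \<le> n" for m
  proof -
    have "(2 ^ m - 2 ^ Suc n) *\<^sub>C y m \<in> S"
    proof (rule Suc.IH[OF _ that])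
      fix t :: complex
      have "(\<Sum>m\<le>n. t ^ m *\<^sub>C (2 ^ m - 2 ^ Suc n) *\<^sub>C y m) =
          (\<Sum>m\<le>Suc n. (2 * t) ^ m *\<^sub>C y m) - 2 ^ Suc n *\<^sub>C (\<Sum>m\<le>Suc n. t ^ m *\<^sub>C y m)"
        by (simp add: cvec.scale_sum_right cvec.scale_right_distrib power_mult_distrib algebra_simps
            sum_subtractf cvec.scale_left_diff_distrib)
      also have "\<dots> \<in> S" by (intro cvec.subspace_diff[OF S] cvec.subspace_scale[OF S] Suc.prems)
      finally show "(\<Sum>m\<le>n. t ^ m *\<^sub>C (2 ^ m - 2 ^ Suc n) *\<^sub>C y m) \<in> S" .
    qed
    moreover have "(2::complex) ^ m - 2 ^ Suc n \<noteq> 0"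
    proof -
      have "(2::nat) ^ m \<noteq> 2 ^ Suc n" using that by (subst power_inject_exp) auto
      then have "of_nat (2 ^ m) \<noteq> (of_nat (2 ^ Suc n) :: complex)" by (subst of_nat_eq_iff)
      then show ?thesis by simp
    qed
    ultimately show ?thesis by (rule subspace_unscale[OF S])
  qed
  have "y (Suc n) = (\<Sum>m\<le>Suc n. 1 ^ m *\<^sub>C y m) - (\<Sum>m\<le>n. y m)" by simp
  also have "\<dots> \<in> S" by (intro cvec.subspace_diff[OF S] Suc.prems cvec.subspace_sum[OF S] low) auto
  finally show ?case using low Suc.prems(2) by (cases "m = Suc n") auto
qed

lemma derivation_in_subspace:
  assumes S: "cvec.subspace S" and x: "x \<in> homog d" and "x \<in> S"
    and "\<And>t. tmap (\<lambda>v. v + t *\<^sub>C X v) x \<in> S"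
  shows "derivation X x \<in> S"
proof -
  \<comment> \<open>The bound \<open>Suc d\<close> in place of \<open>d\<close> keeps the linear
    coefficient in range also in degree 0.\<close>
  have "(\<Sum>m\<le>Suc d. t ^ m *\<^sub>C lin_ext (expand_word X m) x) = tmap (\<lambda>v. v + t *\<^sub>C X v) x" for t
  proof (rule clinear_eq_homog_tensor[of "\<lambda>x. \<Sum>m\<le>Suc d. t ^ m *\<^sub>C lin_ext (expand_word X m) x", OF _ clinear_tmap x])
    show "clinear (\<lambda>x. \<Sum>m\<le>Suc d. t ^ m *\<^sub>C lin_ext (expand_word X m) x)"
      by (intro clinear_sums clinear_scaled clinear_lin_ext)
  next
    fix ks :: "'a list" assume "length ks = d"
    then show "(\<Sum>m\<le>Suc d. t ^ m *\<^sub>C lin_ext (expand_word X m) (bvec ks)) = tmap (\<lambda>v. v + t *\<^sub>C X v) (bvec ks)"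
      using tensor_expand_word[of ks "Suc d" t X] by (simp add: tmap_bvec)
  qed
  then have "lin_ext (expand_word X (Suc 0)) x \<in> S"
    using subspace_poly_coeffs[OF S, where n = "Suc d" and y = "\<lambda>m. lin_ext (expand_word X m) x" and m = 1]
      assms(4) by simp
  then show ?thesis by (simp add: derivation_def expand_word_1[abs_def])
qed

section \<open>Elements of \<open>H\<close>\<close>

text \<open>The action of \<open>l u \<in> Sym\<^sup>2 V\<close>, the Lie algebra of the symplectic group.\<close>

definition symop :: "V \<Rightarrow> V \<Rightarrow> V \<Rightarrow> V"
  where "symop l u v = omega v u *\<^sub>C l + omega v l *\<^sub>C u"

lemma clinear_symop: "clinear (symop l u)"
  unfolding symop_def by (intro clinear_plus clinear_omega_scale)

fun partner :: "idx \<Rightarrow> idx" where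
  "partner (E i) = F i" | "partner (F i) = E i"

lemma omega_basis_partner: "omega_basis k l \<noteq> 0 \<Longrightarrow> k = partner l"
  by (cases k; cases l) (auto split: if_splits)

lemma finite_omega_support: "finite {k. omega (bvec k) u \<noteq> 0}"
proof (rule finite_subset)
  show "{k. omega (bvec k) u \<noteq> 0} \<subseteq> partner ` Poly_Mapping.keys u"
  proof
    fix k assume "k \<in> {k. omega (bvec k) u \<noteq> 0}"
    then have "(\<Sum>l\<in>Poly_Mapping.keys u. Poly_Mapping.lookup u l * omega_basis k l) \<noteq> 0"
      by (simp add: omega_linfun linfun_bvec linfun_def)
    then obtain l where "l \<in> Poly_Mapping.keys u" "omega_basis k l \<noteq> 0"
      by (metis (no_types, lifting) mult_zero_right sum.neutral)
    then show "k \<in> partner ` Poly_Mapping.keys u" using omega_basis_partner by blast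
  qed
qed simp

lemma omega_self: "omega v v = 0"
  using omega_antisym[of v v] by simp

text \<open>The operator X is skew for the form, and its values lie in the isotropic span of
  \<open>l\<close> and \<open>u\<close>, so both the linear and the quadratic term in t of the
  transformed form vanish. The inverse is 1 - t X because X has square zero, and \<open>xi\<close>
  is preserved because X takes values in \<open>W\<close>.\<close>

lemma symop_in_H:
  assumes "l \<in> W" "u \<in> W" "omega l u = 0"
  shows "(\<lambda>v. v + t *\<^sub>C symop l u v) \<in> H"
proof -
  let ?g = "\<lambda>t v. v + t *\<^sub>C symop l u v"
  have ul: "omega u l = 0" using assms(3) omega_antisym[of u l] by simp
  have lin: "clinear (?g t)" for t by (intro clinear_plus clinear_scaled clinear_ident clinear_symop)
  have "symop l u (symop l u v) = 0" for v
    by (simp add: symop_def omega_add_left omega_scale_left assms ul omega_self)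
  then have inv: "?g (- t) (?g t v) = v" for t v
    by (simp add: clinear_simps[OF clinear_symop])
  have "bij (?g t)"
    by (rule bij_betw_byWitness[where f' = "?g (- t)"]) (use inv[where t = t] inv[where t = "- t"] in auto)
  moreover have "finite {k. ?g t (bvec k) \<noteq> bvec k}"
    by (rule finite_subset[of _ "{k. omega (bvec k) u \<noteq> 0} \<union> {k. omega (bvec k) l \<noteq> 0}"])
      (auto simp: symop_def finite_omega_support)
  moreover have "omega (?g t v) (?g t w) = omega v w" for v w
    using omega_antisym[of l w] omega_antisym[of u w]
    by (simp add: symop_def omega_add_left omega_add_right omega_scale_left omega_scale_right
      assms(3) ul omega_self algebra_simps)
  moreover have "xi (?g t v) = xi v" for v
    using assms(1,2) by (simp add: symop_def xi_add xi_scale W_def)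
  ultimately show ?thesis using lin by (simp add: H_def Sp_def GL_def)
qed

lemma H_D:
  assumes "g \<in> H"
  shows "clinear g" "omega (g v) (g w) = omega v w" "g ` W \<subseteq> W"
  using assms by (auto simp: H_def Sp_def GL_def W_def)

lemma derivation_submodule:
  assumes "submodule_under H tmap N" "x \<in> N" "x \<in> homog d" "l \<in> W" "u \<in> W" "omega l u = 0"
  shows "derivation (symop l u) x \<in> N"
  using assms symop_in_H
  by (intro derivation_in_subspace[where d = d]) (auto simp: submodule_under_def)

lemma tmap_traceless:
  assumes "g \<in> H" "x \<in> traceless d"
  shows "tmap g x \<in> traceless d"
  using assms(2) H_D[OF assms(1)] tmap_tpower[of g W x d]
    contract_tmap[of g _ _ d x] traceless_homog[OF assms(2)]
  by (auto simp: traceless_def clinear_simps[OF clinear_tmap])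

section \<open>Vectors in general position\<close>

fun idx_pos :: "idx \<Rightarrow> nat" where
  "idx_pos (E i) = i" | "idx_pos (F i) = i"

lemma finite_idx_pos: "finite {k. idx_pos k < n}"
proof (rule finite_subset)
  show "{k. idx_pos k < n} \<subseteq> E ` {..<n} \<union> F ` {..<n}"
  proof
    fix k assume "k \<in> {k. idx_pos k < n}"
    then show "k \<in> E ` {..<n} \<union> F ` {..<n}" by (cases k) auto
  qed
qed simp

definition small :: "nat \<Rightarrow> (idx list \<Rightarrow>\<^sub>0 complex) set"
  where "small n = {x. \<forall>ks\<in>Poly_Mapping.keys x. \<forall>k\<in>set ks. idx_pos k < n}"

lemma small_exists: obtains n where "x \<in> small n"
proof -
  let ?P = "\<Union>ks\<in>Poly_Mapping.keys x. idx_pos ` set ks"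
  have fin: "finite ?P" by auto
  have "x \<in> small (Suc (Max ?P))"
    unfolding small_def
  proof (safe)
    fix ks k assume "ks \<in> Poly_Mapping.keys x" "k \<in> set ks"
    then have "idx_pos k \<in> ?P" by blast
    then show "idx_pos k < Suc (Max ?P)" using Max_ge[OF fin] by (simp add: less_Suc_eq_le)
  qed
  then show ?thesis using that by blast
qed

lemma small_mono: "m \<le> n \<Longrightarrow> x \<in> small m \<Longrightarrow> x \<in> small n"
  unfolding small_def by (auto dest!: bspec)

lemma small_iff: "x \<in> small n \<longleftrightarrow> (\<forall>ks. (\<exists>k\<in>set ks. n \<le> idx_pos k) \<longrightarrow> Poly_Mapping.lookup x ks = 0)"
  unfolding small_def by (auto simp: in_keys_iff not_less[symmetric])

lemma subspace_small: "cvec.subspace (small n)"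
  by (auto simp: cvec.subspace_def small_iff lookup_add)

lemma bvec_small: "\<forall>k\<in>set ks. idx_pos k < n \<Longrightarrow> bvec ks \<in> small n"
  by (simp add: small_def)

lemma tperm_small:
  assumes "s permutes {..<d}" "x \<in> homog d" "x \<in> small n"
  shows "tperm s x \<in> small n"
  unfolding tperm_def lin_ext_def
  by (intro cvec.subspace_sum[OF subspace_small] cvec.subspace_scale[OF subspace_small] bvec_small)
    (use assms in \<open>auto simp: small_def homog_def\<close>)

lemma slice_small: "x \<in> small n \<Longrightarrow> slice k x \<in> small n"
  unfolding small_def by (auto dest!: keys_slice bspec)

text \<open>Each vector takes a block of two indices from \<open>n\<close> on: the difference puts
  it into \<open>W\<close>, and the use of letters \<open>E\<close> only makes the whole family
  isotropic.\<close>

definition lvec :: "nat \<Rightarrow> nat \<Rightarrow> V"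
  where "lvec n i = bvec (E (n + 2 * i)) - bvec (E (Suc (n + 2 * i)))"

text \<open>The dual partner of \<open>lvec n i\<close>; the second term corrects \<open>xi\<close>,
  and \<open>m\<close> is taken beyond the indices of all \<open>lvec\<close> in use.\<close>

definition mvec :: "nat \<Rightarrow> nat \<Rightarrow> nat \<Rightarrow> V"
  where "mvec n i m = bvec (F (n + 2 * i)) - bvec (F m)"

text \<open>Pairing with it reads off one coordinate of a vector supported below \<open>m\<close>.
  The opposite sign for \<open>F\<close> compensates the antisymmetry of the form, and the term at
  \<open>m\<close> brings the vector into \<open>W\<close>.\<close>

fun dual_vec :: "nat \<Rightarrow> idx \<Rightarrow> V" where
  "dual_vec m (E j) = bvec (F j) - bvec (F m)"
| "dual_vec m (F j) = bvec (E m) - bvec (E j)"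

lemma lvec_W: "lvec n i \<in> W" and mvec_W: "mvec n i m \<in> W"
  by (auto simp: W_def lvec_def mvec_def xi_diff xi_bvec)

lemma dual_vec_W: "dual_vec m k \<in> W"
  by (cases k) (auto simp: W_def xi_diff xi_bvec)

lemmas omega_simps = omega_diff_left omega_diff_right omega_bvec

lemma omega_lvec_lvec: "omega (lvec n i) (lvec n j) = 0"
  by (simp add: lvec_def omega_simps)

lemma omega_lvec_mvec: "n + 2 * i + 1 < m \<Longrightarrow> omega (lvec n i) (mvec n j m) = (if i = j then 1 else 0)"
proof -
  have "Suc (n + 2 * i) \<noteq> n + 2 * j" by presburger
  then show "n + 2 * i + 1 < m \<Longrightarrow> ?thesis" by (simp add: lvec_def mvec_def omega_simps)
qed

lemma omega_bvec_lvec: "idx_pos k < n \<Longrightarrow> omega (bvec k) (lvec n i) = 0"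
  by (cases k) (simp_all add: lvec_def omega_simps)

lemma omega_bvec_mvec: "idx_pos k < n \<Longrightarrow> n \<le> m \<Longrightarrow> omega (bvec k) (mvec n i m) = 0"
  by (cases k) (simp_all add: mvec_def omega_simps)

lemma omega_lvec_bvec: "idx_pos k < n \<or> n + 2 * i + 1 < idx_pos k \<Longrightarrow> omega (lvec n i) (bvec k) = 0"
  by (cases k) (auto simp: lvec_def omega_simps)

lemma omega_bvec_dual_vec:
  "idx_pos k < n \<Longrightarrow> n \<le> m \<Longrightarrow> omega (bvec k) (dual_vec m l) = (if k = l then 1 else 0)"
  by (cases k; cases l) (auto simp: omega_simps)

lemma omega_lvec_dual_vec:
  "idx_pos k < n \<Longrightarrow> n + 2 * i + 1 < m \<Longrightarrow> omega (lvec n i) (dual_vec m k) = 0"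
  by (cases k) (auto simp: lvec_def omega_simps)

definition ltensor :: "nat \<Rightarrow> nat \<Rightarrow> (idx list \<Rightarrow>\<^sub>0 complex)"
  where "ltensor n d = tensor (map (lvec n) [0..<d])"

lemma ltensor_homog: "ltensor n d \<in> homog d"
  unfolding ltensor_def by (rule tensor_homog) simp

lemma ltensor_traceless: "ltensor n d \<in> traceless d"
proof -
  have "ltensor n d \<in> tpower W d"
    unfolding ltensor_def by (rule tensor_tpower) (auto simp: lvec_W)
  moreover have "contract i j (ltensor n d) = 0" if "i < j" "j < d" for i j
    using that contract_tensor[of i j "map (lvec n) [0..<d]"] by (simp add: ltensor_def omega_lvec_lvec)
  ultimately show ?thesis by (simp add: traceless_def)
qed

lemma lookup_lvec: "Poly_Mapping.lookup (lvec n i) (E (n + 2 * j)) = (if i = j then 1 else 0)"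
proof -
  have "Suc (n + 2 * i) \<noteq> n + 2 * j" by presburger
  then show ?thesis by (simp add: lvec_def lookup_minus lookup_bvec)
qed

text \<open>The letter \<open>E (n + 2 * j)\<close> occurs in \<open>lvec n i\<close> only for i =
  j, so among the rearrangements of this word only the word itself has a nonzero
  coefficient.\<close>

lemma generic_ltensor: "generic (ltensor n d) (map (\<lambda>i. E (n + 2 * i)) [0..<d])"
  unfolding generic_def
proof (intro conjI allI impI)
  let ?w = "map (\<lambda>i. E (n + 2 * i)) [0..<d]"
  show "ltensor n d \<in> homog (length ?w)" by (simp add: ltensor_homog)
  fix s assume s: "s permutes {..<length ?w}"
  then have s': "s permutes {..<d}" by simp
  have "Poly_Mapping.lookup (ltensor n d) (permute_list s ?w) =
      (\<Prod>i<d. if i = s i then 1 else 0)"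
    using permutes_in_image[OF s']
    by (auto simp: ltensor_def lookup_tensor permute_list_nth[OF s] lookup_lvec intro!: prod.cong)
  also have "\<dots> = (if s = id then 1 else 0)"
  proof (cases "s = id")
    case False
    then obtain i where "s i \<noteq> i" by (auto simp: fun_eq_iff)
    moreover from this have "i < d" using s' by (auto simp: permutes_def)
    ultimately have "(\<Prod>i<d. if i = s i then 1 else 0::complex) = 0"
      by (intro prod_zero bexI[of _ i]) auto
    then show ?thesis using False by simp
  qed simp
  finally show "Poly_Mapping.lookup (ltensor n d) (permute_list s ?w) = (if s = id then 1 else 0)" .
qed

section \<open>Generating traceless tensors\<close>

fun insert_word :: "('k \<Rightarrow>\<^sub>0 complex) \<Rightarrow> nat \<Rightarrow> 'k list \<Rightarrow> ('k list \<Rightarrow>\<^sub>0 complex)" where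
  "insert_word m 0 ks = m \<otimes> bvec ks"
| "insert_word m (Suc i) [] = 0"
| "insert_word m (Suc i) (k # ks) = bvec k \<otimes> insert_word m i ks"

definition insert_vec :: "('k \<Rightarrow>\<^sub>0 complex) \<Rightarrow> nat \<Rightarrow> ('k list \<Rightarrow>\<^sub>0 complex) \<Rightarrow> ('k list \<Rightarrow>\<^sub>0 complex)"
  where "insert_vec m i = lin_ext (insert_word m i)"

lemma clinear_insert_vec: "clinear (insert_vec m i)"
  unfolding insert_vec_def by (rule clinear_lin_ext)

lemma insert_vec_bvec: "insert_vec m i (bvec ks) = insert_word m i ks"
  by (simp add: insert_vec_def)

text \<open>As \<open>m\<close> is orthogonal to all letters, only the part of
  \<open>symop b m\<close> with value in the line of \<open>m\<close> survives. Replacing a letter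
  by \<open>m\<close> with the coefficient of its pairing with \<open>b\<close> is contracting it
  with \<open>b\<close> and inserting \<open>m\<close> in its place; the sign is that of exchanging
  the arguments of the form. This exhibits the unwanted terms as images of contractions.\<close>

lemma deriv_word_symop:
  "\<forall>k\<in>set ks. omega (bvec k) m = 0 \<Longrightarrow>
    deriv_word (symop b m) ks = - (\<Sum>i<length ks. insert_vec m i (vcontract b i (bvec ks)))"
proof (induction ks)
  case (Cons k ks)
  have ins: "insert_vec m (Suc i) (vcontract b (Suc i) (bvec (k # ks))) =
      bvec k \<otimes> insert_vec m i (vcontract b i (bvec ks))" for i
    by (simp add: vcontract_bvec nths_Cons_compl clinear_simps[OF clinear_insert_vec] insert_vec_bvec tcons_right)
  have "insert_vec m 0 (vcontract b 0 (bvec (k # ks))) = omega b (bvec k) *\<^sub>C (m \<otimes> bvec ks)"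
    by (simp add: vcontract_bvec nths_Cons_compl clinear_simps[OF clinear_insert_vec] insert_vec_bvec)
  then show ?case
    using Cons omega_antisym[of "bvec k" b]
    by (simp add: sum.lessThan_Suc_shift ins symop_def tcons_left tcons_right del: sum.lessThan_Suc)
qed simp

lemma derivation_symop:
  assumes "y \<in> homog d" "y \<in> small n" "\<And>k. idx_pos k < n \<Longrightarrow> omega (bvec k) m = 0"
  shows "derivation (symop b m) y = - (\<Sum>i<d. insert_vec m i (vcontract b i y))"
proof -
  have "derivation (symop b m) y = (-1) *\<^sub>C (\<Sum>i<d. insert_vec m i (vcontract b i y))"
  proof (rule clinear_eq_keys[of "derivation (symop b m)" "\<lambda>y. (-1) *\<^sub>C (\<Sum>i<d. insert_vec m i (vcontract b i y))"])
    show "clinear (\<lambda>y. (-1) *\<^sub>C (\<Sum>i<d. insert_vec m i (vcontract b i y)))"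
      by (intro clinear_scaled clinear_sums clinear_compose[OF clinear_insert_vec] clinear_vcontract)
  next
    fix ks assume "ks \<in> Poly_Mapping.keys y"
    then show "derivation (symop b m) (bvec ks) = (-1) *\<^sub>C (\<Sum>i<d. insert_vec m i (vcontract b i (bvec ks)))"
      using assms deriv_word_symop[of ks m b] by (auto simp: derivation_bvec homog_def small_def)
  qed (rule clinear_derivation)
  then show ?thesis by simp
qed

lemma clinear_foldr_tcons: "clinear (foldr (\<otimes>) vs)"
proof (induction vs)
  case Nil
  then show ?case by (simp add: clinear_ident id_def)
next
  case (Cons v vs)
  then show ?case using clinear_compose[OF clinear_tcons_right Cons] by (simp add: o_def)
qed

lemma derivation_foldr_tcons:
  "clinear X \<Longrightarrow> \<forall>v\<in>set vs. X v = 0 \<Longrightarrow>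
    derivation X (foldr (\<otimes>) vs x) = foldr (\<otimes>) vs (derivation X x)"
  by (induction vs) (simp_all add: derivation_tcons tcons_left)

lemma foldr_tcons_homog: "x \<in> homog d \<Longrightarrow> foldr (\<otimes>) vs x \<in> homog (length vs + d)"
proof (induction vs)
  case (Cons v vs)
  have "Poly_Mapping.lookup (v \<otimes> foldr (\<otimes>) vs x) ks = 0" if "length ks \<noteq> Suc (length vs + d)" for ks
    using that Cons by (cases ks) (auto simp: lookup_tcons_Nil lookup_tcons_Cons homog_iff)
  then show ?case by (simp add: homog_iff)
qed simp

lemma foldr_tcons_tensor: "foldr (\<otimes>) vs (tensor ws) = tensor (vs @ ws)"
  by (induction vs) simp_all

lemma traceless_generated:
  assumes N: "submodule_under H tmap N" and L: "ltensor n d \<in> N"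
  shows "j \<le> d \<Longrightarrow> x \<in> traceless j \<Longrightarrow> x \<in> small n \<Longrightarrow>
    foldr (\<otimes>) (map (lvec n) [0..<d - j]) x \<in> N"
proof (induction j arbitrary: x)
  case 0
  have "x = Poly_Mapping.lookup x [] *\<^sub>C bvec []"
    using traceless_homog[OF 0(2)]
    by (intro poly_mapping_eqI) (auto simp: homog_iff lookup_bvec)
  then have "foldr (\<otimes>) (map (lvec n) [0..<d]) x = Poly_Mapping.lookup x [] *\<^sub>C ltensor n d"
    using clinear_scale[OF clinear_foldr_tcons, of "map (lvec n) [0..<d]" "Poly_Mapping.lookup x []" "bvec []"]
      foldr_tcons_tensor[of "map (lvec n) [0..<d]" "[]"]
    by (simp add: ltensor_def)
  then show ?case using L N by (simp add: submodule_under_def cvec.subspace_scale)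
next
  case (Suc j)
  \<comment> \<open>Write \<open>x\<close> as the sum of \<open>b k \<otimes> y k\<close> with \<open>b k \<in> W\<close>. The derivation \<open>X k\<close> turns the last factor
    \<open>lvec n e\<close> of the prefix into \<open>b k\<close>; its other terms add up to contractions of \<open>x\<close>.\<close>
  let ?K = "{k. idx_pos k < n}"
  define e where "e = d - Suc j"
  define m where "m = n + 2 * d"
  define b where "b k = bvec k - bvec (F m)" for k
  define y where "y k = slice k x" for k
  define X where "X k = symop (b k) (mvec n e m)" for k
  define vs where "vs = map (lvec n) [0..<e]"
  have e: "d - j = Suc e" "e < d" "length vs = e" using Suc.prems by (auto simp: e_def vs_def)
  have x: "x \<in> homog (Suc j)" "x \<in> tpower W (Suc j)"
    using Suc.prems traceless_homog by (auto simp: traceless_def)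
  have heads: "hd ks \<in> ?K" if "ks \<in> Poly_Mapping.keys x" for ks
    using that x(1) Suc.prems(3) by (cases ks) (force simp: homog_def small_def)+
  have sum_y: "(\<Sum>k\<in>?K. y k) = 0"
    using xi_head_expand[OF x(1) finite_idx_pos heads] xi_head_tpower[OF x(2)] by (simp add: y_def)
  \<comment> \<open>The slices sum to 0 because \<open>xi\<close> kills the first factor of
    \<open>x\<close>. Subtracting the same vector from every \<open>bvec k\<close> therefore changes
    nothing and moves all first factors into \<open>W\<close>.\<close>
  have xb: "x = (\<Sum>k\<in>?K. b k \<otimes> y k)"
  proof -
    have "(\<Sum>k\<in>?K. b k \<otimes> y k) = (\<Sum>k\<in>?K. bvec k \<otimes> y k) - bvec (F m) \<otimes> (\<Sum>k\<in>?K. y k)"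
      by (simp add: b_def tcons_left tcons_right sum_subtractf)
    also have "bvec (F m) \<otimes> (\<Sum>k\<in>?K. y k) = 0" unfolding sum_y by (simp add: tcons_right)
    finally show ?thesis
      using slice_expand[OF x(1) finite_idx_pos heads] by (simp add: y_def)
  qed
  have y: "y k \<in> traceless j" "y k \<in> homog j" "y k \<in> small n" for k
    using slice_traceless[OF Suc.prems(2)] slice_small[OF Suc.prems(3)] traceless_homog
    by (auto simp: y_def)
  have "derivation (X k) (foldr (\<otimes>) (map (lvec n) [0..<d - j]) (y k)) =
      foldr (\<otimes>) vs (b k \<otimes> y k) + foldr (\<otimes>) vs (lvec n e \<otimes> derivation (X k) (y k))"
    if "k \<in> ?K" for k
  proof -
    have k: "omega (lvec n i) (b k) = 0" if "i < d" for i
      using that \<open>k \<in> ?K\<close> by (simp add: b_def omega_diff_right omega_lvec_bvec m_def)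
    have "\<forall>v\<in>set vs. X k v = 0"
      using k e by (auto simp: vs_def X_def symop_def omega_lvec_mvec m_def)
    moreover have "X k (lvec n e) = b k"
      using k e by (simp add: X_def symop_def omega_lvec_mvec m_def)
    moreover have "clinear (X k)" unfolding X_def by (rule clinear_symop)
    ultimately show ?thesis
      by (simp add: e vs_def[symmetric] derivation_foldr_tcons derivation_tcons clinear_add[OF clinear_foldr_tcons])
  qed
  then have "(\<Sum>k\<in>?K. derivation (X k) (foldr (\<otimes>) (map (lvec n) [0..<d - j]) (y k))) =
      foldr (\<otimes>) vs x + foldr (\<otimes>) vs (lvec n e \<otimes> (\<Sum>k\<in>?K. derivation (X k) (y k)))"
    unfolding xb by (simp add: sum.distrib clinear_sum[OF clinear_foldr_tcons] tcons_right)
  \<comment> \<open>The inserted vector \<open>mvec n e m\<close> does not depend on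
    \<open>k\<close>, so the sum over \<open>k\<close> passes inside the insertion; there the
    contractions of \<open>y k\<close> with \<open>b k\<close> assemble to a contraction of
    \<open>x\<close> with its first position.\<close>
  also have "(\<Sum>k\<in>?K. derivation (X k) (y k)) = 0"
  proof -
    have "(\<Sum>k\<in>?K. derivation (X k) (y k)) = - (\<Sum>k\<in>?K. \<Sum>i<j. insert_vec (mvec n e m) i (vcontract (b k) i (y k)))"
      using derivation_symop[OF y(2,3), of "mvec n e m"] by (simp add: X_def omega_bvec_mvec m_def sum_negf)
    also have "\<dots> = - (\<Sum>i<j. insert_vec (mvec n e m) i (\<Sum>k\<in>?K. vcontract (b k) i (y k)))"
      by (subst sum.swap) (simp add: clinear_sum[OF clinear_insert_vec])
    also have "\<dots> = - (\<Sum>i<j. insert_vec (mvec n e m) i (contract 0 (Suc i) x))"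
      unfolding xb by (simp add: clinear_sum[OF clinear_contract] contract_tcons_0)
    also have "\<dots> = 0"
      using Suc.prems(2) by (simp add: traceless_def clinear_0[OF clinear_insert_vec])
    finally show ?thesis .
  qed
  finally have "foldr (\<otimes>) vs x = (\<Sum>k\<in>?K. derivation (X k) (foldr (\<otimes>) (map (lvec n) [0..<d - j]) (y k)))"
    by (simp add: tcons_right clinear_0[OF clinear_foldr_tcons])
  also have "\<dots> \<in> N"
  proof (rule cvec.subspace_sum)
    fix k assume "k \<in> ?K"
    moreover have "omega (bvec (F m)) (mvec n e m) = 0" by (simp add: mvec_def omega_simps)
    ultimately have k: "omega (b k) (mvec n e m) = 0"
      by (simp add: b_def omega_diff_left omega_bvec_mvec m_def)
    show "derivation (X k) (foldr (\<otimes>) (map (lvec n) [0..<d - j]) (y k)) \<in> N"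
      unfolding X_def
    proof (rule derivation_submodule[OF N _ _ _ mvec_W k])
      show "foldr (\<otimes>) (map (lvec n) [0..<d - j]) (y k) \<in> N"
        using Suc.prems by (intro Suc.IH y) simp
      show "foldr (\<otimes>) (map (lvec n) [0..<d - j]) (y k) \<in> homog (d - j + j)"
        using foldr_tcons_homog[OF y(2), of "map (lvec n) [0..<d - j]" k] by simp
      show "b k \<in> W" by (simp add: b_def W_def xi_diff xi_bvec)
    qed
  qed (use N in \<open>simp add: submodule_under_def\<close>)
  finally show ?case by (simp add: vs_def e_def)
qed

section \<open>Multilinear elements of a submodule\<close>

definition derivs :: "(nat \<Rightarrow> V) \<Rightarrow> (nat \<Rightarrow> V) \<Rightarrow> nat list \<Rightarrow> (idx list \<Rightarrow>\<^sub>0 complex) \<Rightarrow> (idx list \<Rightarrow>\<^sub>0 complex)"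
  where "derivs l u J = foldr (\<lambda>j. derivation (symop (l j) (u j))) J"

lemma clinear_derivs: "clinear (derivs l u J)"
proof (induction J)
  case Nil
  then show ?case by (simp add: derivs_def clinear_ident id_def)
next
  case (Cons j J)
  then show ?case using clinear_compose[OF clinear_derivation Cons] by (simp add: derivs_def o_def)
qed

lemma derivs_Cons: "derivs l u (j # J) x = derivation (symop (l j) (u j)) (derivs l u J x)"
  by (simp add: derivs_def)

context
  fixes l u :: "nat \<Rightarrow> V" and n d :: nat
  assumes ll: "\<And>i j. i < d \<Longrightarrow> j < d \<Longrightarrow> omega (l i) (l j) = 0"
    and lu: "\<And>i j. i < d \<Longrightarrow> j < d \<Longrightarrow> omega (l i) (u j) = 0"
    and kl: "\<And>k i. idx_pos k < n \<Longrightarrow> i < d \<Longrightarrow> omega (bvec k) (l i) = 0"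
begin

text \<open>The derivation number j sends the letter \<open>k\<close> to a multiple of
  \<open>l j\<close>, and every later one kills that factor. Hence at most one derivation acts on
  the head, and the sum runs over which one it is.\<close>

lemma derivs_tcons:
  assumes "distinct J" "set J \<subseteq> {..<d}" "idx_pos k < n"
  shows "derivs l u J (bvec k \<otimes> y) =
    bvec k \<otimes> derivs l u J y + (\<Sum>j\<in>set J. omega (bvec k) (u j) *\<^sub>C (l j \<otimes> derivs l u (remove1 j J) y))"
  using assms(1,2)
proof (induction J)
  case Nil
  then show ?case by (simp add: derivs_def)
next
  case (Cons j J)
  let ?X = "symop (l j) (u j)"
  have X: "?X (l i) = 0" if "i \<in> set J" for i
    using that Cons.prems ll lu by (auto simp: symop_def)
  have Xk: "?X (bvec k) = omega (bvec k) (u j) *\<^sub>C l j"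
    using Cons.prems kl[OF assms(3)] by (simp add: symop_def)
  have rem: "remove1 i (j # J) = j # remove1 i J" if "i \<in> set J" for i
    using that Cons.prems by auto
  have "derivs l u (j # J) (bvec k \<otimes> y) = derivation ?X (bvec k \<otimes> derivs l u J y) +
      (\<Sum>i\<in>set J. omega (bvec k) (u i) *\<^sub>C derivation ?X (l i \<otimes> derivs l u (remove1 i J) y))"
    using Cons by (simp add: derivs_Cons clinear_simps[OF clinear_derivation])
  also have "\<dots> = bvec k \<otimes> derivs l u (j # J) y + omega (bvec k) (u j) *\<^sub>C (l j \<otimes> derivs l u J y) +
      (\<Sum>i\<in>set J. omega (bvec k) (u i) *\<^sub>C (l i \<otimes> derivs l u (remove1 i (j # J)) y))"
    by (simp add: derivation_tcons[OF clinear_symop] X Xk rem derivs_Cons tcons_left add.commute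
      del: remove1.simps)
  finally show ?case using Cons.prems by (simp add: add.assoc del: remove1.simps(2)) simp
qed

lemma derivs_Nil: "J \<noteq> [] \<Longrightarrow> derivs l u J (bvec []) = 0"
proof (induction J)
  case (Cons j J)
  then show ?case
    by (cases "J = []")
      (simp_all add: derivs_Cons derivation_Nil clinear_0[OF clinear_derivation], simp add: derivs_def derivation_Nil)
qed simp

text \<open>Each letter can absorb at most one derivation. With more derivations than letters
  nothing remains; with equally many, each letter absorbs exactly one, and the list \<open>w\<close>
  records which. The vanishing statement removes the term of the recursion in which the head is left
  alone.\<close>

lemma derivs_bvec:
  assumes "distinct J" "set J \<subseteq> {..<d}" "\<forall>k\<in>set ks. idx_pos k < n"
  shows "length ks < length J \<Longrightarrow> derivs l u J (bvec ks) = 0"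
    "length J = length ks \<Longrightarrow> derivs l u J (bvec ks) =
      (\<Sum>w\<in>permutations_of_set (set J). (\<Prod>q<length ks. omega (bvec (ks ! q)) (u (w ! q))) *\<^sub>C tensor (map l w))"
  using assms
proof (induction ks arbitrary: J)
  case Nil
  {
    case 1
    then show ?case by (intro derivs_Nil) auto
  next
    case 2
    then show ?case by (simp add: derivs_def)
  }
next
  case (Cons k ks)
  have tc: "derivs l u J (bvec (k # ks)) = bvec k \<otimes> derivs l u J (bvec ks) +
      (\<Sum>j\<in>set J. omega (bvec k) (u j) *\<^sub>C (l j \<otimes> derivs l u (remove1 j J) (bvec ks)))"
    if "distinct J" "set J \<subseteq> {..<d}" "\<forall>k\<in>set (k # ks). idx_pos k < n" for J
    using derivs_tcons[of J k "bvec ks"] that by simp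
  {
    case 1
    have "derivs l u (remove1 j J) (bvec ks) = 0" if "j \<in> set J" for j
      using that 1 set_remove1_subset[of j J] by (intro Cons.IH(1)) (auto simp: length_remove1)
    moreover have "derivs l u J (bvec ks) = 0" using 1 by (intro Cons.IH(1)) auto
    ultimately show ?case unfolding tc[OF 1(2-4)] by (simp add: tcons_right)
  next
    case 2
    let ?c = "\<lambda>ks w. \<Prod>q<length ks. omega (bvec (ks ! q)) (u (w ! q))"
    have "derivs l u J (bvec ks) = 0" using 2 by (intro Cons.IH(1)) auto
    then have "derivs l u J (bvec (k # ks)) =
        (\<Sum>j\<in>set J. omega (bvec k) (u j) *\<^sub>C (l j \<otimes> derivs l u (remove1 j J) (bvec ks)))"
      unfolding tc[OF 2(2-4)] by (simp add: tcons_right)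
    also have "\<dots> = (\<Sum>j\<in>set J. \<Sum>w\<in>permutations_of_set (set J - {j}).
        ?c (k # ks) (j # w) *\<^sub>C tensor (map l (j # w)))"
    proof (rule sum.cong[OF refl])
      fix j assume j: "j \<in> set J"
      have "derivs l u (remove1 j J) (bvec ks) =
          (\<Sum>w\<in>permutations_of_set (set (remove1 j J)). ?c ks w *\<^sub>C tensor (map l w))"
        using j 2 set_remove1_subset[of j J] by (intro Cons.IH(2)) (auto simp: length_remove1)
      then show "omega (bvec k) (u j) *\<^sub>C (l j \<otimes> derivs l u (remove1 j J) (bvec ks)) =
          (\<Sum>w\<in>permutations_of_set (set J - {j}). ?c (k # ks) (j # w) *\<^sub>C tensor (map l (j # w)))"
        using 2 by (simp add: tcons_right cvec.scale_sum_right set_remove1_eq prod.lessThan_Suc_shift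
          del: prod.lessThan_Suc)
    qed
    also have "\<dots> = (\<Sum>w\<in>permutations_of_set (set J). ?c (k # ks) w *\<^sub>C tensor (map l w))"
    proof -
      have "permutations_of_set (set J) = (\<Union>j\<in>set J. (#) j ` permutations_of_set (set J - {j}))"
        using 2 by (intro permutations_of_set_nonempty) auto
      moreover have "(\<Sum>w\<in>(\<Union>j\<in>set J. (#) j ` permutations_of_set (set J - {j})).
          ?c (k # ks) w *\<^sub>C tensor (map l w)) =
        (\<Sum>j\<in>set J. \<Sum>w\<in>(#) j ` permutations_of_set (set J - {j}). ?c (k # ks) w *\<^sub>C tensor (map l w))"
        by (rule sum.UNION_disjoint) auto
      ultimately show ?thesis by (simp add: sum.reindex inj_on_def del: tensor_Cons)
    qed
    finally show ?case .
  }
qed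

end

lemma bij_betw_permutations_of_set:
  "bij_betw (\<lambda>s. map s [0..<d]) {s. s permutes {..<d}} (permutations_of_set {..<d})"
  unfolding bij_betw_def
proof
  show "inj_on (\<lambda>s. map s [0..<d]) {s. s permutes {..<d}}"
  proof (intro inj_onI ext)
    fix s s' i
    assume *: "s \<in> {s. s permutes {..<d}}" "s' \<in> {s. s permutes {..<d}}" "map s [0..<d] = map s' [0..<d]"
    show "s i = s' i"
    proof (cases "i < d")
      case True
      then show ?thesis using *(3) by (simp add: map_eq_conv)
    next
      case False
      then show ?thesis using *(1,2) by (simp add: permutes_def)
    qed
  qed
  have "map s [0..<d] \<in> permutations_of_set {..<d}" if "s permutes {..<d}" for s
    using permutes_inj_on[OF that] permutes_image[OF that]
    by (simp add: permutations_of_set_def distinct_map lessThan_atLeast0)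
  moreover have "w \<in> (\<lambda>s. map s [0..<d]) ` {s. s permutes {..<d}}"
    if w: "w \<in> permutations_of_set {..<d}" for w
  proof -
    have "mset w = mset [0..<d]"
      using w set_eq_iff_mset_eq_distinct[of w "[0..<d]"]
      by (simp add: permutations_of_set_def atLeast0LessThan)
    then obtain s where "s permutes {..<length [0..<d]}" "permute_list s [0..<d] = w"
      by (rule mset_eq_permutation)
    then have s: "s permutes {..<d}" "permute_list s [0..<d] = w" by auto
    have "permute_list s [0..<d] = map s [0..<d]"
      using permutes_in_image[OF s(1)] by (auto simp: permute_list_def)
    then show ?thesis using s by (intro image_eqI[of _ _ s]) auto
  qed
  ultimately show "(\<lambda>s. map s [0..<d]) ` {s. s permutes {..<d}} = permutations_of_set {..<d}"
    by blast
qed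

lemma derivation_homog:
  assumes "clinear X" "x \<in> homog d"
  shows "derivation X x \<in> homog d"
proof -
  have "deriv_word X ks \<in> homog (length ks)" for ks
  proof (induction ks)
    case (Cons k ks)
    then show ?case
      using foldr_tcons_homog[of "deriv_word X ks" "length ks" "[bvec k]"]
        foldr_tcons_homog[of "bvec ks" "length ks" "[X (bvec k)]"]
      by (simp add: homog_add bvec_homog)
  qed (simp add: homog_0)
  then show ?thesis
    unfolding derivation_def lin_ext_def using assms(2)
    by (intro homog_sum homog_scale) (auto simp: homog_def)
qed

text \<open>A polarization: with \<open>u j\<close> dual to the letter \<open>kk ! j\<close>,
  applying all derivations extracts the coefficients of \<open>x\<close> at the rearrangements of
  \<open>kk\<close> and places the isotropic vectors accordingly. Taking the isotropic vectors in
  the order given by \<open>t\<close> yields the same operator applied to a reordered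
  \<open>ltensor n d\<close>, and so eventually to any group algebra multiple of it.\<close>

lemma multilinear_in_submodule:
  assumes N: "submodule_under H tmap N" and x: "x \<in> N" "x \<in> homog d" "x \<in> small n"
    and kk: "length kk = d" "\<forall>k\<in>set kk. idx_pos k < n" and t: "t permutes {..<d}"
  shows "(\<Sum>s | s permutes {..<d}. Poly_Mapping.lookup x (permute_list s kk) *\<^sub>C
    tperm s (tperm t (ltensor n d))) \<in> N"
proof -
  define m where "m = n + 2 * d"
  define l where "l i = lvec n (t i)" for i
  define u where "u j = dual_vec m (kk ! j)" for j
  have ti: "t i < d" if "i < d" for i using permutes_in_image[OF t] that by simp
  have kj: "idx_pos (kk ! j) < n" if "j < d" for j using kk that by auto
  have lu: "omega (l i) (u j) = 0" if "i < d" "j < d" for i j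
    using ti[OF that(1)] kj[OF that(2)] unfolding l_def u_def m_def by (intro omega_lvec_dual_vec) auto
  have ll: "omega (l i) (l j) = 0" for i j by (simp add: l_def omega_lvec_lvec)
  have kl: "omega (bvec k) (l i) = 0" if "idx_pos k < n" for k i
    using that by (simp add: l_def omega_bvec_lvec)
  note D = derivs_bvec[of d l u n, OF ll lu kl]
  let ?D = "derivs l u [0..<d]"
  have "?D x = (\<Sum>w\<in>permutations_of_set {..<d}. Poly_Mapping.lookup x (map ((!) kk) w) *\<^sub>C tensor (map l w))"
  proof -
    have *: "?D (bvec ks) = (\<Sum>w\<in>permutations_of_set {..<d}. (if ks = map ((!) kk) w then 1 else 0) *\<^sub>C tensor (map l w))"
      if ks: "ks \<in> Poly_Mapping.keys x" for ks
    proof -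
      have ks': "length ks = d" "\<forall>k\<in>set ks. idx_pos k < n" using ks x by (auto simp: homog_def small_def)
      have "(\<Prod>q<length ks. omega (bvec (ks ! q)) (u (w ! q))) = (if ks = map ((!) kk) w then 1 else 0)"
        if w: "w \<in> permutations_of_set {..<d}" for w
      proof -
        have lw: "length w = d" using w length_finite_permutations_of_set[of w "{..<d}"] by simp
        have "(\<Prod>q<length ks. omega (bvec (ks ! q)) (u (w ! q))) = (\<Prod>q<d. if ks ! q = kk ! (w ! q) then 1 else 0)"
        proof (rule prod.cong)
          fix q assume "q \<in> {..<d}"
          then have "idx_pos (ks ! q) < n" using ks' by auto
          then show "omega (bvec (ks ! q)) (u (w ! q)) = (if ks ! q = kk ! (w ! q) then 1 else 0)"
            unfolding u_def m_def by (rule omega_bvec_dual_vec) simp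
        qed (simp add: ks')
        also have "\<dots> = (if \<forall>q<d. ks ! q = kk ! (w ! q) then 1 else 0)"
          by (auto intro!: prod.neutral prod_zero)
        also have "(\<forall>q<d. ks ! q = kk ! (w ! q)) \<longleftrightarrow> ks = map ((!) kk) w"
          using ks' lw by (auto simp: list_eq_iff_nth_eq)
        finally show ?thesis .
      qed
      then show ?thesis
        using D(2)[of "[0..<d]" ks] ks' by (simp add: atLeast0LessThan cong: sum.cong)
    qed
    have "?D x = (\<Sum>ks\<in>Poly_Mapping.keys x. Poly_Mapping.lookup x ks *\<^sub>C ?D (bvec ks))"
      by (subst clinear_conv_lin_ext[OF clinear_derivs]) (simp add: lin_ext_def)
    also have "\<dots> = (\<Sum>w\<in>permutations_of_set {..<d}. \<Sum>ks\<in>Poly_Mapping.keys x.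
        Poly_Mapping.lookup x ks *\<^sub>C (if ks = map ((!) kk) w then 1 else 0) *\<^sub>C tensor (map l w))"
      by (subst sum.swap) (simp add: * cvec.scale_sum_right)
    also have "\<dots> = (\<Sum>w\<in>permutations_of_set {..<d}. (\<Sum>ks\<in>Poly_Mapping.keys x.
        if ks = map ((!) kk) w then Poly_Mapping.lookup x ks else 0) *\<^sub>C tensor (map l w))"
      unfolding cvec.scale_sum_left by (intro sum.cong refl) simp
    also have "\<dots> = (\<Sum>w\<in>permutations_of_set {..<d}. Poly_Mapping.lookup x (map ((!) kk) w) *\<^sub>C tensor (map l w))"
      by (intro sum.cong refl) (auto simp: in_keys_iff)
    finally show ?thesis .
  qed
  also have "\<dots> = (\<Sum>s | s permutes {..<d}. Poly_Mapping.lookup x (map ((!) kk) (map s [0..<d])) *\<^sub>C tensor (map l (map s [0..<d])))"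
    by (rule sum.reindex_bij_betw[OF bij_betw_permutations_of_set, symmetric])
  also have "\<dots> = (\<Sum>s | s permutes {..<d}. Poly_Mapping.lookup x (permute_list s kk) *\<^sub>C
    tperm s (tperm t (ltensor n d)))"
  proof (intro sum.cong refl)
    fix s assume "s \<in> {s. s permutes {..<d}}"
    then have s: "s permutes {..<d}" by simp
    have "tperm s (tperm t (ltensor n d)) = tperm (t \<circ> s) (tensor (map (lvec n) [0..<d]))"
      using tperm_tperm[OF ltensor_homog s] by (simp add: ltensor_def)
    also have "\<dots> = tensor (permute_list (t \<circ> s) (map (lvec n) [0..<d]))"
      using permutes_compose[OF s t] by (intro tperm_tensor) simp
    also have "permute_list (t \<circ> s) (map (lvec n) [0..<d]) = map l (map s [0..<d])"
      using permutes_in_image[OF s] permutes_in_image[OF t] by (auto simp: permute_list_def l_def)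
    finally show "Poly_Mapping.lookup x (map ((!) kk) (map s [0..<d])) *\<^sub>C tensor (map l (map s [0..<d])) =
      Poly_Mapping.lookup x (permute_list s kk) *\<^sub>C tperm s (tperm t (ltensor n d))"
      using kk by (simp add: permute_list_def o_def)
  qed
  finally have eq: "?D x = \<dots>" .
  have "derivs l u J x \<in> N \<and> derivs l u J x \<in> homog d" if "set J \<subseteq> {..<d}" for J
    using that
  proof (induction J)
    case Nil
    then show ?case using x by (simp add: derivs_def)
  next
    case (Cons j J)
    then have "derivs l u J x \<in> N" "derivs l u J x \<in> homog d" "omega (l j) (u j) = 0"
      using lu by auto
    then have "derivation (symop (l j) (u j)) (derivs l u J x) \<in> N"
      using derivation_submodule[OF N, of "derivs l u J x" d "l j" "u j"]
      by (simp add: l_def u_def lvec_W dual_vec_W)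
    then show ?case using Cons by (simp add: derivs_Cons derivation_homog clinear_symop)
  qed
  from this[of "[0..<d]"] have "?D x \<in> N" by (simp add: atLeast0LessThan)
  then show ?thesis unfolding eq .
qed

section \<open>Irreducibility of the traceless part of the image of a Young symmetrizer\<close>

lemma galg_small: "galg d P \<Longrightarrow> x \<in> homog d \<Longrightarrow> x \<in> small n \<Longrightarrow> P x \<in> small n"
  by (rule galg_closed) (auto intro: subspace_small tperm_small)

text \<open>Positive definiteness is used twice: Q' Q x has norm 0 because Q Q' Q x = 0, and then Q
  x has norm 0 because Q' Q x = 0.\<close>

lemma adjoint_cancel:
  assumes "galg d Q" "galg d Q'" "x \<in> homog d"
    and adj: "\<And>x y. x \<in> homog d \<Longrightarrow> y \<in> homog d \<Longrightarrow> inner (Q x) y = inner x (Q' y)"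
      "\<And>x y. x \<in> homog d \<Longrightarrow> y \<in> homog d \<Longrightarrow> inner (Q' x) y = inner x (Q y)"
    and zero: "Q (Q' (Q x)) = 0"
  shows "Q x = 0"
proof -
  have h: "Q x \<in> homog d" "Q' (Q x) \<in> homog d"
    using assms(1-3) by (auto intro: galg_homog)
  have "inner (Q' (Q x)) (Q' (Q x)) = inner (Q (Q' (Q x))) (Q x)" using adj(1) h by simp
  then have "Q' (Q x) = 0" using zero by (simp add: inner_0 inner_self)
  then have "inner (Q x) (Q x) = 0" using adj(2)[of "Q x" x] h assms(3) by (simp add: inner_0)
  then show ?thesis by (simp add: inner_self)
qed

text \<open>The module of the theorem for the embedding given by inclusion of the image of the Young
  symmetrizer.\<close>

definition traceless_schur :: "nat list \<Rightarrow> (idx list \<Rightarrow>\<^sub>0 complex) set"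
  where "traceless_schur p = schur p W \<inter> traceless (sum_list p)"

section \<open>The image of the Young symmetrizer as a module, and its generator\<close>

lemma subspace_schur: "cvec.subspace (schur p U)"
proof -
  note ar = galg_arg[OF galg_young_sym, of _ p]
  show ?thesis
    unfolding cvec.subspace_def schur_def
  proof (intro conjI ballI allI)
    show "0 \<in> young_sym p ` tpower U (sum_list p)"
      using galg_0[OF galg_young_sym, of p] cvec.subspace_0[OF subspace_tpower] by (metis image_eqI)
    fix x y c
    assume "x \<in> young_sym p ` tpower U (sum_list p)"
    then obtain x' where x: "x = young_sym p x'" "x' \<in> tpower U (sum_list p)" by blast
    show "c *\<^sub>C x \<in> young_sym p ` tpower U (sum_list p)"
      using x ar(2)[of x' x'] cvec.subspace_scale[OF subspace_tpower x(2)] tpower_homog[OF x(2)]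
      by (metis image_eqI)
    assume "y \<in> young_sym p ` tpower U (sum_list p)"
    then obtain y' where y: "y = young_sym p y'" "y' \<in> tpower U (sum_list p)" by blast
    show "x + y \<in> young_sym p ` tpower U (sum_list p)"
      using x y ar(1)[of x' y'] cvec.subspace_add[OF subspace_tpower x(2) y(2)] tpower_homog
      by (metis image_eqI)
  qed
qed

lemma tmap_schur:
  assumes "clinear g" "g ` U \<subseteq> U" "x \<in> schur p U"
  shows "tmap g x \<in> schur p U"
  using assms galg_tmap[OF galg_young_sym assms(1)] tmap_tpower[OF assms(1,2)] tpower_homog
  unfolding schur_def by fastforce

lemma schur_homog: "x \<in> schur p U \<Longrightarrow> x \<in> homog (sum_list p)"
  unfolding schur_def using galg_homog[OF galg_young_sym] tpower_homog by blast

lemma submodule_traceless_schur: "submodule_under H tmap (traceless_schur p)"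
  unfolding submodule_under_def traceless_schur_def
  using cvec.subspace_inter[OF subspace_schur subspace_traceless]
  by (auto intro: tmap_traceless tmap_schur[OF H_D(1) H_D(3)])

lemma young_sym_ltensor: "young_sym p (ltensor n (sum_list p)) \<in> traceless_schur p"
  "young_sym p (ltensor n (sum_list p)) \<noteq> 0"
  using galg_traceless[OF galg_young_sym ltensor_traceless] ltensor_traceless[of n "sum_list p"]
    young_sym_generic_nonzero[OF generic_ltensor]
  by (auto simp: traceless_schur_def schur_def traceless_def)

lemma young_sym_adjoint_schur:
  assumes "is_partition p"
  obtains c' s where "galg (sum_list p) c'" "s \<noteq> 0"
    "\<And>y z :: idx list \<Rightarrow>\<^sub>0 complex. y \<in> homog (sum_list p) \<Longrightarrow> z \<in> homog (sum_list p) \<Longrightarrow>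
      inner (young_sym p y) z = inner y (c' z)"
    "\<And>y z :: idx list \<Rightarrow>\<^sub>0 complex. y \<in> homog (sum_list p) \<Longrightarrow> z \<in> homog (sum_list p) \<Longrightarrow>
      inner (c' y) z = inner y (young_sym p z)"
    "\<And>y :: idx list \<Rightarrow>\<^sub>0 complex. y \<in> schur p W \<Longrightarrow> young_sym p (c' y) = s *\<^sub>C y"
proof -
  obtain c' :: "(idx list \<Rightarrow>\<^sub>0 complex) \<Rightarrow> (idx list \<Rightarrow>\<^sub>0 complex)" and s where c: "galg (sum_list p) c'" "s \<noteq> 0"
    "\<And>y z. y \<in> homog (sum_list p) \<Longrightarrow> z \<in> homog (sum_list p) \<Longrightarrow> inner (young_sym p y) z = inner y (c' z)"
    "\<And>y z. y \<in> homog (sum_list p) \<Longrightarrow> z \<in> homog (sum_list p) \<Longrightarrow> inner (c' y) z = inner y (young_sym p z)"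
    "\<And>y. y \<in> homog (sum_list p) \<Longrightarrow> young_sym p (c' (young_sym p y)) = s *\<^sub>C young_sym p y"
    using young_sym_adjoint[OF assms generic_ltensor[of 0 "sum_list p"]] by auto
  have "young_sym p (c' y) = s *\<^sub>C y" if "y \<in> schur p W" for y
    using that c(5) tpower_homog unfolding schur_def by blast
  with c show ?thesis using that by blast
qed

lemma submodule_contains_generator:
  assumes p: "is_partition p" and N: "submodule_under H tmap N" "N \<subseteq> traceless_schur p"
    and x: "x \<in> N" "x \<noteq> 0" "x \<in> small n"
  shows "young_sym p (ltensor n (sum_list p)) \<in> N"
proof -
  let ?d = "sum_list p" and ?c = "young_sym p"
  let ?L = "ltensor n ?d"
  have subsp: "cvec.subspace N" using N(1) by (simp add: submodule_under_def)
  have xh: "x \<in> homog ?d" using x(1) N(2) schur_homog by (auto simp: traceless_schur_def)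
  obtain kk where kk: "Poly_Mapping.lookup x kk \<noteq> 0" using x(2) by (metis lookup_zero poly_mapping_eqI)
  then have kk': "length kk = ?d" "\<forall>k\<in>set kk. idx_pos k < n"
    using xh x(3) by (auto simp: homog_def small_def in_keys_iff)
  define Q :: "(idx list \<Rightarrow>\<^sub>0 complex) \<Rightarrow> (idx list \<Rightarrow>\<^sub>0 complex)"
    where "Q y = (\<Sum>s | s permutes {..<?d}. Poly_Mapping.lookup x (permute_list s kk) *\<^sub>C tperm s y)" for y
  have Q: "galg ?d Q" unfolding Q_def by (intro galg_sum galg_scale galg_tperm) simp
  have clQ: "clinear Q"
    unfolding Q_def by (intro clinear_sums clinear_scaled clinear_tperm)
  have QPL: "Q (P ?L) \<in> N" if P: "galg ?d P" for P :: "(idx list \<Rightarrow>\<^sub>0 complex) \<Rightarrow> (idx list \<Rightarrow>\<^sub>0 complex)"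
  proof -
    obtain f where "\<forall>x\<in>homog ?d. P x = (\<Sum>t | t permutes {..<?d}. f t *\<^sub>C tperm t x)"
      using P unfolding galg_def by blast
    then have "P ?L = (\<Sum>t | t permutes {..<?d}. f t *\<^sub>C tperm t ?L)"
      using ltensor_homog by blast
    moreover have "Q (tperm t ?L) \<in> N" if "t permutes {..<?d}" for t
      unfolding Q_def by (rule multilinear_in_submodule[OF N(1) x(1) xh x(3) kk' that])
    ultimately show ?thesis
      by (auto simp: clinear_sum[OF clQ] clinear_scale[OF clQ] intro!: cvec.subspace_sum[OF subsp]
        cvec.subspace_scale[OF subsp])
  qed
  \<comment> \<open>By genericity of \<open>?L\<close> the coefficient at its leading word isolates
    the identity in \<open>Q\<close>, whose coefficient is that of \<open>kk\<close> in
    \<open>x\<close>.\<close>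
  have "Q ?L \<noteq> 0"
  proof -
    let ?w = "map (\<lambda>i. E (n + 2 * i)) [0..<?d]"
    have "Poly_Mapping.lookup (Q ?L) ?w = (\<Sum>s | s permutes {..<?d}.
        Poly_Mapping.lookup x (permute_list s kk) * (if s = id then 1 else 0))"
      unfolding Q_def lookup_sum
      using lookup_tperm_generic[OF generic_ltensor, of _ n ?d id] permutes_id by (auto intro!: sum.cong)
    also have "\<dots> = Poly_Mapping.lookup x kk"
      by (simp add: finite_perms permutes_id if_distrib[of "(*) _"] cong: if_cong)
    finally show ?thesis using kk by auto
  qed
  obtain c' s where c': "galg ?d c'" "s \<noteq> 0"
    "\<And>y :: idx list \<Rightarrow>\<^sub>0 complex. y \<in> schur p W \<Longrightarrow> ?c (c' y) = s *\<^sub>C y"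
    using young_sym_adjoint_schur[OF p] by metis
  have sN: "?c (c' z) = s *\<^sub>C z" if "z \<in> N" for z using that N(2) c'(3) by (auto simp: traceless_schur_def)
  obtain Q' where Q': "galg ?d Q'"
    "\<And>x y. x \<in> homog ?d \<Longrightarrow> y \<in> homog ?d \<Longrightarrow> inner (Q x) y = inner x (Q' y)"
    "\<And>x y. x \<in> homog ?d \<Longrightarrow> y \<in> homog ?d \<Longrightarrow> inner (Q' x) y = inner x (Q y)"
    using galg_adjoint[OF Q] by blast
  \<comment> \<open>The adjoint \<open>Q'\<close> makes \<open>v\<close> nonzero: otherwise \<open>Q Q' c = 0\<close>, and \<open>c c' Q L = s Q L\<close>
    would give \<open>Q Q' Q L = 0\<close>.\<close>
  define v where "v = Q (Q' (?c ?L))"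
  have vN: "v \<in> N" unfolding v_def by (rule QPL) (intro galg_comp[OF Q'(1)] galg_young_sym)
  have "v \<noteq> 0"
  proof
    assume "v = 0"
    have QQ: "galg ?d (\<lambda>y. Q (Q' (?c y)))" by (intro galg_comp[OF Q] galg_comp[OF Q'(1)] galg_young_sym)
    have QL: "Q ?L \<in> N" using QPL[OF galg_tperm[OF permutes_id]] by (simp add: tperm_id)
    have h: "Q ?L \<in> homog ?d" "c' (Q ?L) \<in> homog ?d"
      using galg_homog[OF Q ltensor_homog] galg_homog[OF c'(1)] by auto
    have "Q (Q' (?c (c' (Q ?L)))) = 0"
      using galg_generic[of "map (\<lambda>i. E (n + 2 * i)) [0..<?d]" "\<lambda>y. Q (Q' (?c y))" ?L "c' (Q ?L)"]
        QQ h \<open>v = 0\<close> generic_ltensor[of n ?d] by (simp add: v_def)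
    then have "s *\<^sub>C Q (Q' (Q ?L)) = 0"
      using sN[OF QL] galg_arg(2)[OF galg_comp[OF Q Q'(1)] h(1) h(1)] by simp
    then have "Q (Q' (Q ?L)) = 0" using c'(2) by simp
    then have "Q ?L = 0"
      by (rule adjoint_cancel[OF Q Q'(1) ltensor_homog, rotated 2]) (use Q'(2,3) in auto)
    then show False using \<open>Q ?L \<noteq> 0\<close> by blast
  qed
  \<comment> \<open>Since v lies in the image of c, s v equals c c' v. This supplies the outer
    symmetrizer, and the sandwich property turns c c' Q Q' c into a multiple of c.\<close>
  have "galg ?d (\<lambda>y. c' (Q (Q' y)))" by (intro galg_comp[OF c'(1)] galg_comp[OF Q] Q'(1))
  then obtain r where "\<And>y. y \<in> homog ?d \<Longrightarrow> ?c (c' (Q (Q' (?c y)))) = r *\<^sub>C ?c y"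
    using young_sym_sandwich[OF p] by metis
  then have rv: "s *\<^sub>C v = r *\<^sub>C ?c ?L" using sN[OF vN] ltensor_homog by (simp add: v_def)
  then have "r \<noteq> 0" using \<open>v \<noteq> 0\<close> c'(2) by auto
  moreover have "r *\<^sub>C ?c ?L \<in> N" unfolding rv[symmetric] by (rule cvec.subspace_scale[OF subsp vN])
  ultimately show ?thesis using subspace_unscale[OF subsp] by blast
qed

text \<open>The preimage of \<open>N\<close> under the symmetrizer is a submodule containing
  \<open>ltensor\<close>, hence it contains every traceless tensor of bounded support. In particular
  it contains c' y, which the symmetrizer maps to a nonzero multiple of y.\<close>

lemma generator_generates:
  assumes p: "is_partition p" and N: "submodule_under H tmap N"
    and L: "young_sym p (ltensor n (sum_list p)) \<in> N" and y: "y \<in> traceless_schur p" "y \<in> small n"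
  shows "y \<in> N"
proof -
  let ?d = "sum_list p" and ?c = "young_sym p"
  have subsp: "cvec.subspace N" using N by (simp add: submodule_under_def)
  define N' where "N' = {z \<in> homog ?d. ?c z \<in> N}"
  have "submodule_under H tmap N'"
    unfolding submodule_under_def
  proof (intro conjI ballI)
    show "cvec.subspace N'"
      unfolding cvec.subspace_def N'_def
      using subsp
      by (auto simp: cvec.subspace_def homog_0 homog_add homog_scale galg_arg[OF galg_young_sym]
        galg_0[OF galg_young_sym])
    fix g z assume "g \<in> H" "z \<in> N'"
    then show "tmap g z \<in> N'"
      using galg_tmap[OF galg_young_sym, of g z p] H_D(1)[of g] N
      by (auto simp: N'_def tmap_homog submodule_under_def) metis
  qed
  moreover have "ltensor n ?d \<in> N'" using L by (simp add: N'_def ltensor_homog)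
  ultimately have gen: "z \<in> N'" if "z \<in> traceless ?d" "z \<in> small n" for z
    using traceless_generated[of N' n ?d ?d z] that by simp
  obtain c' s where c': "galg ?d c'" "s \<noteq> 0"
    "\<And>y :: idx list \<Rightarrow>\<^sub>0 complex. y \<in> schur p W \<Longrightarrow> ?c (c' y) = s *\<^sub>C y"
    using young_sym_adjoint_schur[OF p] by metis
  have "c' y \<in> N'"
    using y galg_traceless[OF c'(1)] galg_small[OF c'(1)] traceless_homog
    by (intro gen) (auto simp: traceless_schur_def)
  then have "s *\<^sub>C y \<in> N" using c'(3) y by (simp add: N'_def traceless_schur_def)
  then show ?thesis using subspace_unscale[OF subsp] c'(2) by blast
qed

lemma irreducible_traceless_schur:
  assumes "is_partition p"
  shows "irreducible_module H tmap (traceless_schur p)"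
  unfolding irreducible_module_def
proof (intro conjI allI impI)
  show "submodule_under H tmap (traceless_schur p)" by (rule submodule_traceless_schur)
  show "traceless_schur p \<noteq> {0}" using young_sym_ltensor[of p 0] by auto
  fix N assume N: "submodule_under H tmap N \<and> N \<subseteq> traceless_schur p"
  show "N = {0} \<or> N = traceless_schur p"
  proof (cases "N = {0}")
    case False
    have "0 \<in> N" using N cvec.subspace_0 by (auto simp: submodule_under_def)
    then obtain x where x: "x \<in> N" "x \<noteq> 0" using False by auto
    have "y \<in> N" if y: "y \<in> traceless_schur p" for y
    proof -
      \<comment> \<open>The generator depends on the bound of the supports, so the bound has to
        serve the given element of \<open>N\<close> and the target at once.\<close>
      obtain a b where "x \<in> small a" "y \<in> small b" using small_exists by metis
      then have "x \<in> small (max a b)" "y \<in> small (max a b)"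
        using small_mono[of a "max a b"] small_mono[of b "max a b"] by auto
      then show ?thesis
        using generator_generates[OF assms _ submodule_contains_generator[OF assms _ _ x] y] N by blast
    qed
    then show ?thesis using N by blast
  qed simp
qed

section \<open>Embeddings of Schur functors\<close>

lemma lin_ext_subspace: "cvec.subspace S \<Longrightarrow> (\<And>k. b k \<in> S) \<Longrightarrow> lin_ext b x \<in> S"
  unfolding lin_ext_def by (intro cvec.subspace_sum cvec.subspace_scale)

lemma subspace_W: "cvec.subspace W"
  by (simp add: cvec.subspace_def W_def xi_add xi_scale xi_linfun[of 0] linfun_def)

text \<open>A linear map with arbitrary prescribed values on the vectors \<open>lvec 0 i\<close>:
  the first basis vector of each block takes the value, everything else goes to 0. It specializes
  \<open>ltensor 0 d\<close> to any pure tensor of degree d.\<close>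

definition spread :: "(nat \<Rightarrow> V) \<Rightarrow> V \<Rightarrow> V"
  where "spread f = lin_ext (\<lambda>k. case k of E i \<Rightarrow> if even i then f (i div 2) else 0 | F i \<Rightarrow> 0)"

lemma clinear_spread: "clinear (spread f)"
  unfolding spread_def by (rule clinear_lin_ext)

lemma spread_bvec: "spread f (bvec (E i)) = (if even i then f (i div 2) else 0)" "spread f (bvec (F i)) = 0"
  by (simp_all add: spread_def)

lemma spread_lvec: "spread f (lvec 0 i) = f i"
  by (simp add: lvec_def clinear_diff[OF clinear_spread] spread_bvec)

lemma spread_W: "(\<And>i. f i \<in> W) \<Longrightarrow> spread f x \<in> W"
  unfolding spread_def
  by (rule lin_ext_subspace[OF subspace_W])
    (auto intro: cvec.subspace_0[OF subspace_W] split: idx.split)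

lemma tmap_spread_ltensor: "tmap (spread f) (ltensor 0 d) = tensor (map f [0..<d])"
  by (simp add: ltensor_def tmap_tensor clinear_spread o_def spread_lvec)

lemma tensor_zero: "0 \<in> set vs \<Longrightarrow> tensor vs = 0"
  by (induction vs) (auto simp: tcons_left tcons_right)

text \<open>The value of an embedding on the Young symmetrizer of \<open>ltensor 0 d\<close> is multilinear in the
  factors of \<open>ltensor 0 d\<close>: compare it with its images under the projections to the span of the
  \<open>lvec 0 i\<close> with \<open>i \<in> S\<close>.\<close>

lemma schur_embedding_generic:
  assumes emb: "schur_embedding p W \<phi>"
  obtains a where "galg (sum_list p) a"
    "\<phi> (young_sym p (ltensor 0 (sum_list p))) = a (ltensor 0 (sum_list p))"
proof -
  let ?d = "sum_list p" and ?c = "young_sym p"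
  let ?L = "ltensor 0 ?d"
  define pr where "pr S = spread (\<lambda>i. if i \<in> S then lvec 0 i else 0)" for S
  define y where "y = \<phi> (?c ?L)"
  have cL: "?c ?L \<in> schur p W" using young_sym_ltensor(1)[of p 0] by (simp add: traceless_schur_def)
  have pr: "clinear (pr S)" "pr S ` W \<subseteq> W" for S
    using clinear_spread spread_W[of "\<lambda>i. if i \<in> S then lvec 0 i else 0"]
    by (auto simp: pr_def lvec_W cvec.subspace_0[OF subspace_W])
  have pry: "tmap (pr S) y = \<phi> (?c (tmap (pr S) ?L))" for S
  proof -
    have "tmap (pr S) y = \<phi> (tmap (pr S) (?c ?L))"
      using emb cL pr[of S] unfolding schur_embedding_def y_def by metis
    then show ?thesis by (simp add: galg_tmap[OF galg_young_sym pr(1) ltensor_homog])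
  qed
  have y1: "tmap (pr {..<?d}) y = y"
  proof -
    have "map (\<lambda>i. if i \<in> {..<?d} then lvec 0 i else 0) [0..<?d] = map (lvec 0) [0..<?d]" by simp
    then have "tmap (pr {..<?d}) ?L = ?L" unfolding pr_def tmap_spread_ltensor by (simp only: ltensor_def)
    then show ?thesis unfolding pry by (simp add: y_def)
  qed
  have y0: "tmap (pr ({..<?d} - {i})) y = 0" if "i < ?d" for i
  proof -
    have "tmap (pr ({..<?d} - {i})) ?L = 0"
      unfolding pr_def tmap_spread_ltensor using that by (intro tensor_zero) force
    then show ?thesis
      using emb by (simp add: pry schur_embedding_def clinear_0 galg_0[OF galg_young_sym])
  qed
  have "y \<in> tpower W ?d" using emb cL unfolding schur_embedding_def y_def by blast
  then have yh: "y \<in> homog ?d" by (rule tpower_homog)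
  let ?ew = "map (\<lambda>i. E (2 * i))"
  have look: "Poly_Mapping.lookup (pr S (bvec k)) (E (2 * j)) = (if k = E (2 * j) \<and> j \<in> S then 1 else 0)" for S k j
  proof (cases k)
    case (E i)
    show ?thesis
    proof (cases "even i")
      case True
      then obtain i' where "i = 2 * i'" by blast
      then show ?thesis using E lookup_lvec[of 0 i' j] by (auto simp: pr_def spread_bvec)
    next
      case False
      then have "i \<noteq> 2 * j" by presburger
      then show ?thesis using E False by (simp add: pr_def spread_bvec)
    qed
  qed (simp add: pr_def spread_bvec)
  \<comment> \<open>Among all letters only \<open>E (2 * j)\<close> itself is projected to a vector
    involving \<open>E (2 * j)\<close>, so coefficients at such words are unchanged as long as all
    their indices lie in \<open>S\<close>.\<close>
  have lookw: "Poly_Mapping.lookup (tmap (pr S) y) (?ew w) = Poly_Mapping.lookup y (?ew w)"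
    if w: "length w = ?d" "set w \<subseteq> S" for S w
  proof -
    have "Poly_Mapping.lookup (tensor (map (\<lambda>k. pr S (bvec k)) ks)) (?ew w) = (if ks = ?ew w then 1 else 0)"
      if "ks \<in> Poly_Mapping.keys y" for ks
    proof -
      have ks: "length ks = ?d" using that yh by (simp add: homog_def)
      have "Poly_Mapping.lookup (tensor (map (\<lambda>k. pr S (bvec k)) ks)) (?ew w) =
          (\<Prod>q<?d. if ks ! q = E (2 * w ! q) then 1 else 0)"
      proof -
        have "w ! q \<in> S" if "q < ?d" for q using w that by (auto simp: subset_iff)
        then show ?thesis using ks w by (auto simp: lookup_tensor look intro!: prod.cong)
      qed
      also have "\<dots> = (if \<forall>q<?d. ks ! q = E (2 * w ! q) then 1 else 0)"
        by (auto intro!: prod.neutral prod_zero)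
      also have "(\<forall>q<?d. ks ! q = E (2 * w ! q)) \<longleftrightarrow> ks = ?ew w"
        using ks w by (auto simp: list_eq_iff_nth_eq)
      finally show ?thesis .
    qed
    then have "Poly_Mapping.lookup (tmap (pr S) y) (?ew w) =
        (\<Sum>ks\<in>Poly_Mapping.keys y. Poly_Mapping.lookup y ks * (if ks = ?ew w then 1 else 0))"
      unfolding tmap_def lin_ext_def lookup_sum by (intro sum.cong) simp_all
    also have "\<dots> = Poly_Mapping.lookup y (?ew w)"
      by (simp add: if_distrib[of "(*) _"] in_keys_iff cong: if_cong)
    finally show ?thesis .
  qed
  define S where "S = {z. \<exists>a. galg ?d a \<and> z = a ?L}"
  have S: "cvec.subspace S"
    unfolding cvec.subspace_def
  proof (intro conjI ballI allI)
    show "0 \<in> S" unfolding S_def using galg_zero by blast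
    show "z + z' \<in> S" if "z \<in> S" "z' \<in> S" for z z' using that unfolding S_def by (auto intro: galg_add)
    show "c *\<^sub>C z \<in> S" if "z \<in> S" for c z using that unfolding S_def by (auto intro: galg_scale)
  qed
  have summand: "tensor (map (\<lambda>k. pr {..<?d} (bvec k)) ks) \<in> S" if ks: "ks \<in> Poly_Mapping.keys y" for ks
  proof (cases "\<forall>k\<in>set ks. pr {..<?d} (bvec k) \<noteq> 0")
    case False
    then have "tensor (map (\<lambda>k. pr {..<?d} (bvec k)) ks) = 0" by (intro tensor_zero) force
    then show ?thesis using cvec.subspace_0[OF S] by simp
  next
    case True
    have "\<exists>i<?d. k = E (2 * i)" if "k \<in> set ks" for k
    proof (cases k)
      case (E i)
      then show ?thesis
        using True that by (intro exI[of _ "i div 2"]) (auto simp: pr_def spread_bvec split: if_splits)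
    next
      case (F i)
      then show ?thesis using True that by (auto simp: pr_def spread_bvec)
    qed
    then have "\<forall>k\<in>set ks. \<exists>i. i < ?d \<and> k = E (2 * i)" by blast
    then obtain h where h: "\<And>k. k \<in> set ks \<Longrightarrow> h k < ?d \<and> k = E (2 * h k)" by metis
    define w where "w = map h ks"
    have w: "length w = ?d" "set w \<subseteq> {..<?d}" "ks = ?ew w"
      using ks yh h by (auto simp: w_def homog_def o_def map_idI[symmetric])
    \<comment> \<open>If the index i were missing from \<open>w\<close>, the projection omitting i
      would keep the coefficient of \<open>y\<close> at this word, although it annihilates
      \<open>y\<close>.\<close>
    have "{..<?d} \<subseteq> set w"
    proof
      fix i assume "i \<in> {..<?d}"
      show "i \<in> set w"
      proof (rule ccontr)
        assume "i \<notin> set w"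
        then have "Poly_Mapping.lookup y (?ew w) = 0"
          using lookw[of w "{..<?d} - {i}"] y0[of i] w(1,2) \<open>i \<in> {..<?d}\<close> by auto
        then show False using ks w(3) by (simp add: in_keys_iff)
      qed
    qed
    then have "set w = {..<?d}" using w(2) by blast
    moreover from this have "distinct w" using w(1) by (intro card_distinct) simp
    ultimately have "w \<in> (\<lambda>s. map s [0..<?d]) ` {s. s permutes {..<?d}}"
      using bij_betw_imp_surj_on[OF bij_betw_permutations_of_set[of ?d]]
      by (simp add: permutations_of_set_def)
    then obtain s where s: "s permutes {..<?d}" "w = map s [0..<?d]" by blast
    have "map (\<lambda>k. pr {..<?d} (bvec k)) ks = map (lvec 0) w"
      using w(2) unfolding w(3) by (auto simp: pr_def spread_bvec)
    also have "\<dots> = permute_list s (map (lvec 0) [0..<?d])"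
      using permutes_in_image[OF s(1)] by (auto simp: s(2) permute_list_def)
    finally have "tensor (map (\<lambda>k. pr {..<?d} (bvec k)) ks) = tperm s ?L"
      using tperm_tensor[of s "map (lvec 0) [0..<?d]"] s(1) by (simp add: ltensor_def)
    then show ?thesis using galg_tperm[OF s(1)] by (auto simp: S_def)
  qed
  have "y = (\<Sum>ks\<in>Poly_Mapping.keys y. Poly_Mapping.lookup y ks *\<^sub>C tensor (map (\<lambda>k. pr {..<?d} (bvec k)) ks))"
    using y1 by (simp add: tmap_def lin_ext_def)
  also have "\<dots> \<in> S" by (intro cvec.subspace_sum[OF S] cvec.subspace_scale[OF S] summand)
  finally show ?thesis using that by (auto simp: S_def y_def)
qed

text \<open>Every pure tensor over \<open>W\<close> is the image of \<open>ltensor 0 d\<close> under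
  an endomorphism preserving \<open>W\<close>. Naturality of the embedding and of the group algebra
  carries the formula from \<open>ltensor\<close> to it.\<close>

lemma schur_embedding_galg:
  assumes emb: "schur_embedding p W \<phi>"
  obtains a where "galg (sum_list p) a"
    "\<And>x. x \<in> tpower W (sum_list p) \<Longrightarrow> \<phi> (young_sym p x) = a x"
proof -
  let ?d = "sum_list p" and ?c = "young_sym p"
  let ?L = "ltensor 0 ?d"
  obtain a where a: "galg ?d a" "\<phi> (?c ?L) = a ?L" using schur_embedding_generic[OF emb] by blast
  obtain a' where a': "clinear a'" "\<And>x. x \<in> homog ?d \<Longrightarrow> a x = a' x" using galg_linear[OF a(1)] by blast
  obtain c' :: "(idx list \<Rightarrow>\<^sub>0 complex) \<Rightarrow> (idx list \<Rightarrow>\<^sub>0 complex)"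
    where c': "clinear c'" "\<And>x. x \<in> homog ?d \<Longrightarrow> ?c x = c' x"
    using galg_linear[OF galg_young_sym] by blast
  have phi: "clinear \<phi>" using emb by (simp add: schur_embedding_def)
  have "\<phi> (c' x) = a' x" if "x \<in> tpower W ?d" for x
  proof (rule clinear_eq_tpower[OF clinear_compose[OF phi c'(1)] a'(1) _ that])
    fix vs :: "V list" assume vs: "length vs = ?d" "set vs \<subseteq> W"
    define g where "g = spread (\<lambda>i. if i < ?d then vs ! i else 0)"
    have "(if i < ?d then vs ! i else 0) \<in> W" for i
      using vs nth_mem[of i vs] cvec.subspace_0[OF subspace_W] by auto
    then have g: "clinear g" "g ` W \<subseteq> W"
      unfolding g_def by (auto intro!: clinear_spread spread_W)
    have "map (\<lambda>i. if i < ?d then vs ! i else 0) [0..<?d] = vs"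
      using vs by (intro nth_equalityI) auto
    then have gL: "tmap g ?L = tensor vs" unfolding g_def tmap_spread_ltensor by simp
    have "\<phi> (?c (tmap g ?L)) = \<phi> (tmap g (?c ?L))"
      by (simp add: galg_tmap[OF galg_young_sym g(1) ltensor_homog])
    also have "\<dots> = tmap g (a ?L)"
      using emb g young_sym_ltensor(1)[of p 0] a(2) by (auto simp: schur_embedding_def traceless_schur_def)
    also have "\<dots> = a (tmap g ?L)" by (rule galg_tmap[OF a(1) g(1) ltensor_homog])
    finally show "\<phi> (c' (tensor vs)) = a' (tensor vs)"
      unfolding gL using a'(2) c'(2) tensor_homog[OF vs(1)] by simp
  qed
  then have "\<phi> (?c x) = a x" if "x \<in> tpower W ?d" for x
    using that a'(2) c'(2) tpower_homog[OF that] by simp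
  with a(1) show ?thesis using that by blast
qed

text \<open>On the image of the symmetrizer the embedding acts as the group algebra element b = a c'
  / s and so preserves tracelessness. Conversely c c' b' b c = r c with r nonzero, so that a nonzero
  multiple of x is recovered from its image by the group algebra.\<close>

lemma schur_embedding_traceless:
  assumes p: "is_partition p" and emb: "schur_embedding p W \<phi>" and x: "x \<in> schur p W"
  shows "\<phi> x \<in> traceless (sum_list p) \<longleftrightarrow> x \<in> traceless (sum_list p)"
proof -
  let ?d = "sum_list p" and ?c = "young_sym p"
  obtain a where a: "galg ?d a" "\<And>x. x \<in> tpower W ?d \<Longrightarrow> \<phi> (?c x) = a x"
    using schur_embedding_galg[OF emb] by blast
  have phi: "clinear \<phi>" using emb by (simp add: schur_embedding_def)
  obtain c' s where c': "galg ?d c'" "s \<noteq> 0"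
    "\<And>y z :: idx list \<Rightarrow>\<^sub>0 complex. y \<in> homog ?d \<Longrightarrow> z \<in> homog ?d \<Longrightarrow> inner (?c y) z = inner y (c' z)"
    "\<And>y z :: idx list \<Rightarrow>\<^sub>0 complex. y \<in> homog ?d \<Longrightarrow> z \<in> homog ?d \<Longrightarrow> inner (c' y) z = inner y (?c z)"
    "\<And>y :: idx list \<Rightarrow>\<^sub>0 complex. y \<in> schur p W \<Longrightarrow> ?c (c' y) = s *\<^sub>C y"
    using young_sym_adjoint_schur[OF p] by metis
  define b where "b y = inverse s *\<^sub>C a (c' y)" for y
  have b: "galg ?d b" unfolding b_def by (intro galg_scale galg_comp[OF a(1)] c'(1))
  have phi_b: "\<phi> z = b z" if z: "z \<in> schur p W" for z
  proof -
    obtain z' where "z = ?c z'" "z' \<in> tpower W ?d" using z by (auto simp: schur_def)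
    then have "z \<in> tpower W ?d" using galg_tpower[OF galg_young_sym] by blast
    then have "\<phi> (?c (c' z)) = a (c' z)" using a(2) galg_tpower[OF c'(1)] by blast
    then have "s *\<^sub>C \<phi> z = a (c' z)" using c'(5)[OF z] by (simp add: clinear_scale[OF phi])
    then have "inverse s *\<^sub>C s *\<^sub>C \<phi> z = b z" unfolding b_def by (rule arg_cong)
    then show ?thesis using c'(2) by simp
  qed
  obtain b' where b': "galg ?d b'"
    "\<And>x y. x \<in> homog ?d \<Longrightarrow> y \<in> homog ?d \<Longrightarrow> inner (b x) y = inner x (b' y)"
    "\<And>x y. x \<in> homog ?d \<Longrightarrow> y \<in> homog ?d \<Longrightarrow> inner (b' x) y = inner x (b y)"
    using galg_adjoint[OF b] by blast
  have "galg ?d (\<lambda>y. c' (b' (b y)))" by (intro galg_comp[OF c'(1)] galg_comp[OF b'(1)] b)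
  then obtain r where r: "\<And>y. y \<in> homog ?d \<Longrightarrow> ?c (c' (b' (b (?c y)))) = r *\<^sub>C ?c y"
    using young_sym_sandwich[OF p] by metis
  \<comment> \<open>The operators b c and c' b' are adjoint to each other. With r = 0 the
    cancellation rule gives b c L = 0, so the embedding would kill the nonzero element c L.\<close>
  have "r \<noteq> 0"
  proof
    assume "r = 0"
    let ?L = "ltensor 0 ?d"
    have gc: "z \<in> homog ?d \<Longrightarrow> ?c z \<in> homog ?d" for z :: "idx list \<Rightarrow>\<^sub>0 complex"
      by (rule galg_homog[OF galg_young_sym])
    have "b (?c ?L) = 0"
    proof (rule adjoint_cancel[of ?d "\<lambda>z. b (?c z)" "\<lambda>z. c' (b' z)" ?L])
      show "galg ?d (\<lambda>z. b (?c z))" "galg ?d (\<lambda>z. c' (b' z))"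
        by (intro galg_comp[OF b] galg_comp[OF c'(1)] galg_young_sym b'(1))+
      show "b (?c (c' (b' (b (?c ?L))))) = 0"
        using r[OF ltensor_homog] \<open>r = 0\<close> galg_0[OF b] by simp
      show "inner (b (?c y)) z = inner y (c' (b' z))" if "y \<in> homog ?d" "z \<in> homog ?d" for y z
        using that b'(2) c'(3) gc galg_homog[OF b'(1)] by simp
      show "inner (c' (b' y)) z = inner y (b (?c z))" if "y \<in> homog ?d" "z \<in> homog ?d" for y z
        using that b'(3) c'(4) gc galg_homog[OF b'(1)] by simp
    qed (rule ltensor_homog)
    moreover have "?c ?L \<in> schur p W" using young_sym_ltensor(1)[of p 0] by (simp add: traceless_schur_def)
    ultimately have "\<phi> (?c ?L) = \<phi> 0" using phi_b clinear_0[OF phi] by simp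
    moreover have "inj_on \<phi> (schur p W)" using emb by (simp add: schur_embedding_def)
    ultimately have "?c ?L = 0"
      using \<open>?c ?L \<in> schur p W\<close> cvec.subspace_0[OF subspace_schur] by (meson inj_onD)
    then show False using young_sym_ltensor(2) by blast
  qed
  show ?thesis
  proof
    assume "\<phi> x \<in> traceless ?d"
    then have "?c (c' (b' (b x))) \<in> traceless ?d"
      using phi_b[OF x] by (simp add: galg_traceless[OF galg_young_sym] galg_traceless[OF c'(1)]
        galg_traceless[OF b'(1)])
    moreover obtain z where "x = ?c z" "z \<in> homog ?d" using x tpower_homog by (auto simp: schur_def)
    ultimately have "r *\<^sub>C x \<in> traceless ?d" using r by simp
    then show "x \<in> traceless ?d" using subspace_unscale[OF subspace_traceless] \<open>r \<noteq> 0\<close> by blast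
  next
    assume "x \<in> traceless ?d"
    then show "\<phi> x \<in> traceless ?d" using phi_b[OF x] galg_traceless[OF b] by simp
  qed
qed

text \<open>By the comparison of traceless parts, \<phi> restricts to an isomorphism of
  \<open>H\<close>-modules from \<open>traceless_schur p\<close>; submodules of the target are
  pulled back along it.\<close>

theorem proposition3p2:
  fixes p :: "nat list" and \<phi> :: "(idx list \<Rightarrow>\<^sub>0 complex) \<Rightarrow> (idx list \<Rightarrow>\<^sub>0 complex)"
  assumes "is_partition p"
    and "schur_embedding p W \<phi>"
  shows "irreducible_module H tmap (schur_traceless p \<phi>)"
proof -
  let ?M = "traceless_schur p"
  have phi: "clinear \<phi>" "inj_on \<phi> (schur p W)"
    using assms(2) by (simp_all add: schur_embedding_def)
  have eq: "schur_traceless p \<phi> = \<phi> ` ?M"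
    using schur_embedding_traceless[OF assms] by (auto simp: schur_traceless_def traceless_schur_def)
  have equiv: "\<phi> (tmap g x) = tmap g (\<phi> x)" if "g \<in> H" "x \<in> ?M" for g x
    using assms(2) H_D[OF that(1)] that(2) by (simp add: schur_embedding_def traceless_schur_def)
  have M: "submodule_under H tmap ?M" by (rule submodule_traceless_schur)
  then have M0: "cvec.subspace ?M" and MH: "\<And>g x. g \<in> H \<Longrightarrow> x \<in> ?M \<Longrightarrow> tmap g x \<in> ?M"
    by (auto simp: submodule_under_def)
  have sub: "cvec.subspace (\<phi> ` ?M)"
    unfolding cvec.subspace_def
  proof (intro conjI ballI allI)
    show "0 \<in> \<phi> ` ?M" using cvec.subspace_0[OF M0] clinear_0[OF phi(1)] by (metis image_eqI)
  next
    fix x y assume "x \<in> \<phi> ` ?M" "y \<in> \<phi> ` ?M"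
    then obtain x' y' where "x = \<phi> x'" "y = \<phi> y'" "x' \<in> ?M" "y' \<in> ?M" by blast
    then show "x + y \<in> \<phi> ` ?M"
      using cvec.subspace_add[OF M0, of x' y'] clinear_add[OF phi(1), of x' y'] by (metis image_eqI)
  next
    fix x c assume "x \<in> \<phi> ` ?M"
    then obtain x' where "x = \<phi> x'" "x' \<in> ?M" by blast
    then show "c *\<^sub>C x \<in> \<phi> ` ?M"
      using cvec.subspace_scale[OF M0, of x' c] clinear_scale[OF phi(1), of c x'] by (metis image_eqI)
  qed
  have irr: "irreducible_module H tmap ?M" by (rule irreducible_traceless_schur[OF assms(1)])
  show ?thesis
    unfolding irreducible_module_def eq
  proof (intro conjI allI impI)
    show "submodule_under H tmap (\<phi> ` ?M)"
      using sub MH equiv unfolding submodule_under_def by (auto intro: image_eqI simp flip: equiv)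
    obtain x where "x \<in> ?M" "x \<noteq> 0"
      using irr cvec.subspace_0[OF M0] by (auto simp: irreducible_module_def)
    then have "\<phi> x \<noteq> \<phi> 0"
      using phi(2) cvec.subspace_0[OF subspace_schur] by (auto simp: traceless_schur_def dest: inj_onD)
    then show "\<phi> ` ?M \<noteq> {0}" using \<open>x \<in> ?M\<close> clinear_0[OF phi(1)] by auto
    fix N assume N: "submodule_under H tmap N \<and> N \<subseteq> \<phi> ` ?M"
    define N' where "N' = {x \<in> ?M. \<phi> x \<in> N}"
    have "N = \<phi> ` N'" using N by (auto simp: N'_def)
    have "cvec.subspace N" using N by (simp add: submodule_under_def)
    then have "cvec.subspace N'"
      using M0 by (auto simp: cvec.subspace_def N'_def clinear_add[OF phi(1)] clinear_scale[OF phi(1)]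
        clinear_0[OF phi(1)])
    moreover have "tmap g x \<in> N'" if "g \<in> H" "x \<in> N'" for g x
      using that N MH equiv by (auto simp: N'_def submodule_under_def)
    ultimately have "N' = {0} \<or> N' = ?M"
      using irr by (auto simp: irreducible_module_def submodule_under_def N'_def)
    then show "N = {0} \<or> N = \<phi> ` ?M" using \<open>N = \<phi> ` N'\<close> clinear_0[OF phi(1)] by auto
  qed
qed

end
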